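(* Let $M$ be a Riemannian $d$-manifold. The recursive formula $$X \,\mapsto\, \widetilde{X} := \begin{cases} X, & d = 0,\\ \bigsqcup_{x \in X} \{x\} \times \widetilde{\mathrm{ci}(U_x X)}, & d > 0 \end{cases}$$ (where, for $d>0$, $\mathrm{ci}(U_xX)$ is regarded as an element of $\mathfrak{S}_{d-1}(U_xM)$, $U_xM$ being a Riemannian $(d-1)$-manifold) defines an injective map on $\mathfrak{S}_d(M)$ whose image consists of subsets of $\widetilde{M}^{(d)}$, and which satisfies the following properties for all $X, Y \in \mathfrak{S}_d(M)$: 1. $\widetilde{X} \cup \widetilde{Y} = \widetilde{X \cup Y}$. 2. $\widetilde{X} \cap \widetilde{Y} = \widetilde{\mathrm{ci}(X \cap Y)}$.
   Context: Manifolds are smooth, and $\langle\cdot,\cdot\rangle$ is the Riemannian metric. For a subset $A$ of a topological space, $\mathrm{ci}(A) := \mathrm{cl}(\mathrm{int}\, A)$ is the closure of its interior. $\sqcup$, $\bigsqcup$ denote disjoint unions. Let $M$ be a Riemannian $d$-manifold, $x\in M$. Put $U_x M := \{v \in T_xM : \langle v,v\rangle = 1\}$, the unit sphere of $T_xM$; for $d \ge 1$ it is a Riemannian $(d-1)$-manifold with the metric induced from the inner product on $T_xM$ (two points if $d=1$), and for $v\in U_xM$ the tangent space $T_v(U_xM)$ is identified with $v^\perp\subset T_xM$. For an arbitrary subset $X\subset M$ put $$U_xX := \{v \in U_xM : v = \gamma'(0) \text{ for some smooth curve } \gamma:[0,\varepsilon_0)\to X \text{ with } \gamma(0)=x\}$$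 (smooth as a curve in $M$, for some $\varepsilon_0>0$). For $v\in U_xM$ and $\delta>0$ put $$\mathfrak{c}_{v,\delta} := \{u \in T_xM : (1-\delta)\|u\|\,\|v\| < \langle u,v\rangle < \delta\},$$ and let $\exp_x$ be the Riemannian exponential map at $x$ ($\delta$ is always taken small enough that $\exp_x$ is defined on $\mathfrak{c}_{v,\delta}$). For $0\le k\le d$ define $\widetilde{M}^{(0)} := M$ and, for $k>0$, $\widetilde{M}^{(k)} := \bigsqcup_{x\in M}\{x\}\times \widetilde{U_xM}^{(k-1)}$; equivalently, $\widetilde{M}^{(k)}$ is the set of tuples $(x;v_1,\dots,v_k)$ with $x\in M$ and $v_1,\dots,v_k\in T_xM$ orthonormal. The collection $\mathfrak{S}_d(M)$ of subsets of $M$ is defined recursively on $d$. For $d=0$ it consists of all subsets of $M$. For $d\ge 1$, $X\subset M$ belongs to $\mathfrak{S}_d(M)$ iff (a) $X = \mathrm{ci}(X)$; (b) for each $x\in X$, the set $$\mathcal{C}_{X,x} := \{v\in U_xM : \exists\,\delta>0\ \ (\exp_x(\mathfrak{c}_{v,\delta})\subset X \ \text{ or }\ \exp_x(\mathfrak{c}_{v,\delta})\subset M\setminus X)\}$$ has dense interior in $U_xM$ (i.e. $\mathrm{int}\,\mathcal{C}_{X,x}$ is dense in $U_xM$); (c) for each $x\in X$, $\mathrm{ci}(U_xX)\in\mathfrak{S}_{d-1}(U_xM)$, with $\mathrm{ci}$ taken in $U_xM$. The formula for $\widetilde{X}$ is literally meaningful for any subset $X \subset M$, and is applied to $X\cup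 Y$ and $\mathrm{ci}(X\cap Y)$ in this sense. *)

theory Defs
  imports "HOL-Analysis.Analysis"
begin

section \<open>Smooth maps\<close>

text \<open>
  \<open>Ck_on k W S f\<close>: \<open>f\<close> is \<open>k\<close> times continuously differentiable on \<open>S\<close>. It is only used when \<open>W\<close>
  is a linear subspace and \<open>S\<close> is open in \<open>W\<close>, or when \<open>W = UNIV :: real set\<close> and \<open>S\<close> is relatively
  open in a nondegenerate interval (derivatives at an included end point are then one-sided). In
  both cases the derivatives within \<open>S\<close> are uniquely determined on vectors of \<open>W\<close>.
\<close>

primrec Ck_on ::
    "nat \<Rightarrow> 'b::real_normed_vector set \<Rightarrow> 'b set \<Rightarrow> ('b \<Rightarrow> 'c::real_normed_vector) \<Rightarrow> bool" where
  "Ck_on 0 W S f \<longleftrightarrow> continuous_on S f"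
| "Ck_on (Suc k) W S f \<longleftrightarrow>
     (\<exists>f'. (\<forall>x\<in>S. (f has_derivative f' x) (at x within S)) \<and> (\<forall>w\<in>W. Ck_on k W S (\<lambda>x. f' x w)))"

definition smooth_on ::
    "'b::real_normed_vector set \<Rightarrow> 'b set \<Rightarrow> ('b \<Rightarrow> 'c::real_normed_vector) \<Rightarrow> bool" where
  "smooth_on W S f \<longleftrightarrow> (\<forall>k. Ck_on k W S f)"

section \<open>Riemannian manifolds\<close>

text \<open>
  A manifold is given by an atlas indexed by its points: \<open>chart M p\<close> maps the open neighbourhood
  \<open>cdom M p\<close> of \<open>p\<close> onto an open subset of a linear subspace \<open>tspace M p\<close> of the ambient Euclidean
  space \<open>'e\<close>. The tangent space at \<open>p\<close> is modelled by \<open>tspace M p\<close>, a tangent vector being represented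
  by its coordinates in \<open>chart M p\<close>. The dimension \<open>d\<close> of the manifold is the dimension of these
  subspaces, so it is an ordinary natural number (possibly \<open>0\<close>); \<open>'e\<close> only has to be large enough.
  \<open>rmetric M p\<close> is the inner product on \<open>tspace M p\<close>; its values on other vectors are irrelevant.
\<close>

record ('a, 'e) rman =
  rtop :: "'a topology"
  tspace :: "'a \<Rightarrow> 'e set"
  cdom :: "'a \<Rightarrow> 'a set"
  chart :: "'a \<Rightarrow> 'a \<Rightarrow> 'e"
  rmetric :: "'a \<Rightarrow> 'e \<Rightarrow> 'e \<Rightarrow> real"

abbreviation pts :: "('a, 'e) rman \<Rightarrow> 'a set" where
  "pts M \<equiv> topspace (rtop M)"

definition cimg :: "('a, 'e) rman \<Rightarrow> 'a \<Rightarrow> 'e set" where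
  "cimg M p = chart M p ` cdom M p"

definition cinv :: "('a, 'e) rman \<Rightarrow> 'a \<Rightarrow> 'e \<Rightarrow> 'a" where
  "cinv M p = inv_into (cdom M p) (chart M p)"

definition transition :: "('a, 'e) rman \<Rightarrow> 'a \<Rightarrow> 'a \<Rightarrow> 'e \<Rightarrow> 'e" where
  "transition M p q = chart M q \<circ> cinv M p"

text \<open>
  The metric in the coordinates \<open>chart M p\<close>, at the coordinate point \<open>y\<close> of \<open>q\<close>: a coordinate vector is
  carried to \<open>tspace M q\<close> by the derivative at \<open>y\<close> of the change of coordinates from \<open>chart M p\<close> to
  \<open>chart M q\<close>.
\<close>

definition gcoord :: "('a, 'e::euclidean_space) rman \<Rightarrow> 'a \<Rightarrow> 'e \<Rightarrow> 'e \<Rightarrow> 'e \<Rightarrow> real" where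
  "gcoord M p y a b =
     (let q = cinv M p y; D = frechet_derivative (transition M p q) (at y within cimg M p)
      in rmetric M q (D a) (D b))"

definition inner_product_on :: "'e::real_vector set \<Rightarrow> ('e \<Rightarrow> 'e \<Rightarrow> real) \<Rightarrow> bool" where
  "inner_product_on W g \<longleftrightarrow>
     (\<forall>u\<in>W. \<forall>v\<in>W. g u v = g v u) \<and>
     (\<forall>u\<in>W. \<forall>v\<in>W. \<forall>w\<in>W. g (u + v) w = g u w + g v w) \<and>
     (\<forall>u\<in>W. \<forall>v\<in>W. \<forall>c. g (c *\<^sub>R u) v = c * g u v) \<and>
     (\<forall>u\<in>W. u \<noteq> 0 \<longrightarrow> g u u > 0)"

definition riemannian_manifold :: "nat \<Rightarrow> ('a, 'e::euclidean_space) rman \<Rightarrow> bool" where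
  "riemannian_manifold d M \<longleftrightarrow>
     Hausdorff_space (rtop M) \<and> second_countable (rtop M) \<and>
     (\<forall>p\<in>pts M.
        subspace (tspace M p) \<and> dim (tspace M p) = d \<and>
        openin (rtop M) (cdom M p) \<and> p \<in> cdom M p \<and>
        openin (top_of_set (tspace M p)) (cimg M p) \<and>
        homeomorphic_map (subtopology (rtop M) (cdom M p)) (top_of_set (cimg M p)) (chart M p) \<and>
        inner_product_on (tspace M p) (rmetric M p)) \<and>
     (\<forall>p\<in>pts M. \<forall>q\<in>pts M.
        smooth_on (tspace M p) (chart M p ` (cdom M p \<inter> cdom M q)) (transition M p q)) \<and>
     (\<forall>p\<in>pts M. \<forall>a\<in>tspace M p. \<forall>b\<in>tspace M p.
        smooth_on (tspace M p) (cimg M p) (\<lambda>y. gcoord M p y a b))"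

section \<open>Curves, geodesics and the exponential map\<close>

definition smooth_curve :: "('a, 'e::euclidean_space) rman \<Rightarrow> real set \<Rightarrow> (real \<Rightarrow> 'a) \<Rightarrow> bool" where
  "smooth_curve M I \<gamma> \<longleftrightarrow>
     continuous_map (top_of_set I) (rtop M) \<gamma> \<and>
     (\<forall>p\<in>pts M. smooth_on UNIV {t\<in>I. \<gamma> t \<in> cdom M p} (chart M p \<circ> \<gamma>))"

definition velocity ::
    "('a, 'e::euclidean_space) rman \<Rightarrow> real set \<Rightarrow> (real \<Rightarrow> 'a) \<Rightarrow> real \<Rightarrow> 'e \<Rightarrow> bool" where
  "velocity M I \<gamma> t v \<longleftrightarrow> ((chart M (\<gamma> t) \<circ> \<gamma>) has_vector_derivative v) (at t within I)"

text \<open>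
  Christoffel symbols of the first kind in the coordinates \<open>chart M p\<close>: \<open>christoffel M p y a b w\<close> is the
  inner product of \<open>\<nabla>\<^sub>a b\<close> and \<open>w\<close> for constant coordinate fields \<open>a\<close>, \<open>b\<close>, \<open>w\<close>. Accordingly, \<open>geodesic\<close>
  is the equation \<open>\<nabla>\<^bsub>\<gamma>'\<^esub> \<gamma>' = 0\<close> in each chart, paired with all \<open>w\<close>.
\<close>

definition dgcoord :: "('a, 'e::euclidean_space) rman \<Rightarrow> 'a \<Rightarrow> 'e \<Rightarrow> 'e \<Rightarrow> 'e \<Rightarrow> 'e \<Rightarrow> real" where
  "dgcoord M p y w a b = frechet_derivative (\<lambda>z. gcoord M p z a b) (at y within cimg M p) w"

definition christoffel :: "('a, 'e::euclidean_space) rman \<Rightarrow> 'a \<Rightarrow> 'e \<Rightarrow> 'e \<Rightarrow> 'e \<Rightarrow> 'e \<Rightarrow> real" where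
  "christoffel M p y a b w = (dgcoord M p y a b w + dgcoord M p y b a w - dgcoord M p y w a b) / 2"

definition geodesic :: "('a, 'e::euclidean_space) rman \<Rightarrow> real set \<Rightarrow> (real \<Rightarrow> 'a) \<Rightarrow> bool" where
  "geodesic M I \<gamma> \<longleftrightarrow>
     smooth_curve M I \<gamma> \<and>
     (\<forall>p\<in>pts M. \<exists>c' c''. let J = {t\<in>I. \<gamma> t \<in> cdom M p}; c = chart M p \<circ> \<gamma> in
        \<forall>t\<in>J. (c has_vector_derivative c' t) (at t within J) \<and>
              (c' has_vector_derivative c'' t) (at t within J) \<and>
              (\<forall>w\<in>tspace M p. gcoord M p (c t) (c'' t) w + christoffel M p (c t) (c' t) (c' t) w = 0))"

definition exp_rel :: "('a, 'e::euclidean_space) rman \<Rightarrow> 'a \<Rightarrow> 'e \<Rightarrow> 'a \<Rightarrow> bool" where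
  "exp_rel M x u y \<longleftrightarrow>
     (\<exists>\<gamma>. geodesic M {0..1} \<gamma> \<and> \<gamma> 0 = x \<and> velocity M {0..1} \<gamma> 0 u \<and> \<gamma> 1 = y)"

definition exp_dom :: "('a, 'e::euclidean_space) rman \<Rightarrow> 'a \<Rightarrow> 'e set" where
  "exp_dom M x = {u \<in> tspace M x. \<exists>y. exp_rel M x u y}"

definition rexp :: "('a, 'e::euclidean_space) rman \<Rightarrow> 'a \<Rightarrow> 'e \<Rightarrow> 'a" where
  "rexp M x u = (THE y. exp_rel M x u y)"

section \<open>Unit spheres of tangent spaces\<close>

definition unit_sphere :: "('a, 'e::euclidean_space) rman \<Rightarrow> 'a \<Rightarrow> 'e set" where
  "unit_sphere M x = {v \<in> tspace M x. rmetric M x v v = 1}"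

text \<open>
  The unit sphere as a Riemannian manifold. The chart around \<open>v\<close> is the orthogonal projection along \<open>v\<close>
  of the open hemisphere centred at \<open>v\<close>. Its derivative at \<open>v\<close> is the identity of the orthogonal
  complement of \<open>v\<close>, so the tangent space at \<open>v\<close> is identified with this complement in the usual way,
  and the metric is the induced one.
\<close>

definition usphere :: "('a, 'e::euclidean_space) rman \<Rightarrow> 'a \<Rightarrow> ('e, 'e) rman" where
  "usphere M x =
     \<lparr> rtop = top_of_set (unit_sphere M x),
       tspace = (\<lambda>v. {w \<in> tspace M x. rmetric M x v w = 0}),
       cdom = (\<lambda>v. {u \<in> unit_sphere M x. rmetric M x u v > 0}),
       chart = (\<lambda>v u. u - rmetric M x u v *\<^sub>R v),
       rmetric = (\<lambda>v. rmetric M x) \<rparr>"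

section \<open>The collection \<open>\<SS>\<^sub>d(M)\<close> and the map \<open>X \<mapsto> X\<close>-tilde\<close>

definition ci :: "'a topology \<Rightarrow> 'a set \<Rightarrow> 'a set" where
  "ci T A = T closure_of (T interior_of A)"

definition U_set :: "('a, 'e::euclidean_space) rman \<Rightarrow> 'a \<Rightarrow> 'a set \<Rightarrow> 'e set" where
  "U_set M x X =
     {v \<in> unit_sphere M x. \<exists>\<epsilon>>0. \<exists>\<gamma>. smooth_curve M {0..<\<epsilon>} \<gamma> \<and> \<gamma> ` {0..<\<epsilon>} \<subseteq> X \<and> \<gamma> 0 = x \<and>
        velocity M {0..<\<epsilon>} \<gamma> 0 v}"

definition tnorm :: "('a, 'e) rman \<Rightarrow> 'a \<Rightarrow> 'e \<Rightarrow> real" where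
  "tnorm M x u = sqrt (rmetric M x u u)"

definition cone :: "('a, 'e::euclidean_space) rman \<Rightarrow> 'a \<Rightarrow> 'e \<Rightarrow> real \<Rightarrow> 'e set" where
  "cone M x v \<delta> = {u \<in> tspace M x. (1 - \<delta>) * tnorm M x u * tnorm M x v < rmetric M x u v \<and>
                                  rmetric M x u v < \<delta>}"

definition C_set :: "('a, 'e::euclidean_space) rman \<Rightarrow> 'a set \<Rightarrow> 'a \<Rightarrow> 'e set" where
  "C_set M X x = {v \<in> unit_sphere M x. \<exists>\<delta>>0. cone M x v \<delta> \<subseteq> exp_dom M x \<and>
     (rexp M x ` cone M x v \<delta> \<subseteq> X \<or> rexp M x ` cone M x v \<delta> \<subseteq> pts M - X)}"

text \<open>
  The recursions below pass from \<open>M\<close> to \<open>usphere M x\<close>, that is, from points of an arbitrary type \<open>'a\<close> to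
  points of type \<open>'e\<close>. As a recursive function has a fixed type, each recursion is first carried out
  for manifolds with points of type \<open>'e\<close> (the primed versions), its step being polymorphic in the type
  of points, and then extended to all manifolds by one more step. The lemmas \<open>SS_Suc\<close>, \<open>tilde_Suc\<close>,
  \<open>frames_Suc\<close> show that the resulting functions satisfy the intended recursive equations.
\<close>

definition SS_step ::
    "(('e, 'e) rman \<Rightarrow> 'e set set) \<Rightarrow> ('a, 'e::euclidean_space) rman \<Rightarrow> 'a set set" where
  "SS_step F M = {X. X \<subseteq> pts M \<and> X = ci (rtop M) X \<and>
     (\<forall>x\<in>X. rtop (usphere M x) closure_of (rtop (usphere M x) interior_of C_set M X x)
              = pts (usphere M x)) \<and>
     (\<forall>x\<in>X. ci (rtop (usphere M x)) (U_set M x X) \<in> F (usphere M x))}"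

primrec SS' :: "nat \<Rightarrow> ('e, 'e::euclidean_space) rman \<Rightarrow> 'e set set" where
  "SS' 0 = (\<lambda>M. Pow (pts M))"
| "SS' (Suc d) = SS_step (SS' d)"

definition SS :: "nat \<Rightarrow> ('a, 'e::euclidean_space) rman \<Rightarrow> 'a set set" where
  "SS d M = (case d of 0 \<Rightarrow> Pow (pts M) | Suc k \<Rightarrow> SS_step (SS' k) M)"

text \<open>
  A tuple \<open>(x; v\<^sub>1, \<dots>, v\<^sub>k)\<close> is represented as \<open>(x, [v\<^sub>1, \<dots>, v\<^sub>k])\<close>; in particular a point \<open>x\<close> of the
  zeroth stage is identified with \<open>(x, [])\<close>.
\<close>

definition frames_step ::
    "(('e, 'e) rman \<Rightarrow> ('e \<times> 'e list) set) \<Rightarrow> ('a, 'e::euclidean_space) rman \<Rightarrow> ('a \<times> 'e list) set" where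
  "frames_step F M = {(x, v # vs) | x v vs. x \<in> pts M \<and> (v, vs) \<in> F (usphere M x)}"

primrec frames' :: "nat \<Rightarrow> ('e, 'e::euclidean_space) rman \<Rightarrow> ('e \<times> 'e list) set" where
  "frames' 0 = (\<lambda>M. pts M \<times> {[]})"
| "frames' (Suc k) = frames_step (frames' k)"

definition frames :: "nat \<Rightarrow> ('a, 'e::euclidean_space) rman \<Rightarrow> ('a \<times> 'e list) set" where
  "frames k M = (case k of 0 \<Rightarrow> pts M \<times> {[]} | Suc j \<Rightarrow> frames_step (frames' j) M)"

definition tilde_step ::
    "(('e, 'e) rman \<Rightarrow> 'e set \<Rightarrow> ('e \<times> 'e list) set)
      \<Rightarrow> ('a, 'e::euclidean_space) rman \<Rightarrow> 'a set \<Rightarrow> ('a \<times> 'e list) set" where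
  "tilde_step F M X = {(x, v # vs) | x v vs.
     x \<in> X \<and> (v, vs) \<in> F (usphere M x) (ci (rtop (usphere M x)) (U_set M x X))}"

primrec tilde' :: "nat \<Rightarrow> ('e, 'e::euclidean_space) rman \<Rightarrow> 'e set \<Rightarrow> ('e \<times> 'e list) set" where
  "tilde' 0 = (\<lambda>M X. X \<times> {[]})"
| "tilde' (Suc d) = tilde_step (tilde' d)"

definition tilde ::
    "nat \<Rightarrow> ('a, 'e::euclidean_space) rman \<Rightarrow> 'a set \<Rightarrow> ('a \<times> 'e list) set" where
  "tilde d M X = (case d of 0 \<Rightarrow> X \<times> {[]} | Suc k \<Rightarrow> tilde_step (tilde' k) M X)"

lemma SS_0: "SS 0 M = Pow (pts M)"
  by (simp add: SS_def)

lemma SS'_eq: "SS' d = SS d"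
  by (cases d) (auto simp: SS_def fun_eq_iff)

lemma SS_Suc:
  "X \<in> SS (Suc d) M \<longleftrightarrow> X \<subseteq> pts M \<and> X = ci (rtop M) X \<and>
     (\<forall>x\<in>X. rtop (usphere M x) closure_of (rtop (usphere M x) interior_of C_set M X x)
              = pts (usphere M x)) \<and>
     (\<forall>x\<in>X. ci (rtop (usphere M x)) (U_set M x X) \<in> SS d (usphere M x))"
  by (simp add: SS_def SS_step_def flip: SS'_eq)

lemma frames_0: "frames 0 M = pts M \<times> {[]}"
  by (simp add: frames_def)

lemma frames'_eq: "frames' d = frames d"
  by (cases d) (auto simp: frames_def fun_eq_iff)

lemma frames_Suc:
  "frames (Suc k) M = {(x, v # vs) | x v vs. x \<in> pts M \<and> (v, vs) \<in> frames k (usphere M x)}"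
  by (simp add: frames_def frames_step_def flip: frames'_eq)

lemma tilde_0: "tilde 0 M X = X \<times> {[]}"
  by (simp add: tilde_def)

lemma tilde'_eq: "tilde' d = tilde d"
  by (cases d) (auto simp: tilde_def fun_eq_iff)

lemma tilde_Suc:
  "tilde (Suc d) M X = {(x, v # vs) | x v vs.
     x \<in> X \<and> (v, vs) \<in> tilde d (usphere M x) (ci (rtop (usphere M x)) (U_set M x X))}"
  by (simp add: tilde_def tilde_step_def flip: tilde'_eq)

section \<open>The stages of the recursion\<close>

text \<open>
  The stages \<open>frames k M\<close> consist of the orthonormal tuples (\<open>frames_eq_ortho_tuples\<close>), and \<open>usphere M x\<close>
  is a Riemannian manifold of dimension one less (\<open>riemannian_manifold_usphere\<close>).
\<close>

definition rmetric_sym :: "('a, 'e) rman \<Rightarrow> bool" where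
  "rmetric_sym M \<longleftrightarrow> (\<forall>x\<in>pts M. \<forall>u\<in>tspace M x. \<forall>v\<in>tspace M x. rmetric M x u v = rmetric M x v u)"

definition ortho_tuples :: "nat \<Rightarrow> ('a, 'e) rman \<Rightarrow> ('a \<times> 'e list) set" where
  "ortho_tuples k M = {(x, vs). x \<in> pts M \<and> length vs = k \<and> set vs \<subseteq> tspace M x \<and>
     (\<forall>i<k. \<forall>j<k. rmetric M x (vs ! i) (vs ! j) = (if i = j then 1 else 0))}"

lemma ortho_tuples_Suc:
  assumes "rmetric_sym M"
  shows "ortho_tuples (Suc k) M =
    {(x, v # vs) | x v vs. x \<in> pts M \<and> (v, vs) \<in> ortho_tuples k (usphere M x)}"
proof -
  have mem: "(x, v # vs) \<in> ortho_tuples (Suc k) M \<longleftrightarrow>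
          x \<in> pts M \<and> (v, vs) \<in> ortho_tuples k (usphere M x)" for x v vs
  proof -
    have sym: "rmetric M x u w = rmetric M x w u"
      if "x \<in> pts M" "u \<in> tspace M x" "w \<in> tspace M x" for u w
      using assms that by (auto simp: rmetric_sym_def)
    define P where "P = (\<forall>i<Suc k. \<forall>j<Suc k.
      rmetric M x ((v # vs) ! i) ((v # vs) ! j) = (if i = j then 1 else 0))"
    define Q where "Q = (rmetric M x v v = 1 \<and> (\<forall>w\<in>set vs. rmetric M x v w = 0) \<and>
      (\<forall>i<k. \<forall>j<k. rmetric M x (vs ! i) (vs ! j) = (if i = j then 1 else 0)))"
    have *: "P = Q"
      if "x \<in> pts M" "v \<in> tspace M x" "set vs \<subseteq> tspace M x" "length vs = k"
    proof -
      have "rmetric M x (vs ! i) v = rmetric M x v (vs ! i)" if "i < k" for i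
      proof -
        have "vs ! i \<in> tspace M x"
          using that nth_mem[of i vs] \<open>length vs = k\<close> \<open>set vs \<subseteq> tspace M x\<close> by auto
        from sym[OF \<open>x \<in> pts M\<close> this \<open>v \<in> tspace M x\<close>] show ?thesis .
      qed
      moreover have "(\<forall>w\<in>set vs. rmetric M x v w = 0) \<longleftrightarrow> (\<forall>i<k. rmetric M x v (vs ! i) = 0)"
        using \<open>length vs = k\<close> by (simp add: all_set_conv_all_nth)
      ultimately show ?thesis
        unfolding P_def Q_def by (simp add: All_less_Suc2 cong: conj_cong)
    qed
    have "(x, v # vs) \<in> ortho_tuples (Suc k) M \<longleftrightarrow>
        x \<in> pts M \<and> length vs = k \<and> v \<in> tspace M x \<and> set vs \<subseteq> tspace M x \<and> P"
      unfolding ortho_tuples_def P_def by simp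
    moreover have "x \<in> pts M \<and> (v, vs) \<in> ortho_tuples k (usphere M x) \<longleftrightarrow>
        x \<in> pts M \<and> length vs = k \<and> v \<in> tspace M x \<and> set vs \<subseteq> tspace M x \<and> Q"
      unfolding ortho_tuples_def Q_def usphere_def unit_sphere_def by auto
    ultimately show ?thesis using * by blast
  qed
  have Cons: "\<exists>v vs. zs = v # vs" if "(x, zs) \<in> ortho_tuples (Suc k) M" for x zs
    using that by (auto simp: ortho_tuples_def length_Suc_conv)
  show ?thesis (is "?L = ?R")
  proof (intro subset_antisym subsetI)
    fix z assume z: "z \<in> ?L"
    moreover obtain x v vs where "z = (x, v # vs)"
      using z Cons by (cases z) blast
    ultimately show "z \<in> ?R" using mem by simp
  next
    fix z assume "z \<in> ?R"
    then obtain x v vs where "z = (x, v # vs)" "x \<in> pts M" "(v, vs) \<in> ortho_tuples k (usphere M x)"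
      by blast
    then show "z \<in> ?L" using mem by simp
  qed
qed

lemma rmetric_sym_usphere: "rmetric_sym M \<Longrightarrow> x \<in> pts M \<Longrightarrow> rmetric_sym (usphere M x)"
  by (auto simp: rmetric_sym_def usphere_def)

lemma frames_eq_aux: "rmetric_sym M \<Longrightarrow> frames k M = ortho_tuples k (M :: ('e, 'e::euclidean_space) rman)"
proof (induction k arbitrary: M)
  case 0
  then show ?case by (auto simp: frames_0 ortho_tuples_def)
next
  case (Suc k)
  then show ?case
    by (auto simp: frames_Suc ortho_tuples_Suc rmetric_sym_usphere)
qed

lemma frames_eq_ortho_tuples:
  assumes "riemannian_manifold d M"
  shows "frames k M = {(x, vs). x \<in> pts M \<and> length vs = k \<and> set vs \<subseteq> tspace M x \<and>
     (\<forall>i<k. \<forall>j<k. rmetric M x (vs ! i) (vs ! j) = (if i = j then 1 else 0))}"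
proof -
  have "rmetric_sym M"
    using assms by (auto simp: rmetric_sym_def riemannian_manifold_def inner_product_on_def)
  then have "frames k M = ortho_tuples k M"
  proof (cases k)
    case 0
    then show ?thesis by (auto simp: frames_0 ortho_tuples_def)
  next
    case (Suc j)
    with \<open>rmetric_sym M\<close> show ?thesis
      by (simp add: frames_Suc ortho_tuples_Suc rmetric_sym_usphere frames_eq_aux cong: conj_cong)
  qed
  then show ?thesis by (simp add: ortho_tuples_def)
qed

lemma Ck_on_cong:
  assumes "\<And>x. x \<in> S \<Longrightarrow> f x = h x" and "Ck_on k W S f"
  shows "Ck_on k W S h"
proof (cases k)
  case 0
  then show ?thesis using assms by (simp cong: continuous_on_cong)
next
  case (Suc j)
  then show ?thesis using assms
    by (auto intro: has_derivative_transform[rotated 2]) (metis has_derivative_transform)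
qed

lemma Ck_on_mono: "Ck_on (Suc k) W S f \<Longrightarrow> Ck_on k W S f"
proof (induction k arbitrary: f)
  case 0
  then show ?case
    using has_derivative_continuous_on by fastforce
next
  case (Suc k)
  then obtain f' where "\<forall>x\<in>S. (f has_derivative f' x) (at x within S)"
    "\<forall>w\<in>W. Ck_on (Suc k) W S (\<lambda>x. f' x w)" by (subst (asm) Ck_on.simps(2)) blast
  then show ?case using Suc.IH by auto
qed

lemma Ck_on_subset: "S' \<subseteq> S \<Longrightarrow> Ck_on k W S f \<Longrightarrow> Ck_on k W S' f"
proof (induction k arbitrary: f)
  case 0
  then show ?case using continuous_on_subset by auto
next
  case (Suc k)
  then obtain f' where "\<forall>x\<in>S. (f has_derivative f' x) (at x within S)"
    "\<forall>w\<in>W. Ck_on k W S (\<lambda>x. f' x w)" by auto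
  then show ?case using Suc.IH Suc.prems(1)
    by (auto intro!: exI[of _ f'] intro: has_derivative_subset)
qed

lemma Ck_on_const: "Ck_on k W S (\<lambda>x. c)"
proof (induction k arbitrary: c)
  case (Suc k)
  then show ?case by (auto intro!: exI[of _ "\<lambda>_ _. 0"])
qed simp

lemma Ck_on_linear:
  assumes "bounded_linear L" shows "Ck_on k W S L"
proof (cases k)
  case 0
  then show ?thesis using assms linear_continuous_on by auto
next
  case (Suc j)
  then show ?thesis using assms bounded_linear_imp_has_derivative
    by (auto intro!: exI[of _ "\<lambda>_. L"] Ck_on_const)
qed

lemma Ck_on_add: "Ck_on k W S f \<Longrightarrow> Ck_on k W S h \<Longrightarrow> Ck_on k W S (\<lambda>x. f x + h x)"
proof (induction k arbitrary: f h)
  case 0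
  then show ?case by (auto intro: continuous_on_add)
next
  case (Suc k)
  from Suc.prems obtain f' h' where
    "\<forall>x\<in>S. (f has_derivative f' x) (at x within S)" "\<forall>w\<in>W. Ck_on k W S (\<lambda>x. f' x w)"
    "\<forall>x\<in>S. (h has_derivative h' x) (at x within S)" "\<forall>w\<in>W. Ck_on k W S (\<lambda>x. h' x w)"
    by auto
  then show ?case using Suc.IH
    by (auto intro!: exI[of _ "\<lambda>x w. f' x w + h' x w"] has_derivative_add)
qed

lemma Ck_on_bilinear:
  assumes "bounded_bilinear P"
  shows "Ck_on k W S f \<Longrightarrow> Ck_on k W S h \<Longrightarrow> Ck_on k W S (\<lambda>x. P (f x) (h x))"
proof (induction k arbitrary: f h)
  case 0
  then show ?case using bounded_bilinear.continuous_on[OF assms] by auto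
next
  case (Suc k)
  from Suc.prems obtain f' h' where
    1: "\<forall>x\<in>S. (f has_derivative f' x) (at x within S)" "\<forall>w\<in>W. Ck_on k W S (\<lambda>x. f' x w)"
    "\<forall>x\<in>S. (h has_derivative h' x) (at x within S)" "\<forall>w\<in>W. Ck_on k W S (\<lambda>x. h' x w)"
    by auto
  moreover have "Ck_on k W S f" "Ck_on k W S h" using Suc.prems Ck_on_mono by blast+
  ultimately show ?case using Suc.IH
    by (auto intro!: exI[of _ "\<lambda>x w. P (f x) (h' x w) + P (f' x w) (h x)"]
          bounded_bilinear.FDERIV[OF assms] Ck_on_add)
qed

lemmas Ck_on_mult = Ck_on_bilinear[OF bounded_bilinear_mult]
lemmas Ck_on_scaleR = Ck_on_bilinear[OF bounded_bilinear_scaleR]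

lemma rsqrt_deriv:
  assumes G: "bounded_bilinear (G :: 'e::real_normed_vector \<Rightarrow> 'e \<Rightarrow> real)" and sym: "\<And>u v. G u v = G v u" and "G y y < 1"
  shows "((\<lambda>y. 1 / sqrt (1 - G y y)) has_derivative (\<lambda>w. G y w * (1 / sqrt (1 - G y y))^3)) (at y within S)"
proof -
  have *: "((\<lambda>y. 1 - G y y) has_derivative (\<lambda>w. - (2 * G y w))) (at y within S)"
    by (rule derivative_eq_intros bounded_bilinear.FDERIV[OF G] refl)+ (auto simp: sym[of _ y])
  have "((\<lambda>z. 1 / sqrt z) has_real_derivative (- (1/2) * (1 / sqrt (1 - G y y))^3)) (at (1 - G y y))"
    using assms(3) by (auto intro!: derivative_eq_intros simp: field_simps power3_eq_cube)
  then have d: "((\<lambda>z. 1 / sqrt z) has_derivative (\<lambda>h. (- (1/2) * (1 / sqrt (1 - G y y))^3) * h)) (at (1 - G y y))"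
    by (simp only: has_field_derivative_def)
  show ?thesis
    using has_derivative_compose[OF * d] by (simp add: mult_ac)
qed

lemma Ck_on_rsqrt:
  assumes G: "bounded_bilinear (G :: 'e::real_normed_vector \<Rightarrow> 'e \<Rightarrow> real)" and sym: "\<And>u v. G u v = G v u"
    and S: "\<And>y. y \<in> S \<Longrightarrow> G y y < 1"
  shows "Ck_on k W S (\<lambda>y. 1 / sqrt (1 - G y y))"
proof (induction k)
  case 0
  then show ?case
    using rsqrt_deriv[OF G sym S] by (auto intro!: has_derivative_continuous_on)
next
  case (Suc k)
  have "Ck_on k W S (\<lambda>y. G y w * (1 / sqrt (1 - G y y))^3)" for w
    unfolding power3_eq_cube
    by (intro Ck_on_mult Suc Ck_on_linear bounded_bilinear.bounded_linear_left[OF G])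
  then show ?case
    by (auto intro!: exI[of _ "\<lambda>y w. G y w * (1 / sqrt (1 - G y y))^3"] rsqrt_deriv[OF G sym S]
        simp del: power_one_over power_divide)
qed

lemma Ck_on_sqrt:
  assumes G: "bounded_bilinear (G :: 'e::real_normed_vector \<Rightarrow> 'e \<Rightarrow> real)" and sym: "\<And>u v. G u v = G v u"
    and S: "\<And>y. y \<in> S \<Longrightarrow> G y y < 1"
  shows "Ck_on k W S (\<lambda>y. sqrt (1 - G y y))"
proof -
  have "Ck_on k W S (\<lambda>y. 1 + - 1 * G y y)"
    by (intro Ck_on_add Ck_on_mult Ck_on_const Ck_on_bilinear[OF G] Ck_on_linear bounded_linear_ident)
  from Ck_on_mult[OF this Ck_on_rsqrt[OF G sym S]]
  have "Ck_on k W S (\<lambda>y. (1 + - 1 * G y y) * (1 / sqrt (1 - G y y)))" .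
  then show ?thesis
  proof (rule Ck_on_cong[rotated])
    fix y assume "y \<in> S"
    then have "0 < 1 - G y y" using S by force
    then show "(1 + - 1 * G y y) * (1 / sqrt (1 - G y y)) = sqrt (1 - G y y)"
      by (simp add: real_div_sqrt)
  qed
qed

lemma inner_product_extend:
  assumes "subspace W" "inner_product_on W g"
  obtains G :: "'e::euclidean_space \<Rightarrow> 'e \<Rightarrow> real" where "bounded_bilinear G" "\<And>u v. G u v = G v u"
    "\<And>u v. u \<in> W \<Longrightarrow> v \<in> W \<Longrightarrow> g u v = G u v"
proof -
  obtain B where B: "B \<subseteq> W" "independent B" "W = span B"
    using basis_exists[of W] assms(1) by (metis span_subspace)
  obtain P where P: "linear P" "\<forall>x\<in>B. P x = x" "range P = span B"
    using linear_independent_extend_subspace[OF B(2), of id] by auto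
  have PW: "P x \<in> W" for x using P(3) B(3) by auto
  have Pid: "P x = x" if "x \<in> W" for x
    using linear_eq_on_span[OF P(1) linear_id, of B x] P(2) that B(3) by auto
  have g: "u\<in>W \<Longrightarrow> v\<in>W \<Longrightarrow> g u v = g v u" "u\<in>W \<Longrightarrow> v\<in>W \<Longrightarrow> w\<in>W \<Longrightarrow> g (u + v) w = g u w + g v w"
    "u\<in>W \<Longrightarrow> v\<in>W \<Longrightarrow> g (c *\<^sub>R u) v = c * g u v" for u v w c
    using assms(2) by (auto simp: inner_product_on_def)
  have g': "u\<in>W \<Longrightarrow> v\<in>W \<Longrightarrow> w\<in>W \<Longrightarrow> g w (u + v) = g w u + g w v"
    "u\<in>W \<Longrightarrow> v\<in>W \<Longrightarrow> g v (c *\<^sub>R u) = c * g v u" for u v w c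
    using g assms(1) by (metis subspace_add, metis g subspace_scale assms(1))
  have "bilinear (\<lambda>u v. g (P u) (P v))"
    unfolding bilinear_def
    by (auto intro!: linearI simp: linear_add[OF P(1)] linear_scale[OF P(1)] g g' PW)
  then show thesis
    by (intro that[of "\<lambda>u v. g (P u) (P v)"]) (auto simp: bilinear_conv_bounded_bilinear Pid g(1)[OF PW PW])
qed

lemma derivative_unique_along:
  assumes "(f has_derivative D1) (at y within S)" "(f has_derivative D2) (at y within S)"
    and S: "openin (top_of_set W) S" "subspace W" "y \<in> S" "a \<in> W"
  shows "D1 a = D2 a"
proof -
  have "y \<in> W" using S openin_imp_subset by auto
  obtain e where e: "e > 0" "ball y e \<inter> W \<subseteq> S"
    using S by (meson openin_contains_ball)
  define J where "J = {t::real. y + t *\<^sub>R a \<in> S}"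
  define d where "d = e / (norm a + 1)"
  have d: "d > 0" using e by (auto simp: d_def add_nonneg_pos)
  have "ball 0 d \<subseteq> J"
  proof
    fix t assume "t \<in> ball (0::real) d"
    then have "\<bar>t\<bar> * (norm a + 1) < e"
      by (auto simp: d_def dist_norm pos_less_divide_eq add_nonneg_pos)
    then have "\<bar>t\<bar> * norm a < e" using abs_ge_zero[of t] by (smt (verit) mult_left_mono)
    then have "y + t *\<^sub>R a \<in> ball y e" by (simp add: dist_norm)
    then show "t \<in> J" using e S \<open>y \<in> W\<close> by (auto simp: J_def subspace_add subspace_scale)
  qed
  then have int: "0 \<in> interior J" using d by (meson centre_in_ball interior_maximal open_ball subsetD)
  have l: "((\<lambda>t. y + t *\<^sub>R a) has_derivative (\<lambda>t. t *\<^sub>R a)) (at 0 within J)"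
    by (auto intro!: derivative_eq_intros)
  have D: "((\<lambda>t. f (y + t *\<^sub>R a)) has_derivative (\<lambda>t. D (t *\<^sub>R a))) (at 0 within J)"
    if "(f has_derivative D) (at y within S)" for D
  proof (rule has_derivative_in_compose[OF l])
    show "(f has_derivative D) (at (y + 0 *\<^sub>R a) within (\<lambda>t. y + t *\<^sub>R a) ` J)"
      using has_derivative_subset[OF that, of "(\<lambda>t. y + t *\<^sub>R a) ` J"] by (auto simp: J_def)
  qed
  have "at 0 within J = at 0"
    using int by (rule at_within_interior)
  then have "((\<lambda>t. f (y + t *\<^sub>R a)) has_derivative (\<lambda>t. D1 (t *\<^sub>R a))) (at 0)"
     "((\<lambda>t. f (y + t *\<^sub>R a)) has_derivative (\<lambda>t. D2 (t *\<^sub>R a))) (at 0)"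
    using D[OF assms(1)] D[OF assms(2)] by simp_all
  from fun_cong[OF has_derivative_unique[OF this], of 1] show ?thesis by simp
qed

lemma second_countable_euclidean:
  "second_countable (euclidean :: 'e::second_countable_topology topology)"
proof -
  obtain B :: "'e set set" where "countable B" "topological_basis B"
    using ex_countable_basis by blast
  moreover from this have "\<exists>V\<in>B. x \<in> V \<and> V \<subseteq> U" if "open U" "x \<in> U" for U x
    using that by (metis topological_basisE)
  ultimately show ?thesis
    unfolding second_countable_def by (metis open_openin topological_basis_open)
qed

lemma riemannian_manifold_usphere:
  assumes M: "riemannian_manifold (Suc d) M" and x: "x \<in> pts M"
  shows "riemannian_manifold d (usphere M x)"
proof -
  define W where "W = tspace M x"
  have W: "subspace W" "dim W = Suc d" and ip: "inner_product_on W (rmetric M x)"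
    using M x by (auto simp: riemannian_manifold_def W_def)
  obtain G where G: "bounded_bilinear G" and sym: "\<And>u v. G u v = G v u"
    and gG: "\<And>u v. u \<in> W \<Longrightarrow> v \<in> W \<Longrightarrow> rmetric M x u v = G u v"
    using inner_product_extend[OF W(1) ip] by metis
  note Gs = bounded_bilinear.add_left[OF G] bounded_bilinear.add_right[OF G]
    bounded_bilinear.diff_left[OF G] bounded_bilinear.diff_right[OF G]
    bounded_bilinear.scaleR_left[OF G] bounded_bilinear.scaleR_right[OF G]
    bounded_bilinear.zero_left[OF G] bounded_bilinear.zero_right[OF G]
  have pos: "u \<in> W \<Longrightarrow> u \<noteq> 0 \<Longrightarrow> 0 < G u u" for u
    using ip gG by (auto simp: inner_product_on_def)
  have nn: "u \<in> W \<Longrightarrow> 0 \<le> G u u" for u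
    using pos[of u] by (cases "u = 0") (auto simp: Gs)
  note Wc = subspace_add[OF W(1)] subspace_diff[OF W(1)] subspace_scale[OF W(1)] subspace_0[OF W(1)]
  define N where "N = usphere M x"
  define U where "U = {v \<in> W. G v v = 1}"
  have UW: "u \<in> U \<Longrightarrow> u \<in> W" and U1: "u \<in> U \<Longrightarrow> G u u = 1" for u by (auto simp: U_def)
  have U_eq: "unit_sphere M x = U" by (auto simp: unit_sphere_def U_def W_def[symmetric] gG)
  define T where "T p = {w \<in> W. G p w = 0}" for p
  define H where "H p = {u \<in> U. G u p > 0}" for p
  define B where "B p = {y \<in> T p. G y y < 1}" for p
  define s where "s y = sqrt (1 - G y y)" for y
  define \<phi> where "\<phi> p u = u - G u p *\<^sub>R p" for p u
  define \<psi> where "\<psi> p y = y + s y *\<^sub>R p" for p y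
  have pts: "pts N = U" by (simp add: N_def usphere_def U_eq)
  have top: "rtop N = top_of_set U" by (simp add: N_def usphere_def U_eq)
  have tsp: "p \<in> U \<Longrightarrow> tspace N p = T p" for p
    by (auto simp: N_def usphere_def T_def gG U_def simp flip: W_def)
  have cd: "p \<in> U \<Longrightarrow> cdom N p = H p" for p
    by (auto simp: N_def usphere_def H_def gG U_eq UW)
  have ch: "p \<in> U \<Longrightarrow> u \<in> W \<Longrightarrow> chart N p u = \<phi> p u" for p u
    by (auto simp: N_def usphere_def \<phi>_def gG U_eq UW)
  have rm: "rmetric N p u v = G u v" if "u \<in> W" "v \<in> W" for p u v
    using that by (auto simp: N_def usphere_def gG)
  have sub: "subspace (T p)" for p
    by (auto simp: T_def subspace_def Gs Wc)
  have TW: "T p \<subseteq> W" for p by (auto simp: T_def)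
  have HU: "H p \<subseteq> U" for p by (auto simp: H_def)
  have BT: "B p \<subseteq> T p" for p by (auto simp: B_def)
  have cont: "continuous_on A (\<lambda>y. G (f y) (h y))" if "continuous_on A f" "continuous_on A h" for A f h
    using bounded_bilinear.continuous_on[OF G that] .
  have opB: "openin (top_of_set (T p)) (B p)" for p
  proof -
    have "B p = T p \<inter> (\<lambda>y. G y y) -` {..<1}" by (auto simp: B_def)
    then show ?thesis
      using continuous_openin_preimage_gen[OF cont[OF continuous_on_id continuous_on_id] open_lessThan] by simp
  qed
  have opH: "openin (top_of_set U) (H p)" for p
  proof -
    have "H p = U \<inter> (\<lambda>y. G y p) -` {0<..}" by (auto simp: H_def)
    then show ?thesis
      using continuous_openin_preimage_gen[OF cont[OF continuous_on_id continuous_on_const] open_greaterThan] by simp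
  qed
  have phiB: "\<phi> p u \<in> B p" "\<psi> p (\<phi> p u) = u" if p: "p \<in> U" and u: "u \<in> H p" for p u
  proof -
    have *: "G (\<phi> p u) (\<phi> p u) = 1 - (G u p)^2"
      using p u by (auto simp: \<phi>_def Gs U1 H_def sym[of p u] power2_eq_square)
    have "G u p > 0" using u by (auto simp: H_def)
    then show "\<phi> p u \<in> B p" unfolding B_def T_def using * p u
      by (auto simp: H_def U_def \<phi>_def Gs Wc sym[of p u])
    show "\<psi> p (\<phi> p u) = u" using * \<open>G u p > 0\<close>
      by (simp add: \<psi>_def s_def) (simp add: \<phi>_def)
  qed
  have s2: "s y * s y = 1 - G y y" "s y > 0" if "y \<in> B p" for p y
    using that by (auto simp: B_def s_def)
  have psiH: "\<psi> p y \<in> H p" "\<phi> p (\<psi> p y) = y" "G (\<psi> p y) p = s y" if p: "p \<in> U" and y: "y \<in> B p" for p y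
  proof -
    have 0: "G y p = 0" "G p y = 0" "y \<in> W" using y by (auto simp: B_def T_def sym[of p])
    show *: "G (\<psi> p y) p = s y" using 0 p by (simp add: \<psi>_def Gs U1)
    have "G (\<psi> p y) (\<psi> p y) = 1" using 0 s2[OF y] p by (simp add: \<psi>_def Gs U1 algebra_simps)
    then show "\<psi> p y \<in> H p" using * s2[OF y] 0 p by (auto simp: H_def U_def \<psi>_def Wc)
    show "\<phi> p (\<psi> p y) = y" using * by (simp add: \<phi>_def) (simp add: \<psi>_def)
  qed
  have HB: "\<phi> p ` H p = B p" if "p \<in> U" for p
    using phiB psiH that by (force simp: image_iff set_eq_iff)
  have cim: "cimg N p = B p" if "p \<in> U" for p
    unfolding cimg_def cd[OF that] HB[OF that, symmetric]
    using HU UW that by (intro image_cong) (auto intro!: ch)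
  have cv: "cinv N p y = \<psi> p y" if p: "p \<in> U" and y: "y \<in> B p" for p y
  proof -
    have "inj_on (chart N p) (H p)"
      using phiB p HU UW ch by (smt (verit) inj_onI subsetD)
    moreover have "chart N p (\<psi> p y) = y" "\<psi> p y \<in> H p"
      using psiH[OF p y] HU UW ch p by (auto simp: subset_iff)
    ultimately show ?thesis unfolding cinv_def cd[OF p] by (metis inv_into_f_eq)
  qed
  have tr: "transition N p q y = \<phi> q (\<psi> p y)" if "p \<in> U" "q \<in> U" "y \<in> B p" for p q y
    using that psiH[of p y] HU UW by (auto simp: transition_def cv intro!: ch)
  have Gbl: "bounded_linear (\<lambda>u. G u p)" for p using bounded_bilinear.bounded_linear_left[OF G] .
  have sB: "continuous_on A s" for A
    unfolding s_def by (intro continuous_intros cont)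
  have homeo: "homeomorphic_map (subtopology (rtop N) (cdom N p)) (top_of_set (cimg N p)) (chart N p)"
    if p: "p \<in> U" for p
  proof -
    have "homeomorphic_maps (top_of_set (H p)) (top_of_set (B p)) (\<phi> p) (\<psi> p)"
      unfolding homeomorphic_maps_def
      using phiB[OF p] psiH[OF p]
      by (auto simp: \<phi>_def[abs_def] \<psi>_def[abs_def] intro!: continuous_intros cont sB)
    then have "homeomorphic_map (top_of_set (H p)) (top_of_set (B p)) (\<phi> p)"
      using homeomorphic_map_maps by blast
    moreover have "subtopology (rtop N) (cdom N p) = top_of_set (H p)"
      using HU by (simp add: top cd[OF p] subtopology_subtopology Int_absorb1)
    moreover have "\<phi> p u = chart N p u" if "u \<in> H p" for u
      using that HU UW ch[OF p] by (metis subsetD)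
    ultimately show ?thesis
      using cim[OF p] by (auto intro: homeomorphic_map_eq[where f="\<phi> p"])
  qed
  have dimT: "dim (T p) = d" if p: "p \<in> U" for p
  proof -
    have "p \<notin> T p" using U1[OF p] by (simp add: T_def)
    then have pT: "p \<notin> span (T p)" using sub[of p] span_eq_iff by metis
    have "span (insert p (T p)) = W"
    proof
      show "span (insert p (T p)) \<subseteq> W" using UW[OF p] TW[of p] W(1) by (simp add: span_minimal)
      show "W \<subseteq> span (insert p (T p))"
      proof
        fix w assume "w \<in> W"
        then have "w - G w p *\<^sub>R p \<in> T p" using U1[OF p] UW[OF p] by (auto simp: T_def Wc Gs sym[of p w])
        then show "w \<in> span (insert p (T p))"
          using span_base[of _ "T p"] by (auto simp: span_breakdown_eq)
      qed
    qed
    then have "dim W = Suc (dim (T p))"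
      using pT dim_insert[of p "T p"] dim_span[of "insert p (T p)"] by simp
    then show ?thesis using W by simp
  qed
  have ipT: "inner_product_on (T p) (rmetric N p)" for p
    using pos unfolding inner_product_on_def
    by (auto simp: T_def rm Wc Gs sym)
  have smooth: "Ck_on k (T p) (B p) (\<lambda>y. \<phi> q (\<psi> p y))" if "p \<in> U" for p q k
  proof -
    have cs: "Ck_on k (T p) (B p) s"
      unfolding s_def[abs_def] by (intro Ck_on_sqrt G sym) (auto simp: B_def)
    have psi: "Ck_on k (T p) (B p) (\<psi> p)"
      unfolding \<psi>_def[abs_def]
      by (intro Ck_on_add Ck_on_scaleR cs Ck_on_const Ck_on_linear bounded_linear_ident)
    have "Ck_on k (T p) (B p) (\<lambda>y. \<psi> p y + G (\<psi> p y) q *\<^sub>R (- q))"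
      by (intro Ck_on_add Ck_on_scaleR psi Ck_on_bilinear[OF G] Ck_on_const)
    then show ?thesis by (simp add: \<phi>_def)
  qed
  have trans: "smooth_on (tspace N p) (chart N p ` (cdom N p \<inter> cdom N q)) (transition N p q)"
    if p: "p \<in> U" and q: "q \<in> U" for p q
  proof -
    have sb: "chart N p ` (cdom N p \<inter> cdom N q) \<subseteq> B p"
      using cim[OF p] by (auto simp: cimg_def)
    show ?thesis unfolding smooth_on_def tsp[OF p]
    proof
      fix k show "Ck_on k (T p) (chart N p ` (cdom N p \<inter> cdom N q)) (transition N p q)"
        by (rule Ck_on_cong[OF _ Ck_on_subset[OF sb smooth[OF p, of k q]]])
           (use tr[OF p q] sb in auto)
    qed
  qed
  have gc: "gcoord N p y a b = G a b + G y a * G y b * (1 / s y)^2"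
    if p: "p \<in> U" and y: "y \<in> B p" and ab: "a \<in> T p" "b \<in> T p" for p y a b
  proof -
    define q where "q = \<psi> p y"
    have q: "q \<in> U" using psiH[OF p y] HU by (auto simp: q_def)
    have qc: "q = cinv N p y" using cv[OF p y] by (simp add: q_def)
    define D where "D = frechet_derivative (transition N p q) (at y within B p)"
    define E where "E a = (a + (- (G y a / s y)) *\<^sub>R p) - G (a + (- (G y a / s y)) *\<^sub>R p) q *\<^sub>R q" for a
    have "(s has_derivative (\<lambda>a. - (G y a / s y))) (at y within B p)"
    proof -
      have *: "((\<lambda>y. 1 - G y y) has_derivative (\<lambda>w. - (2 * G y w))) (at y within B p)"
        by (rule derivative_eq_intros bounded_bilinear.FDERIV[OF G] refl)+ (auto simp: sym[of _ y])
      show ?thesis unfolding s_def[abs_def]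
        using has_derivative_real_sqrt[OF _ *] y by (simp add: B_def field_simps)
    qed
    then have "((\<lambda>y. \<psi> p y) has_derivative (\<lambda>a. a + (- (G y a / s y)) *\<^sub>R p)) (at y within B p)"
      unfolding \<psi>_def by (intro derivative_intros)
    then have "((\<lambda>y. \<phi> q (\<psi> p y)) has_derivative E) (at y within B p)"
      unfolding \<phi>_def E_def
      by (intro derivative_intros bounded_linear.has_derivative[OF Gbl])
    then have E: "(transition N p q has_derivative E) (at y within B p)"
      by (rule has_derivative_transform[OF y, rotated]) (use tr[OF p q] in auto)
    then have "(transition N p q has_derivative D) (at y within B p)"
      unfolding D_def by (metis differentiableI frechet_derivative_works)
    then have DE: "D a = E a" if "a \<in> T p" for a
      using derivative_unique_along[OF _ E opB sub y that] by blast
    have Ea: "E a = a + (- (G y a / s y)) *\<^sub>R p" if "a \<in> T p" for a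
    proof -
      have "s y \<noteq> 0" using s2[OF y] by simp
      moreover have "G a p = 0" "G p y = 0" using that y by (auto simp: T_def B_def sym[of _ p])
      ultimately have "G (a + (- (G y a / s y)) *\<^sub>R p) q = 0"
        using p by (simp add: q_def \<psi>_def Gs U1 sym[of a y])
      then show ?thesis by (simp add: E_def)
    qed
    have "gcoord N p y a b = rmetric N q (D a) (D b)"
      by (simp add: gcoord_def Let_def D_def qc cim[OF p])
    also have "\<dots> = G (E a) (E b)"
      using ab TW UW[OF p] by (auto simp: DE Ea rm Wc subset_iff)
    also have "\<dots> = G a b + G y a * G y b * (1 / s y)^2"
    proof -
      have "G p a = 0" "G p b = 0" "G a p = 0" "G b p = 0"
        using ab by (auto simp: T_def sym[of a p] sym[of b p])
      then show ?thesis
        unfolding Ea[OF ab(1)] Ea[OF ab(2)]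
        by (simp add: Gs U1[OF p] power2_eq_square)
    qed
    finally show ?thesis .
  qed
  have gsm: "smooth_on (tspace N p) (cimg N p) (\<lambda>y. gcoord N p y a b)"
    if p: "p \<in> U" and ab: "a \<in> tspace N p" "b \<in> tspace N p" for p a b
    unfolding smooth_on_def tsp[OF p] cim[OF p]
  proof
    fix k
    have rs: "Ck_on k (T p) (B p) (\<lambda>y. 1 / s y)"
      unfolding s_def by (intro Ck_on_rsqrt G sym) (auto simp: B_def)
    have "Ck_on k (T p) (B p) (\<lambda>y. G a b + G y a * G y b * (1 / s y)^2)"
      unfolding power2_eq_square
      by (intro Ck_on_add Ck_on_mult Ck_on_const Ck_on_linear[OF Gbl] rs)
    then show "Ck_on k (T p) (B p) (\<lambda>y. gcoord N p y a b)"
      by (rule Ck_on_cong[rotated]) (use gc p ab tsp in auto)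
  qed
  have pH: "p \<in> H p" if "p \<in> U" for p using that by (simp add: H_def U1)
  have "Hausdorff_space (rtop N)" "second_countable (rtop N)"
    unfolding top
    by (auto simp: Hausdorff_space_subtopology second_countable_subtopology second_countable_euclidean)
  then have "riemannian_manifold d N"
    unfolding riemannian_manifold_def pts
  proof (intro conjI ballI)
    fix p assume p: "p \<in> U"
    show "subspace (tspace N p)" "dim (tspace N p) = d" using sub dimT[OF p] by (simp_all add: tsp[OF p])
    show "openin (rtop N) (cdom N p)" "p \<in> cdom N p"
      using opH pH[OF p] by (simp_all add: cd[OF p] top)
    show "openin (top_of_set (tspace N p)) (cimg N p)"
      using opB[of p] by (simp add: cim[OF p] tsp[OF p])
    show "inner_product_on (tspace N p) (rmetric N p)"
      using ipT by (simp add: tsp[OF p])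
  qed (assumption | erule homeo | (rule trans; assumption) | (rule gsm; assumption))+
  then show ?thesis by (simp add: N_def)
qed

end

theory Submission
  imports Defs
begin

text \<open>
  For \<open>x\<close> in \<open>M\<close> and \<open>X \<subseteq> M\<close> let \<open>A\<^sub>X\<close> and \<open>B\<^sub>X\<close> be the sets of unit vectors \<open>v\<close> at \<open>x\<close> such that a small
  sector around \<open>v\<close>, taken in the chart at \<open>x\<close>, lies in \<open>X\<close> or avoids \<open>X\<close>, respectively. Both are open.
  By a priori estimates for geodesics and Brouwer's theorem, the exponential image of a cone contains a
  sector, so for \<open>X\<close> in the collection \<open>A\<^sub>X \<union> B\<^sub>X\<close> is dense. Straight lines in the chart give
  \<open>A\<^sub>X \<subseteq> U\<^sub>x X\<close>, and a curve with velocity \<open>v\<close> enters every sector around \<open>v\<close>, so that \<open>U\<^sub>x X\<close> is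
  disjoint from \<open>B\<^sub>X\<close>. Hence \<open>ci (U\<^sub>x X)\<close> is the closure of \<open>A\<^sub>X\<close>, and the closed sets \<open>ci (U\<^sub>x X)\<close>
  behave under unions and intersections of the \<open>X\<close> just like the open sets \<open>A\<^sub>X\<close>; both identities follow
  by induction on the dimension. Finally \<open>X\<close> is recovered as the closure of the set of base points of
  its image, because all directions at an interior point of \<open>X\<close> belong to \<open>A\<^sub>X\<close>.
\<close>

section \<open>Derivatives along a subspace and Lipschitz bounds\<close>

text \<open>Existence of geodesics is part of the data, because a cone occurring in
  \<open>C_set\<close> lies in \<open>exp_dom\<close> by definition. What must be shown is that
  \<open>exp_rel\<close> is single-valued for short vectors (\<open>rexp\<close> is a definite
  description), that short geodesics stay in one chart, and that the image of a cone is not too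
  thin. Brouwer's theorem asks only for continuity and closeness to the identity, which is exactly
  what the estimates deliver. The set \<open>U_set M x X\<close> is never determined. It is
  squeezed: it contains one open set of directions and avoids another, and as these two together are
  dense, \<open>ci\<close> forgets everything in between. The identities are checked fibre by fibre.
  The induction hypothesis is applied only to the sets of directions of X and of Y, which belong to
  the collection by condition (c); the union and the regularised intersection enter only through the
  formula for their fibres.\<close>

definition lin_on :: "'e::real_vector set \<Rightarrow> ('e \<Rightarrow> real) \<Rightarrow> bool" where
  "lin_on W T \<longleftrightarrow> (\<forall>a\<in>W. \<forall>b\<in>W. T (a + b) = T a + T b) \<and> (\<forall>a\<in>W. \<forall>c. T (c *\<^sub>R a) = c * T a)"

section \<open>Derivatives of maps with values in a linear subspace\<close>

lemma subspace_projection: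
  fixes V :: "'e::euclidean_space set"
  assumes "subspace V"
  obtains P where "bounded_linear P" "\<And>x. x \<in> V \<Longrightarrow> P x = x" "\<And>x. P x \<in> V"
proof -
  obtain B where B: "B \<subseteq> V" "independent B" "V = span B"
    using basis_exists[of V] assms by (metis span_subspace)
  obtain P where P: "linear P" "\<forall>x\<in>B. P x = x" "range P = span B"
    using linear_independent_extend_subspace[OF B(2), of id] by auto
  show thesis
  proof
    show "bounded_linear P" using P(1) linear_linear by blast
    show "P x \<in> V" for x using P(3) B(3) by auto
    show "P x = x" if "x \<in> V" for x
      using linear_eq_on_span[OF P(1) linear_id, of B x] P(2) that B(3) by auto
  qed
qed

text \<open>A projection P onto V fixes the values of f, so both D and its composition with P are
  derivatives of f; they agree on W by uniqueness, and the second one takes values in V.\<close>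

lemma derivative_in_subspace:
  fixes f :: "'e::euclidean_space \<Rightarrow> 'f::euclidean_space"
  assumes f: "(f has_derivative D) (at y within S)"
    and S: "openin (top_of_set W) S" "subspace W" "y \<in> S" "a \<in> W"
    and V: "subspace V" "f ` S \<subseteq> V"
  shows "D a \<in> V"
proof -
  obtain P where P: "bounded_linear P" "\<And>x. x \<in> V \<Longrightarrow> P x = x" "\<And>x. P x \<in> V"
    using subspace_projection[OF V(1)] by metis
  have "((\<lambda>x. P (f x)) has_derivative (\<lambda>x. P (D x))) (at y within S)"
    using bounded_linear.has_derivative[OF P(1) f] .
  then have "(f has_derivative (\<lambda>x. P (D x))) (at y within S)"
    by (rule has_derivative_transform[OF S(3), rotated]) (use P V in auto)
  from derivative_unique_along[OF f this S] show ?thesis using P(3) by metis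
qed

lemma vector_derivative_in_subspace:
  fixes c :: "real \<Rightarrow> 'e::euclidean_space"
  assumes c: "(c has_vector_derivative v) (at t within J)"
    and J: "at t within J \<noteq> bot" "t \<in> J"
    and V: "subspace V" "c ` J \<subseteq> V"
  shows "v \<in> V"
proof -
  obtain P where P: "bounded_linear P" "\<And>x. x \<in> V \<Longrightarrow> P x = x" "\<And>x. P x \<in> V"
    using subspace_projection[OF V(1)] by metis
  have "((\<lambda>x. P (c x)) has_vector_derivative P v) (at t within J)"
    using bounded_linear.has_vector_derivative[OF P(1) c] .
  then have "(c has_vector_derivative P v) (at t within J)"
    by (rule has_vector_derivative_transform[OF J(2), rotated]) (use P V in auto)
  from vector_derivative_unique_within[OF J(1) c this] show ?thesis using P(3) by metis
qed

lemma orthonormal_expansion: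
  fixes W :: "'e::euclidean_space set"
  assumes "subspace W"
  obtains B where "finite B" "B \<subseteq> W" "\<And>b. b \<in> B \<Longrightarrow> norm b = 1"
    "\<And>w. w \<in> W \<Longrightarrow> w = (\<Sum>b\<in>B. (w \<bullet> b) *\<^sub>R b)"
proof -
  obtain B where B: "0 \<notin> B" "B \<subseteq> W" "pairwise orthogonal B" "\<And>x. x \<in> B \<Longrightarrow> norm x = 1"
    "independent B" "span B = W"
    using orthonormal_basis_subspace[OF assms] by (metis norm_zero zero_neq_one)
  have fin: "finite B" using B(5) independent_imp_finite by blast
  show thesis
    by (rule that[OF fin B(2)]) (use B fin orthonormal_basis_expand[of B] in auto)
qed

lemma lin_on_sum:
  assumes "lin_on W T" "subspace W" "finite B" "B \<subseteq> W"
  shows "T (\<Sum>b\<in>B. k b *\<^sub>R b) = (\<Sum>b\<in>B. k b * T b)"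
  using assms(3,4)
proof (induction B)
  case empty
  have "T (0 *\<^sub>R 0) = 0 * T 0" using assms(1,2) unfolding lin_on_def by (metis subspace_0)
  then show ?case by simp
next
  case (insert x F)
  then have "(\<Sum>b\<in>F. k b *\<^sub>R b) \<in> W" "k x *\<^sub>R x \<in> W"
    using assms(2) by (auto intro!: subspace_sum subspace_scale)
  then show ?case using insert assms(1) by (simp add: lin_on_def)
qed

text \<open>A single constant serves as bound and as Lipschitz constant, so that scaling and summing
  treat both properties at once.\<close>

definition bd_lip :: "'e::real_normed_vector set \<Rightarrow> real \<Rightarrow> ('e \<Rightarrow> real) \<Rightarrow> bool" where
  "bd_lip K L F \<longleftrightarrow> (\<forall>y\<in>K. \<bar>F y\<bar> \<le> L) \<and> (\<forall>y\<in>K. \<forall>z\<in>K. \<bar>F y - F z\<bar> \<le> L * norm (y - z))"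

lemma bd_lip_scale: "bd_lip K L F \<Longrightarrow> bd_lip K (\<bar>c\<bar> * L) (\<lambda>y. c * F y)"
proof -
  have "\<bar>c * F y - c * F z\<bar> = \<bar>c\<bar> * \<bar>F y - F z\<bar>" for y z
    by (simp only: abs_mult flip: right_diff_distrib)
  moreover assume "bd_lip K L F"
  ultimately show ?thesis
    unfolding bd_lip_def by (simp only: abs_mult mult.assoc) (blast intro: mult_left_mono abs_ge_zero)
qed

lemma bd_lip_add: "bd_lip K L F \<Longrightarrow> bd_lip K L' F' \<Longrightarrow> bd_lip K (L + L') (\<lambda>y. F y + F' y)"
  unfolding bd_lip_def distrib_right
proof (intro conjI ballI, goal_cases)
  case (1 y)
  then show ?case using abs_triangle_ineq[of "F y" "F' y"] by (force intro: order_trans add_mono)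
next
  case (2 y z)
  then have "\<bar>F y - F z\<bar> \<le> L * norm (y - z)" "\<bar>F' y - F' z\<bar> \<le> L' * norm (y - z)" by auto
  then show ?case by linarith
qed

lemma bd_lip_sum: "(\<And>i. i \<in> B \<Longrightarrow> bd_lip K (L i) (F i)) \<Longrightarrow> bd_lip K (\<Sum>i\<in>B. L i) (\<lambda>y. \<Sum>i\<in>B. F i y)"
proof (induction B rule: infinite_finite_induct)
  case (insert x B)
  then show ?case by (simp add: bd_lip_add)
qed (simp_all add: bd_lip_def)

lemma bd_lip_mono: "bd_lip K L F \<Longrightarrow> L \<le> L' \<Longrightarrow> bd_lip K L' F"
  unfolding bd_lip_def
proof (intro conjI ballI, goal_cases)
  case (1 y)
  then show ?case by force
next
  case (2 y z)
  then have "\<bar>F y - F z\<bar> \<le> L * norm (y - z)" by blast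
  also have "\<dots> \<le> L' * norm (y - z)" using 2 by (intro mult_right_mono) auto
  finally show ?case .
qed

lemma bd_lip_cong: "bd_lip K L F \<Longrightarrow> (\<And>y. y \<in> K \<Longrightarrow> F y = F' y) \<Longrightarrow> bd_lip K L F'"
  unfolding bd_lip_def by simp

text \<open>Expanding w in an orthonormal basis turns bounds for basis vectors into a bound
  proportional to \<open>norm w\<close>. The parameter x stands for the remaining arguments and
  \<open>n x\<close> for the product of their norms; iterating the step frees a multilinear form
  from its basis arguments one slot at a time.\<close>

lemma bd_lip_linear_step:
  assumes B: "finite B" "B \<subseteq> W" "\<And>b. b \<in> B \<Longrightarrow> norm b = 1"
    "\<And>w. w \<in> W \<Longrightarrow> w = (\<Sum>b\<in>B. (w \<bullet> b) *\<^sub>R b)" and W: "subspace W"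
    and lin: "\<And>y x. y \<in> K \<Longrightarrow> x \<in> X \<Longrightarrow> lin_on W (h y x)"
    and n: "\<And>x. x \<in> X \<Longrightarrow> n x \<ge> 0"
    and bd: "\<And>b. b \<in> B \<Longrightarrow> \<exists>L\<ge>0. \<forall>x\<in>X. bd_lip K (L * n x) (\<lambda>y. h y x b)"
  shows "\<exists>L\<ge>0. \<forall>x\<in>X. \<forall>w\<in>W. bd_lip K (L * (n x * norm w)) (\<lambda>y. h y x w)"
proof -
  obtain l where l: "\<And>b. b \<in> B \<Longrightarrow> l b \<ge> 0" "\<And>b x. b \<in> B \<Longrightarrow> x \<in> X \<Longrightarrow> bd_lip K (l b * n x) (\<lambda>y. h y x b)"
    using bd by metis
  have "bd_lip K (sum l B * (n x * norm w)) (\<lambda>y. h y x w)" if "x \<in> X" "w \<in> W" for x w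
  proof -
    have 1: "bd_lip K (\<Sum>b\<in>B. \<bar>w \<bullet> b\<bar> * (l b * n x)) (\<lambda>y. \<Sum>b\<in>B. (w \<bullet> b) * h y x b)"
      using l that by (intro bd_lip_sum bd_lip_scale)
    have 2: "(\<Sum>b\<in>B. \<bar>w \<bullet> b\<bar> * (l b * n x)) \<le> (\<Sum>b\<in>B. norm w * (l b * n x))"
    proof (intro sum_mono mult_right_mono)
      fix b assume "b \<in> B"
      then show "\<bar>w \<bullet> b\<bar> \<le> norm w" "0 \<le> l b * n x"
        using Cauchy_Schwarz_ineq2[of w b] B(3)[of b] l n that by auto
    qed
    have 3: "(\<Sum>b\<in>B. norm w * (l b * n x)) = sum l B * (n x * norm w)"
      by (simp add: sum_distrib_right sum_distrib_left mult_ac)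
    have "bd_lip K (sum l B * (n x * norm w)) (\<lambda>y. \<Sum>b\<in>B. (w \<bullet> b) * h y x b)"
      by (rule bd_lip_mono[OF 1 2[unfolded 3]])
    moreover have "(\<Sum>b\<in>B. (w \<bullet> b) * h y x b) = h y x w" if "y \<in> K" for y
      using lin_on_sum[OF lin[OF that \<open>x \<in> X\<close>] W B(1,2), of "\<lambda>b. w \<bullet> b", folded B(4)[OF \<open>w \<in> W\<close>]] by (rule sym)
    ultimately show ?thesis by (rule bd_lip_cong)
  qed
  then show ?thesis using l by (intro exI[of _ "sum l B"]) (auto intro: sum_nonneg)
qed

text \<open>\<open>Ck_on\<close> makes the derivative continuous only for each fixed direction in W.
  A uniform bound over K is therefore assembled from the finitely many basis directions, and the
  mean value inequality along segments of the convex set K gives the Lipschitz bound.\<close>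

lemma Ck_on_bd_lip:
  fixes f :: "'e::euclidean_space \<Rightarrow> real"
  assumes f: "Ck_on (Suc 0) W S f" and W: "subspace W" "S \<subseteq> W" and K: "K \<subseteq> S" "compact K" "convex K"
  shows "\<exists>L\<ge>0. bd_lip K L f"
proof -
  obtain f' where f': "\<And>x. x \<in> S \<Longrightarrow> (f has_derivative f' x) (at x within S)"
    "\<And>w. w \<in> W \<Longrightarrow> continuous_on S (\<lambda>x. f' x w)"
    using f by auto
  obtain B where B: "finite B" "B \<subseteq> W" "\<And>b. b \<in> B \<Longrightarrow> norm b = 1"
    "\<And>w. w \<in> W \<Longrightarrow> w = (\<Sum>b\<in>B. (w \<bullet> b) *\<^sub>R b)"
    using orthonormal_expansion[OF W(1)] by metis
  have bounded: "\<exists>m\<ge>0. \<forall>x\<in>K. \<bar>F x\<bar> \<le> m" if "continuous_on S F" for F :: "'e \<Rightarrow> real"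
  proof -
    have "compact (F ` K)" using that K by (meson compact_continuous_image continuous_on_subset)
    then obtain m where "\<forall>x\<in>F ` K. norm x \<le> m" using compact_imp_bounded bounded_iff by blast
    then show ?thesis by (intro exI[of _ "\<bar>m\<bar>"]) force
  qed
  have "\<forall>b. \<exists>m\<ge>0. b \<in> B \<longrightarrow> (\<forall>x\<in>K. \<bar>f' x b\<bar> \<le> m)"
    using bounded[OF f'(2)] B(2) by (metis order_refl subsetD)
  then obtain m where m: "\<And>b. m b \<ge> 0" "\<And>b x. b \<in> B \<Longrightarrow> x \<in> K \<Longrightarrow> \<bar>f' x b\<bar> \<le> m b" by metis
  have lin: "lin_on W (f' x)" if "x \<in> K" for x
    using f'(1)[of x] that K has_derivative_bounded_linear[of f "f' x"]
    by (auto simp: lin_on_def linear_add linear_scale bounded_linear.linear subset_iff)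
  have der: "\<bar>f' x w\<bar> \<le> sum m B * norm w" if "x \<in> K" "w \<in> W" for x w
  proof -
    have "f' x w = (\<Sum>b\<in>B. (w \<bullet> b) * f' x b)"
      using lin_on_sum[OF lin[OF that(1)] W(1) B(1,2), of "\<lambda>b. w \<bullet> b", folded B(4)[OF \<open>w \<in> W\<close>]] .
    also have "\<bar>\<dots>\<bar> \<le> (\<Sum>b\<in>B. norm w * m b)"
      unfolding abs_mult
    proof (rule order_trans[OF sum_abs], rule sum_mono)
      fix b assume "b \<in> B"
      then have "\<bar>w \<bullet> b\<bar> \<le> norm w" using Cauchy_Schwarz_ineq2[of w b] B(3) by auto
      then show "\<bar>(w \<bullet> b) * f' x b\<bar> \<le> norm w * m b" unfolding abs_mult
        using m \<open>b \<in> B\<close> that by (intro mult_mono) auto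
    qed
    finally show ?thesis by (simp add: sum_distrib_left mult.commute)
  qed
  have lip: "\<bar>f y - f z\<bar> \<le> sum m B * norm (y - z)" if "y \<in> K" "z \<in> K" for y z
  proof -
    define \<phi> where "\<phi> t = z + t *\<^sub>R (y - z)" for t :: real
    have \<phi>K: "\<phi> t \<in> K" if "t \<in> {0..1}" for t
      using convexD_alt[OF K(3) \<open>z \<in> K\<close> \<open>y \<in> K\<close>, of t] that by (simp add: \<phi>_def algebra_simps)
    have yz: "y - z \<in> W" using that K W by (auto intro: subspace_diff)
    have "norm (f (\<phi> 1) - f (\<phi> 0)) \<le> (sum m B * norm (y - z)) * norm ((1::real) - 0)"
    proof (rule differentiable_bound[of "{0..1::real}" "\<lambda>t. f (\<phi> t)" "\<lambda>t h. f' (\<phi> t) (h *\<^sub>R (y - z))"])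
      fix t :: real assume t: "t \<in> {0..1}"
      have *: "(\<phi> has_derivative (\<lambda>h. h *\<^sub>R (y - z))) (at t within {0..1})"
        unfolding \<phi>_def by (auto intro!: derivative_eq_intros)
      show "((\<lambda>t. f (\<phi> t)) has_derivative (\<lambda>h. f' (\<phi> t) (h *\<^sub>R (y - z)))) (at t within {0..1})"
        by (rule has_derivative_in_compose[OF *])
           (use \<phi>K t K f'(1) in \<open>blast intro: has_derivative_subset\<close>)
      show "onorm (\<lambda>h. f' (\<phi> t) (h *\<^sub>R (y - z))) \<le> sum m B * norm (y - z)"
        using der[OF \<phi>K[OF t] subspace_scale[OF W(1) yz]]
        by (intro onorm_bound) (auto simp: mult_ac intro!: mult_nonneg_nonneg sum_nonneg m)
    qed auto
    then show ?thesis by (simp add: \<phi>_def)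
  qed
  have "continuous_on S f" using f Ck_on_mono[of 0 W S f] by simp
  from bounded[OF this] obtain m0 where "m0 \<ge> 0" "\<forall>x\<in>K. \<bar>f x\<bar> \<le> m0" by auto
  moreover have "0 \<le> sum m B" using m by (simp add: sum_nonneg)
  moreover have "bd_lip K (m0 + sum m B) f"
    unfolding bd_lip_def distrib_right using calculation lip
    by (smt (verit) mult_nonneg_nonneg norm_ge_zero)
  ultimately show ?thesis by (intro exI[of _ "m0 + sum m B"]) auto
qed

section \<open>The acceleration of a geodesic\<close>

text \<open>The acceleration \<alpha> is given implicitly by the geodesic equation, and both
  estimates come from testing the equation: with w = \<alpha> for the size, with the difference of
  two accelerations for the Lipschitz bound. The factor m in the latter reflects that the equation
  is quadratic in the velocity; it is what later makes slow geodesics contracting.\<close>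

lemma acceleration_bounds:
  fixes W S :: "'e::euclidean_space set"
  assumes W: "subspace W" and S: "openin (top_of_set W) S" "p \<in> S"
    and g: "\<And>y a. y \<in> S \<Longrightarrow> a \<in> W \<Longrightarrow> lin_on W (g y a)"
      "\<And>y a b. y \<in> S \<Longrightarrow> a \<in> W \<Longrightarrow> b \<in> W \<Longrightarrow> g y a b = g y b a"
      "\<And>a b. a \<in> W \<Longrightarrow> b \<in> W \<Longrightarrow> Ck_on (Suc 0) W S (\<lambda>y. g y a b)"
    and pos: "inner_product_on W (g p)"
    and \<Gamma>: "\<And>y a b. y \<in> S \<Longrightarrow> a \<in> W \<Longrightarrow> b \<in> W \<Longrightarrow> lin_on W (\<Gamma> y a b)"
      "\<And>y a w. y \<in> S \<Longrightarrow> a \<in> W \<Longrightarrow> w \<in> W \<Longrightarrow> lin_on W (\<lambda>b. \<Gamma> y a b w)"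
      "\<And>y a b w. y \<in> S \<Longrightarrow> a \<in> W \<Longrightarrow> b \<in> W \<Longrightarrow> w \<in> W \<Longrightarrow> \<Gamma> y a b w = \<Gamma> y b a w"
      "\<And>a b w. a \<in> W \<Longrightarrow> b \<in> W \<Longrightarrow> w \<in> W \<Longrightarrow> Ck_on (Suc 0) W S (\<lambda>y. \<Gamma> y a b w)"
  obtains R C where "R > 0" "C > 0" "cball p R \<inter> W \<subseteq> S"
    "\<And>y a \<alpha>. \<lbrakk>y \<in> cball p R \<inter> W; a \<in> W; \<alpha> \<in> W; \<And>w. w \<in> W \<Longrightarrow> g y \<alpha> w + \<Gamma> y a a w = 0\<rbrakk>
      \<Longrightarrow> norm \<alpha> \<le> C * (norm a)\<^sup>2"
    "\<And>y1 y2 a1 a2 \<alpha>1 \<alpha>2 m. \<lbrakk>y1 \<in> cball p R \<inter> W; y2 \<in> cball p R \<inter> W; a1 \<in> W; a2 \<in> W; \<alpha>1 \<in> W; \<alpha>2 \<in> W;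
      \<And>w. w \<in> W \<Longrightarrow> g y1 \<alpha>1 w + \<Gamma> y1 a1 a1 w = 0; \<And>w. w \<in> W \<Longrightarrow> g y2 \<alpha>2 w + \<Gamma> y2 a2 a2 w = 0;
      norm a1 \<le> m; norm a2 \<le> m; m \<le> 1\<rbrakk>
      \<Longrightarrow> norm (\<alpha>1 - \<alpha>2) \<le> C * m * (norm (y1 - y2) + norm (a1 - a2))"
proof -
  note Wc = subspace_add[OF W] subspace_diff[OF W] subspace_scale[OF W] subspace_0[OF W]
  have SW: "S \<subseteq> W" using S openin_imp_subset by blast
  then have pW: "p \<in> W" using S by blast
  obtain R0 where R0: "R0 > 0" "cball p R0 \<inter> W \<subseteq> S"
    using S by (meson openin_contains_cball)
  define K where "K = cball p R0 \<inter> W"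
  have K: "K \<subseteq> S" "compact K" "convex K"
    using R0 W by (auto simp: K_def closed_subspace compact_Int_closed convex_Int subspace_imp_convex)
  have pK: "p \<in> K" using R0 pW by (simp add: K_def)
  obtain B where B: "finite B" "B \<subseteq> W" "\<And>b. b \<in> B \<Longrightarrow> norm b = 1"
    "\<And>w. w \<in> W \<Longrightarrow> w = (\<Sum>b\<in>B. (w \<bullet> b) *\<^sub>R b)"
    using orthonormal_expansion[OF W] by metis
  note step = bd_lip_linear_step[OF B W, of K]
  have inS: "y \<in> K \<Longrightarrow> y \<in> S" and inW: "b \<in> B \<Longrightarrow> b \<in> W" for y b using K B by auto
  \<comment> \<open>The second slot is freed while the first holds a basis vector; symmetry of g
    exchanges the slots, and a further application frees the other one.\<close>
  have "\<exists>L\<ge>0. \<forall>x\<in>W. \<forall>w\<in>W. bd_lip K (L * (norm x * norm w)) (\<lambda>y. g y x w)"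
  proof (rule step)
    fix b assume b: "b \<in> B"
    have "\<exists>L\<ge>0. \<forall>x\<in>{()}. \<forall>w\<in>W. bd_lip K (L * (1 * norm w)) (\<lambda>y. g y b w)"
      by (rule step) (use Ck_on_bd_lip[OF g(3) W SW K] g b inS inW in auto)
    then obtain L where L: "L \<ge> 0" "\<And>w. w \<in> W \<Longrightarrow> bd_lip K (L * norm w) (\<lambda>y. g y b w)" by auto
    have "bd_lip K (L * norm w) (\<lambda>y. g y w b)" if "w \<in> W" for w
      by (rule bd_lip_cong[OF L(2)[OF that]]) (use g b inS inW that in auto)
    with L(1) show "\<exists>L\<ge>0. \<forall>x\<in>W. bd_lip K (L * norm x) (\<lambda>y. g y x b)" by blast
  qed (use g inS in auto)
  then obtain Lg where Lg: "Lg \<ge> 0" "\<And>a b. a \<in> W \<Longrightarrow> b \<in> W \<Longrightarrow> bd_lip K (Lg * (norm a * norm b)) (\<lambda>y. g y a b)"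
    by blast
  \<comment> \<open>Three nested applications free w, then b, then a. Linearity in a is inherited
    from linearity in b through the symmetry of \<Gamma>.\<close>
  have "\<exists>L\<ge>0. \<forall>x\<in>W\<times>W. \<forall>a\<in>W. bd_lip K (L * ((norm (fst x) * norm (snd x)) * norm a)) (\<lambda>y. \<Gamma> y a (snd x) (fst x))"
  proof (rule step)
    fix i assume i: "i \<in> B"
    have "\<exists>L\<ge>0. \<forall>w\<in>W. \<forall>b\<in>W. bd_lip K (L * (norm w * norm b)) (\<lambda>y. \<Gamma> y i b w)"
    proof (rule step)
      fix j assume j: "j \<in> B"
      have "\<exists>L\<ge>0. \<forall>x\<in>{()}. \<forall>w\<in>W. bd_lip K (L * (1 * norm w)) (\<lambda>y. \<Gamma> y i j w)"
        by (rule step) (use Ck_on_bd_lip[OF \<Gamma>(4) W SW K] \<Gamma> i j inS inW in auto)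
      then show "\<exists>L\<ge>0. \<forall>w\<in>W. bd_lip K (L * norm w) (\<lambda>y. \<Gamma> y i j w)" by auto
    qed (use \<Gamma> inS inW i in auto)
    then show "\<exists>L\<ge>0. \<forall>x\<in>W\<times>W. bd_lip K (L * (norm (fst x) * norm (snd x))) (\<lambda>y. \<Gamma> y i (snd x) (fst x))"
      by auto
  next
    fix y and x :: "'e \<times> 'e" assume yx: "y \<in> K" "x \<in> W \<times> W"
    then have *: "\<Gamma> y (snd x) a (fst x) = \<Gamma> y a (snd x) (fst x)" if "a \<in> W" for a
      using \<Gamma>(3) inS that by auto
    have "lin_on W (\<lambda>a. \<Gamma> y (snd x) a (fst x))" using \<Gamma>(2) yx inS by auto
    then show "lin_on W (\<lambda>a. \<Gamma> y a (snd x) (fst x))"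
      unfolding lin_on_def using * Wc by simp
  qed auto
  then obtain LG where LG: "LG \<ge> 0" "\<And>w b a. w \<in> W \<Longrightarrow> b \<in> W \<Longrightarrow> a \<in> W \<Longrightarrow>
      bd_lip K (LG * (norm w * norm b * norm a)) (\<lambda>y. \<Gamma> y a b w)"
    by auto
  define L where "L = Lg + LG + 1"
  have L: "L \<ge> 1" "Lg \<le> L" "LG \<le> L" using Lg LG by (auto simp: L_def)
  have gl: "\<bar>g y a b - g z a b\<bar> \<le> L * (norm a * norm b) * norm (y - z)"
    if "y \<in> K" "z \<in> K" "a \<in> W" "b \<in> W" for y z a b
    using bd_lip_mono[OF Lg(2)[OF that(3,4)], of "L * (norm a * norm b)"] L that
    by (auto simp: bd_lip_def mult_right_mono)
  have Gl: "\<bar>\<Gamma> y a b w - \<Gamma> z a b w\<bar> \<le> L * (norm w * norm b * norm a) * norm (y - z)"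
    and Gb: "\<bar>\<Gamma> y a b w\<bar> \<le> L * (norm w * norm b * norm a)"
    if "y \<in> K" "z \<in> K" "a \<in> W" "b \<in> W" "w \<in> W" for y z a b w
    using bd_lip_mono[OF LG(2)[OF that(5,4,3)], of "L * (norm w * norm b * norm a)"] L that
    by (auto simp: bd_lip_def mult_right_mono)
  obtain G where G: "bounded_bilinear G" "\<And>u v. G u v = G v u"
    "\<And>u v. u \<in> W \<Longrightarrow> v \<in> W \<Longrightarrow> g p u v = G u v"
    using inner_product_extend[OF W pos] by metis
  \<comment> \<open>\<mu> is the minimum of the quadratic form on the unit sphere of W. For W = {0}
    this sphere is empty, and any positive number will do.\<close>
  obtain \<mu> where \<mu>: "\<mu> > 0" "\<And>a. a \<in> W \<Longrightarrow> g p a a \<ge> \<mu> * (norm a)\<^sup>2"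
  proof (cases "W \<inter> sphere 0 1 = {}")
    case True
    have z: "a = 0" if "a \<in> W" for a
    proof (rule ccontr)
      assume "a \<noteq> 0"
      then have "(1 / norm a) *\<^sub>R a \<in> W \<inter> sphere 0 1" using that Wc by simp
      with True show False by blast
    qed
    have "g p 0 0 = 0" using G bounded_bilinear.zero_left Wc by metis
    then have "g p a a \<ge> 1 * (norm a)\<^sup>2" if "a \<in> W" for a unfolding z[OF that] by simp
    then show thesis using that[of 1] zero_less_one by blast
  next
    case False
    have "compact (W \<inter> sphere 0 1)" using W by (simp add: closed_Int_compact closed_subspace)
    moreover have "continuous_on (W \<inter> sphere 0 1) (\<lambda>a. G a a)"
      by (intro bounded_bilinear.continuous_on[OF G(1)] continuous_on_id)
    ultimately obtain a0 where "a0 \<in> W \<inter> sphere 0 1" "\<forall>a\<in>W \<inter> sphere 0 1. G a0 a0 \<le> G a a"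
      using continuous_attains_inf[of "W \<inter> sphere 0 1" "\<lambda>a. G a a"] False by blast
    then have a0: "a0 \<in> W" "norm a0 = 1" "\<And>a. a \<in> W \<Longrightarrow> norm a = 1 \<Longrightarrow> G a0 a0 \<le> G a a"
      by simp_all
    show thesis
    proof (rule that[of "G a0 a0"])
      have "a0 \<noteq> 0" using a0(2) by auto
      then have "0 < g p a0 a0" using pos a0(1) unfolding inner_product_on_def by blast
      then show "0 < G a0 a0" using G(3) a0(1) by simp
      fix a assume a: "a \<in> W"
      show "G a0 a0 * (norm a)\<^sup>2 \<le> g p a a"
      proof (cases "a = 0")
        case True
        then show ?thesis using G(3)[OF a a] by (simp add: bounded_bilinear.zero_left[OF G(1)])
      next
        case False
        define u where "u = (1 / norm a) *\<^sub>R a"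
        have u: "u \<in> W" "norm u = 1" "a = norm a *\<^sub>R u" using a False Wc by (auto simp: u_def)
        have "G a a = (norm a)\<^sup>2 * G u u"
          by (subst (1 2) u(3))
            (simp add: bounded_bilinear.scaleR_left[OF G(1)] bounded_bilinear.scaleR_right[OF G(1)] power2_eq_square)
        then show ?thesis
          using mult_left_mono[OF a0(3)[OF u(1,2)], of "(norm a)\<^sup>2"] G(3)[OF a a] by (simp add: mult.commute)
      qed
    qed
  qed
  \<comment> \<open>Within distance \<mu> / (2 * L) of p the form g changes by at most \<mu> / 2, so
    half of its lower bound survives; this half is l.\<close>
  define R where "R = min R0 (\<mu> / (2 * L))"
  define l where "l = \<mu> / 2"
  have R: "R > 0" "R \<le> R0" "R \<le> \<mu> / (2 * L)" using R0 \<mu> L by (auto simp: R_def)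
  have l: "l > 0" using \<mu> by (simp add: l_def)
  have RK: "y \<in> K" if "y \<in> cball p R \<inter> W" for y using that R by (auto simp: K_def)
  have gp: "g y a a \<ge> l * (norm a)\<^sup>2" if y: "y \<in> cball p R \<inter> W" and a: "a \<in> W" for y a
  proof -
    have "\<bar>g y a a - g p a a\<bar> \<le> L * (norm a * norm a) * norm (y - p)"
      using gl[OF RK[OF y] pK a a] .
    also have "\<dots> \<le> L * (norm a * norm a) * (\<mu> / (2 * L))"
      using y R L by (intro mult_left_mono) (auto simp: dist_norm norm_minus_commute)
    also have "\<dots> = l * (norm a)\<^sup>2" using L by (simp add: l_def power2_eq_square)
    finally have "\<bar>g y a a - g p a a\<bar> \<le> l * (norm a)\<^sup>2" .
    moreover have "\<mu> * (norm a)\<^sup>2 = 2 * (l * (norm a)\<^sup>2)" by (simp add: l_def)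
    ultimately show ?thesis using \<mu>(2)[OF a] by linarith
  qed
  have glin: "g y (a - a') b = g y a b - g y a' b" if "y \<in> S" "a \<in> W" "a' \<in> W" "b \<in> W" for y a a' b
  proof -
    have "g y b ((a - a') + a') = g y b (a - a') + g y b a'"
      using g(1)[OF that(1,4)] that Wc unfolding lin_on_def by blast
    then show ?thesis using g(2) that Wc by simp
  qed
  have Glin: "\<Gamma> y a (b - b') w = \<Gamma> y a b w - \<Gamma> y a b' w"
    if "y \<in> S" "a \<in> W" "b \<in> W" "b' \<in> W" "w \<in> W" for y a b b' w
  proof -
    have "\<Gamma> y a ((b - b') + b') w = \<Gamma> y a (b - b') w + \<Gamma> y a b' w"
      using \<Gamma>(2)[OF that(1,2,5)] that Wc unfolding lin_on_def by blast
    then show ?thesis by simp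
  qed
  define k where "k = L / l"
  have k: "k > 0" using L l by (simp add: k_def)
  have cancel: "norm \<beta> \<le> x / l" if "l * (norm \<beta>)\<^sup>2 \<le> x * norm \<beta>" "x \<ge> 0" for \<beta> :: 'e and x
  proof (cases "\<beta> = 0")
    case False
    with that(1) have "l * norm \<beta> \<le> x" by (simp add: power2_eq_square)
    then show ?thesis using l by (simp add: field_simps)
  qed (use that l in simp)
  have acc1: "norm \<alpha> \<le> k * (norm a)\<^sup>2"
    if "y \<in> cball p R \<inter> W" "a \<in> W" "\<alpha> \<in> W" "\<And>w. w \<in> W \<Longrightarrow> g y \<alpha> w + \<Gamma> y a a w = 0" for y a \<alpha>
  proof -
    have "l * (norm \<alpha>)\<^sup>2 \<le> - \<Gamma> y a a \<alpha>" using gp[OF that(1,3)] that(4)[OF that(3)] by simp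
    also have "\<dots> \<le> L * (norm a)\<^sup>2 * norm \<alpha>"
      using Gb[OF RK[OF that(1)] pK that(2,2,3)] by (simp add: power2_eq_square mult_ac)
    finally have "norm \<alpha> \<le> L * (norm a)\<^sup>2 / l" using L by (intro cancel) auto
    then show ?thesis by (simp add: k_def)
  qed
  \<comment> \<open>The difference estimate produces a factor 2 at \<open>norm (a1 - a2)\<close> and
    1 + k at \<open>norm (y1 - y2)\<close>; the number 2 + k dominates both.\<close>
  define C where "C = k * (2 + k)"
  have C: "k \<le> C" "C > 0" using k by (auto simp: C_def algebra_simps intro!: add_pos_pos)
  show thesis
  proof (rule that[OF R(1) C(2)])
    show "cball p R \<inter> W \<subseteq> S" using RK K by blast
    show "norm \<alpha> \<le> C * (norm a)\<^sup>2"
      if "y \<in> cball p R \<inter> W" "a \<in> W" "\<alpha> \<in> W" "\<And>w. w \<in> W \<Longrightarrow> g y \<alpha> w + \<Gamma> y a a w = 0" for y a \<alpha>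
      using acc1[OF that] C(1) by (meson mult_right_mono order_trans zero_le_power2)
    show "norm (\<alpha>1 - \<alpha>2) \<le> C * m * (norm (y1 - y2) + norm (a1 - a2))"
      if y: "y1 \<in> cball p R \<inter> W" "y2 \<in> cball p R \<inter> W" and a: "a1 \<in> W" "a2 \<in> W"
        and \<alpha>: "\<alpha>1 \<in> W" "\<alpha>2 \<in> W"
        and eq: "\<And>w. w \<in> W \<Longrightarrow> g y1 \<alpha>1 w + \<Gamma> y1 a1 a1 w = 0" "\<And>w. w \<in> W \<Longrightarrow> g y2 \<alpha>2 w + \<Gamma> y2 a2 a2 w = 0"
        and m: "norm a1 \<le> m" "norm a2 \<le> m" "m \<le> 1" for y1 y2 a1 a2 \<alpha>1 \<alpha>2 m
    proof -
      define \<beta> where "\<beta> = \<alpha>1 - \<alpha>2"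
      have \<beta>: "\<beta> \<in> W" using \<alpha> Wc by (simp add: \<beta>_def)
      have m0: "0 \<le> m" using m(1) norm_ge_zero order_trans by blast
      have m2: "m\<^sup>2 \<le> m" using m m0 by (simp add: power2_eq_square mult_left_le)
      note yK = RK[OF y(1)] RK[OF y(2)]
      have aW: "a1 - a2 \<in> W" using a Wc by simp
      have a2m: "norm \<alpha>2 \<le> k * m"
      proof -
        have "norm \<alpha>2 \<le> k * (norm a2)\<^sup>2" using acc1[OF y(2) a(2) \<alpha>(2) eq(2)] .
        also have "\<dots> \<le> k * m" using k m power_mono[OF m(2), of 2] m2 by (intro mult_left_mono) auto
        finally show ?thesis .
      qed
      have "g y1 \<beta> \<beta> = g y1 \<alpha>1 \<beta> - g y1 \<alpha>2 \<beta>"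
        unfolding \<beta>_def using glin[OF inS[OF yK(1)] \<alpha> \<beta>[unfolded \<beta>_def]] .
      \<comment> \<open>The two geodesic equations are subtracted with one argument changed at a
        time: the quadratic term at y1 splits by polarisation, using the symmetry of \<Gamma>, and
        the last two brackets change only the base point. In their estimates m \<le> 1 reduces
        squares of m to m.\<close>
      also have "\<dots> = - \<Gamma> y1 a1 (a1 - a2) \<beta> - \<Gamma> y1 a2 (a1 - a2) \<beta>
          - (\<Gamma> y1 a2 a2 \<beta> - \<Gamma> y2 a2 a2 \<beta>) - (g y1 \<alpha>2 \<beta> - g y2 \<alpha>2 \<beta>)"
        using eq(1)[OF \<beta>] eq(2)[OF \<beta>] Glin[OF inS[OF yK(1)] _ a \<beta>] a \<Gamma>(3)[OF inS[OF yK(1)] a \<beta>] by simp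
      also have "\<dots> \<le> L * (norm \<beta> * norm (a1 - a2) * m) + L * (norm \<beta> * norm (a1 - a2) * m)
          + L * (norm \<beta> * m) * norm (y1 - y2) + L * ((k * m) * norm \<beta>) * norm (y1 - y2)"
      proof -
        have "\<bar>\<Gamma> y1 a1 (a1 - a2) \<beta>\<bar> \<le> L * (norm \<beta> * norm (a1 - a2) * norm a1)"
          using Gb[OF yK(1) pK a(1) aW \<beta>] .
        also have "\<dots> \<le> L * (norm \<beta> * norm (a1 - a2) * m)" using L m by (intro mult_left_mono) auto
        finally have 1: "\<bar>\<Gamma> y1 a1 (a1 - a2) \<beta>\<bar> \<le> L * (norm \<beta> * norm (a1 - a2) * m)" .
        have "\<bar>\<Gamma> y1 a2 (a1 - a2) \<beta>\<bar> \<le> L * (norm \<beta> * norm (a1 - a2) * norm a2)"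
          using Gb[OF yK(1) pK a(2) aW \<beta>] .
        also have "\<dots> \<le> L * (norm \<beta> * norm (a1 - a2) * m)" using L m by (intro mult_left_mono) auto
        finally have 2: "\<bar>\<Gamma> y1 a2 (a1 - a2) \<beta>\<bar> \<le> L * (norm \<beta> * norm (a1 - a2) * m)" .
        have "\<bar>\<Gamma> y1 a2 a2 \<beta> - \<Gamma> y2 a2 a2 \<beta>\<bar> \<le> L * (norm \<beta> * norm a2 * norm a2) * norm (y1 - y2)"
          using Gl[OF yK a(2,2) \<beta>] .
        also have "norm \<beta> * norm a2 * norm a2 \<le> norm \<beta> * m"
          using power_mono[OF m(2), of 2] m2 by (simp add: power2_eq_square mult.assoc mult_left_mono)
        then have "L * (norm \<beta> * norm a2 * norm a2) * norm (y1 - y2) \<le> L * (norm \<beta> * m) * norm (y1 - y2)"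
          using L by (intro mult_right_mono mult_left_mono) auto
        finally have 3: "\<bar>\<Gamma> y1 a2 a2 \<beta> - \<Gamma> y2 a2 a2 \<beta>\<bar> \<le> L * (norm \<beta> * m) * norm (y1 - y2)" .
        have "\<bar>g y1 \<alpha>2 \<beta> - g y2 \<alpha>2 \<beta>\<bar> \<le> L * (norm \<alpha>2 * norm \<beta>) * norm (y1 - y2)"
          using gl[OF yK \<alpha>(2) \<beta>] .
        also have "\<dots> \<le> L * ((k * m) * norm \<beta>) * norm (y1 - y2)"
          using L a2m by (intro mult_right_mono mult_left_mono) auto
        finally have 4: "\<bar>g y1 \<alpha>2 \<beta> - g y2 \<alpha>2 \<beta>\<bar> \<le> L * ((k * m) * norm \<beta>) * norm (y1 - y2)" .
        show ?thesis using 1 2 3 4 by linarith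
      qed
      also have "\<dots> = (L * m * (2 * norm (a1 - a2) + (1 + k) * norm (y1 - y2))) * norm \<beta>"
        by (simp add: algebra_simps)
      finally have "l * (norm \<beta>)\<^sup>2 \<le> (L * m * (2 * norm (a1 - a2) + (1 + k) * norm (y1 - y2))) * norm \<beta>"
        using gp[OF y(1) \<beta>] by linarith
      then have "norm \<beta> \<le> (L * m * (2 * norm (a1 - a2) + (1 + k) * norm (y1 - y2))) / l"
        by (rule cancel) (use L m0 k in auto)
      also have "\<dots> = k * m * (2 * norm (a1 - a2) + (1 + k) * norm (y1 - y2))" by (simp add: k_def)
      also have "\<dots> \<le> k * m * ((2 + k) * norm (a1 - a2) + (2 + k) * norm (y1 - y2))"
        using k m0 by (intro mult_left_mono add_mono mult_right_mono) auto
      also have "\<dots> = C * m * (norm (y1 - y2) + norm (a1 - a2))" by (simp add: C_def algebra_simps)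
      finally show ?thesis by (simp add: \<beta>_def)
    qed
  qed
qed

section \<open>The metric and its Christoffel symbols in a chart\<close>

lemma lin_on_christoffel:
  assumes "lin_on W f" "lin_on W h" "lin_on W k"
  shows "lin_on W (\<lambda>x. (f x + h x - k x) / 2)"
  using assms unfolding lin_on_def by (simp add: algebra_simps add_divide_distrib diff_divide_distrib)

lemma openin_at_within:
  assumes "openin (top_of_set S) S'" "y \<in> S'"
  shows "at y within S' = at y within S"
proof -
  obtain O' where "open O'" "S' = S \<inter> O'" using assms(1) by (auto simp: openin_open)
  then show ?thesis using assms(2) by (intro at_within_nhd[of y O']) auto
qed

text \<open>Velocities at p are coordinates in the chart indexed by p, so the local analysis at p
  takes place in this one chart; other charts enter through transitions only.\<close>

locale chart_at =
  fixes M :: "('a, 'e::euclidean_space) rman" and d :: nat and p :: 'a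
  assumes M: "riemannian_manifold d M" and p: "p \<in> pts M"
begin

abbreviation "W \<equiv> tspace M p"
abbreviation "S \<equiv> cimg M p"

lemma
  shows W: "subspace W" and dim_W: "dim W = d"
    and cdom_open: "openin (rtop M) (cdom M p)" and p_cdom: "p \<in> cdom M p"
    and S: "openin (top_of_set W) S"
    and chart_homeo: "homeomorphic_map (subtopology (rtop M) (cdom M p)) (top_of_set S) (chart M p)"
    and metric: "inner_product_on W (rmetric M p)"
  using M p by (auto simp: riemannian_manifold_def)

lemma S_W: "S \<subseteq> W"
  using S openin_imp_subset by blast

lemma cdom_pts: "cdom M p \<subseteq> pts M"
  using cdom_open openin_subset by blast

lemma chart_inj: "inj_on (chart M p) (cdom M p)"
  using homeomorphic_imp_injective_map[OF chart_homeo] cdom_pts by (simp add: Int_absorb1)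

lemma chart_S: "q \<in> cdom M p \<Longrightarrow> chart M p q \<in> S"
  by (simp add: cimg_def)

lemma cinv_chart: "q \<in> cdom M p \<Longrightarrow> cinv M p (chart M p q) = q"
  unfolding cinv_def using chart_inj by simp

lemma
  assumes "y \<in> S"
  shows cinv_cdom: "cinv M p y \<in> cdom M p" and chart_cinv: "chart M p (cinv M p y) = y"
  using assms unfolding cimg_def cinv_def by (auto intro: inv_into_into f_inv_into_f)

lemma chart_continuous: "continuous_map (subtopology (rtop M) (cdom M p)) (top_of_set S) (chart M p)"
  using chart_homeo homeomorphic_imp_continuous_map by blast

lemma chart_open:
  assumes "openin (rtop M) A"
  shows "openin (top_of_set W) (chart M p ` (cdom M p \<inter> A))"
proof -
  have "openin (top_of_set S) (chart M p ` (cdom M p \<inter> A))"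
    using homeomorphic_imp_open_map[OF chart_homeo] assms
    by (auto simp: open_map_def intro: openin_subtopology_Int2)
  then show ?thesis using S openin_trans by blast
qed

lemma cinv_continuous: "continuous_map (top_of_set S) (rtop M) (cinv M p)"
proof -
  obtain h where "homeomorphic_maps (subtopology (rtop M) (cdom M p)) (top_of_set S) (chart M p) h"
    using chart_homeo homeomorphic_map_maps by blast
  then have h: "continuous_map (top_of_set S) (subtopology (rtop M) (cdom M p)) h" "\<And>y. y \<in> S \<Longrightarrow> chart M p (h y) = y"
    by (auto simp: homeomorphic_maps_def)
  have "h y = cinv M p y" if "y \<in> S" for y
  proof -
    have "h y \<in> cdom M p" using h(1) that by (auto simp: continuous_map_def)
    then show ?thesis using cinv_chart[of "h y"] h(2)[OF that] by simp
  qed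
  then have "continuous_map (top_of_set S) (subtopology (rtop M) (cdom M p)) (cinv M p)"
    using h(1) by (auto intro: continuous_map_eq)
  then show ?thesis using continuous_map_in_subtopology by blast
qed

section \<open>Changes of coordinates and the coefficients of the metric\<close>

lemma transition_smooth:
  assumes "q \<in> pts M"
  shows "Ck_on k W (chart M p ` (cdom M p \<inter> cdom M q)) (transition M p q)"
  using M p assms by (auto simp: riemannian_manifold_def smooth_on_def)

text \<open>\<open>gcoord\<close> differentiates the transition within the whole chart image,
  although it is smooth only on the image of the overlap. The latter is relatively open and contains
  y, so both filters at y agree. That D maps W into \<open>tspace M q\<close> is essential, since
  \<open>rmetric M q\<close> is an inner product only there.\<close>

lemma transition_derivative:
  assumes y: "y \<in> S"
  defines "q \<equiv> cinv M p y"
  defines "D \<equiv> frechet_derivative (transition M p q) (at y within S)"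
  shows "(transition M p q has_derivative D) (at y within S)"
    and "a \<in> W \<Longrightarrow> D a \<in> tspace M q"
proof -
  have q: "q \<in> cdom M p" "q \<in> pts M" using cinv_cdom[OF y] cdom_pts by (auto simp: q_def)
  interpret Q: chart_at M d q using M q(2) by unfold_locales
  define S' where "S' = chart M p ` (cdom M p \<inter> cdom M q)"
  have S': "openin (top_of_set W) S'" unfolding S'_def using chart_open[OF Q.cdom_open] .
  have yS': "y \<in> S'" using q Q.p_cdom chart_cinv[OF y] by (auto simp: S'_def q_def intro!: image_eqI)
  have S'S: "S' \<subseteq> S" by (auto simp: S'_def cimg_def)
  have "openin (top_of_set S) S'" using S' S'S S_W by (meson openin_subset_trans)
  note at = openin_at_within[OF this yS']
  obtain D' where "(transition M p q has_derivative D') (at y within S')"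
    using transition_smooth[OF q(2), of "Suc 0"] yS' by (auto simp: S'_def[symmetric])
  then show D: "(transition M p q has_derivative D) (at y within S)"
    unfolding D_def at by (metis differentiableI frechet_derivative_works)
  have img: "transition M p q ` S' \<subseteq> tspace M q"
    using Q.chart_S Q.S_W cinv_chart by (auto simp: S'_def transition_def)
  show "D a \<in> tspace M q" if "a \<in> W"
    by (rule derivative_in_subspace[OF D[folded at] S' W yS' that Q.W img])
qed

lemma
  assumes y: "y \<in> S" and a: "a \<in> W"
  shows gcoord_sym: "b \<in> W \<Longrightarrow> gcoord M p y a b = gcoord M p y b a"
    and gcoord_lin: "lin_on W (gcoord M p y a)"
proof -
  define q where "q = cinv M p y"
  define D where "D = frechet_derivative (transition M p q) (at y within S)"
  have q: "q \<in> pts M" using cinv_cdom[OF y] cdom_pts by (auto simp: q_def)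
  have ip: "inner_product_on (tspace M q) (rmetric M q)"
    using M q by (auto simp: riemannian_manifold_def)
  have sub: "subspace (tspace M q)" using M q by (auto simp: riemannian_manifold_def)
  note * = transition_derivative[OF y, folded q_def, folded D_def]
  have g: "gcoord M p y u v = rmetric M q (D u) (D v)" for u v
    by (simp add: gcoord_def Let_def q_def D_def)
  have lin: "linear D" using has_derivative_linear[OF *(1)] .
  have sym: "u \<in> tspace M q \<Longrightarrow> v \<in> tspace M q \<Longrightarrow> rmetric M q u v = rmetric M q v u" for u v
    using ip by (auto simp: inner_product_on_def)
  then show "b \<in> W \<Longrightarrow> gcoord M p y a b = gcoord M p y b a"
    unfolding g using *(2) a by blast
  have add: "u \<in> tspace M q \<Longrightarrow> v \<in> tspace M q \<Longrightarrow> w \<in> tspace M q \<Longrightarrow>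
      rmetric M q (u + v) w = rmetric M q u w + rmetric M q v w"
    and scale: "u \<in> tspace M q \<Longrightarrow> v \<in> tspace M q \<Longrightarrow> rmetric M q (c *\<^sub>R u) v = c * rmetric M q u v"
    for u v w c using ip unfolding inner_product_on_def by blast+
  show "lin_on W (gcoord M p y a)"
    unfolding lin_on_def
  proof (intro conjI ballI allI)
    fix u v c assume u: "u \<in> W"
    note m = *(2)[OF a] *(2)[OF u]
    show "gcoord M p y a (c *\<^sub>R u) = c * gcoord M p y a u"
      unfolding g linear_scale[OF lin]
      using sym[OF m(1) subspace_scale[OF sub m(2)]] sym[OF m] scale[OF m(2,1)] by simp
    assume "v \<in> W"
    note m = m *(2)[OF this]
    show "gcoord M p y a (u + v) = gcoord M p y a u + gcoord M p y a v"
      unfolding g linear_add[OF lin]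
      using sym[OF m(1) subspace_add[OF sub m(2,3)]] sym[OF m(1,2)] sym[OF m(1,3)] add[OF m(2,3,1)] by simp
  qed
qed

lemma gcoord_centre:
  assumes "a \<in> W" "b \<in> W"
  shows "gcoord M p (chart M p p) a b = rmetric M p a b"
proof -
  define y where "y = chart M p p"
  have y: "y \<in> S" using chart_S p_cdom by (simp add: y_def)
  have q: "cinv M p y = p" using cinv_chart p_cdom by (simp add: y_def)
  define D where "D = frechet_derivative (transition M p p) (at y within S)"
  have D: "(transition M p p has_derivative D) (at y within S)"
    using transition_derivative(1)[OF y] by (simp add: q D_def)
  have "(transition M p p has_derivative (\<lambda>x. x)) (at y within S)"
    by (rule has_derivative_transform[OF y _ has_derivative_ident])
       (auto simp: transition_def chart_cinv)
  from derivative_unique_along[OF D this S W y]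
  have "D c = c" if "c \<in> W" for c using that by blast
  then show ?thesis using assms by (simp add: gcoord_def Let_def q D_def flip: y_def)
qed

lemma gcoord_smooth: "a \<in> W \<Longrightarrow> b \<in> W \<Longrightarrow> Ck_on k W S (\<lambda>y. gcoord M p y a b)"
  using M p by (auto simp: riemannian_manifold_def smooth_on_def)

lemma dgcoord_derivative:
  assumes "y \<in> S" "a \<in> W" "b \<in> W"
  shows "((\<lambda>z. gcoord M p z a b) has_derivative (\<lambda>w. dgcoord M p y w a b)) (at y within S)"
proof -
  obtain D where "((\<lambda>z. gcoord M p z a b) has_derivative D) (at y within S)"
    using gcoord_smooth[OF assms(2,3), of "Suc 0"] assms(1) by auto
  then show ?thesis unfolding dgcoord_def by (metis differentiableI frechet_derivative_works)
qed

text \<open>A derivative within a relatively open subset of W is determined on W only. Identities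
  for \<open>dgcoord\<close> on W are therefore obtained by exhibiting some derivative of the right
  form.\<close>

lemma dgcoord_unique:
  assumes "y \<in> S" "a \<in> W" "b \<in> W" "w \<in> W" "((\<lambda>z. gcoord M p z a b) has_derivative D) (at y within S)"
  shows "dgcoord M p y w a b = D w"
  using derivative_unique_along[OF dgcoord_derivative[OF assms(1-3)] assms(5) S W assms(1,4)] .

lemma dgcoord_smooth:
  assumes "a \<in> W" "b \<in> W" "w \<in> W"
  shows "Ck_on k W S (\<lambda>y. dgcoord M p y w a b)"
proof -
  obtain f' where f': "\<And>x. x \<in> S \<Longrightarrow> ((\<lambda>z. gcoord M p z a b) has_derivative f' x) (at x within S)"
    "\<And>w. w \<in> W \<Longrightarrow> Ck_on k W S (\<lambda>x. f' x w)"
    using gcoord_smooth[OF assms(1,2), of "Suc k"] by auto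
  show ?thesis
    by (rule Ck_on_cong[OF _ f'(2)[OF assms(3)]]) (simp add: dgcoord_unique[OF _ assms f'(1)])
qed

lemma dgcoord_sym:
  assumes "y \<in> S" "a \<in> W" "b \<in> W" "w \<in> W"
  shows "dgcoord M p y w a b = dgcoord M p y w b a"
  by (rule dgcoord_unique[OF assms])
     (rule has_derivative_transform[OF assms(1) _ dgcoord_derivative[OF assms(1,3,2)]],
      simp add: gcoord_sym assms)

lemma dgcoord_lin:
  assumes y: "y \<in> S" and a: "a \<in> W"
  shows "b \<in> W \<Longrightarrow> lin_on W (\<lambda>w. dgcoord M p y w a b)"
    and "w \<in> W \<Longrightarrow> lin_on W (\<lambda>b. dgcoord M p y w a b)"
    and "w \<in> W \<Longrightarrow> lin_on W (\<lambda>b. dgcoord M p y w b a)"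
proof -
  show "lin_on W (\<lambda>w. dgcoord M p y w a b)" if b: "b \<in> W"
    using has_derivative_linear[OF dgcoord_derivative[OF y a b]]
    unfolding lin_on_def by (simp add: linear_add[of "\<lambda>w. dgcoord M p y w a b"]
        linear_scale[of "\<lambda>w. dgcoord M p y w a b"])
  show *: "lin_on W (\<lambda>b. dgcoord M p y w a b)" if w: "w \<in> W"
    unfolding lin_on_def
  proof (intro conjI ballI allI)
    fix u v c assume u: "u \<in> W"
    show "dgcoord M p y w a (c *\<^sub>R u) = c * dgcoord M p y w a u"
    proof (rule dgcoord_unique[OF y a _ w])
      show "((\<lambda>z. gcoord M p z a (c *\<^sub>R u)) has_derivative (\<lambda>w. c * dgcoord M p y w a u)) (at y within S)"
        by (rule has_derivative_transform[OF y _ has_derivative_mult_right[OF dgcoord_derivative[OF y a u]]])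
           (use gcoord_lin a u in \<open>auto simp: lin_on_def\<close>)
    qed (use u W in \<open>simp add: subspace_scale\<close>)
    assume v: "v \<in> W"
    show "dgcoord M p y w a (u + v) = dgcoord M p y w a u + dgcoord M p y w a v"
    proof (rule dgcoord_unique[OF y a _ w])
      show "((\<lambda>z. gcoord M p z a (u + v)) has_derivative (\<lambda>w. dgcoord M p y w a u + dgcoord M p y w a v)) (at y within S)"
        by (rule has_derivative_transform[OF y _ has_derivative_add[OF dgcoord_derivative[OF y a u] dgcoord_derivative[OF y a v]]])
           (use gcoord_lin a u v in \<open>auto simp: lin_on_def\<close>)
    qed (use u v W in \<open>simp add: subspace_add\<close>)
  qed
  then show "lin_on W (\<lambda>b. dgcoord M p y w b a)" if w: "w \<in> W"
    using *[OF w] W unfolding lin_on_def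
    by (simp add: dgcoord_sym[OF y _ a w] subspace_add subspace_scale)
qed

lemma christoffel_facts:
  assumes y: "y \<in> S" and a: "a \<in> W"
  shows "b \<in> W \<Longrightarrow> lin_on W (christoffel M p y a b)"
    and "w \<in> W \<Longrightarrow> lin_on W (\<lambda>b. christoffel M p y a b w)"
    and "b \<in> W \<Longrightarrow> w \<in> W \<Longrightarrow> christoffel M p y a b w = christoffel M p y b a w"
  unfolding christoffel_def[abs_def]
  using dgcoord_lin[OF y] a
  by (auto intro!: lin_on_christoffel simp: dgcoord_sym[OF y])

lemma christoffel_smooth:
  assumes "a \<in> W" "b \<in> W" "w \<in> W"
  shows "Ck_on k W S (\<lambda>y. christoffel M p y a b w)"
proof -
  have "Ck_on k W S (\<lambda>y. (1/2) * ((dgcoord M p y a b w + dgcoord M p y b a w) + (-1) * dgcoord M p y w a b))"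
    by (intro Ck_on_mult Ck_on_add Ck_on_const dgcoord_smooth assms)
  then show ?thesis by (rule Ck_on_cong[rotated]) (simp add: christoffel_def)
qed

definition geodesic_acc :: "'e \<Rightarrow> 'e \<Rightarrow> 'e \<Rightarrow> bool" where
  "geodesic_acc y a \<alpha> \<longleftrightarrow> a \<in> W \<and> \<alpha> \<in> W \<and> (\<forall>w\<in>W. gcoord M p y \<alpha> w + christoffel M p y a a w = 0)"

text \<open>The conclusion of \<open>acceleration_bounds\<close> as one predicate, so that a pair of
  constants can be passed through the estimates on geodesics.\<close>

definition acc_bound :: "real \<Rightarrow> real \<Rightarrow> bool" where
  "acc_bound R C \<longleftrightarrow> R > 0 \<and> C > 0 \<and> cball (chart M p p) R \<inter> W \<subseteq> S \<and>
     (\<forall>y\<in>cball (chart M p p) R \<inter> W. \<forall>a \<alpha>. geodesic_acc y a \<alpha> \<longrightarrow> norm \<alpha> \<le> C * (norm a)\<^sup>2) \<and>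
     (\<forall>y1\<in>cball (chart M p p) R \<inter> W. \<forall>y2\<in>cball (chart M p p) R \<inter> W. \<forall>a1 a2 \<alpha>1 \<alpha>2 m.
        geodesic_acc y1 a1 \<alpha>1 \<longrightarrow> geodesic_acc y2 a2 \<alpha>2 \<longrightarrow> norm a1 \<le> m \<longrightarrow> norm a2 \<le> m \<longrightarrow> m \<le> 1 \<longrightarrow>
        norm (\<alpha>1 - \<alpha>2) \<le> C * m * (norm (y1 - y2) + norm (a1 - a2)))"

lemma acceleration: "\<exists>R C. acc_bound R C"
proof -
  have "inner_product_on W (gcoord M p (chart M p p)) = inner_product_on W (rmetric M p)"
    unfolding inner_product_on_def
    by (simp add: gcoord_centre subspace_add[OF W] subspace_scale[OF W] cong: ball_cong)
  then have ip: "inner_product_on W (gcoord M p (chart M p p))" using metric by simp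
  show ?thesis
  proof (rule acceleration_bounds[of W S "chart M p p" "gcoord M p" "christoffel M p"], goal_cases)
    case (12 R C)
    show ?case unfolding acc_bound_def geodesic_acc_def
      by (intro exI[of _ R] exI[of _ C] conjI 12(1-3) ballI allI impI; elim conjE)
        (rule 12(4,5); blast)+
  qed (fact W S chart_S[OF p_cdom] ip gcoord_lin gcoord_sym gcoord_smooth christoffel_facts christoffel_smooth)+
qed

end

section \<open>Geodesics with small initial velocity\<close>

text \<open>Continuity method: otherwise the compact complement of A has a least element m > 0, and
  the step applied at m contradicts its choice.\<close>

lemma interval_induction:
  fixes A :: "real set"
  assumes A: "openin (top_of_set {0..1}) A" "0 \<in> A"
    and step: "\<And>t. 0 < t \<Longrightarrow> t \<le> 1 \<Longrightarrow> {0..<t} \<subseteq> A \<Longrightarrow> t \<in> A"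
  shows "A = {0..1}"
proof (rule ccontr)
  assume "A \<noteq> {0..1}"
  moreover have sub: "A \<subseteq> {0..1}" using A(1) openin_imp_subset by blast
  ultimately have ne: "{0..1} - A \<noteq> {}" by blast
  have "closedin (top_of_set {0..1}) ({0..1} - A)" using A(1) by (simp add: closedin_diff)
  then have "compact ({0..1} - A)" using closedin_compact compact_Icc by blast
  then obtain m where m: "m \<in> {0..1} - A" "\<And>t. t \<in> {0..1} - A \<Longrightarrow> m \<le> t"
    using compact_attains_inf[OF _ ne] by metis
  have "m \<noteq> 0" using m(1) A(2) by auto
  moreover have "{0..<m} \<subseteq> A" using m by force
  ultimately show False using step[of m] m(1) by auto
qed

lemma vector_mvt:
  fixes f :: "real \<Rightarrow> 'e::real_normed_vector"
  assumes "\<And>s. s \<in> {0..t} \<Longrightarrow> (f has_vector_derivative f' s) (at s within {0..t})"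
    and "\<And>s. s \<in> {0..t} \<Longrightarrow> norm (f' s) \<le> B" and "0 \<le> t"
  shows "norm (f t - f 0) \<le> B * t"
proof -
  have "norm (f t - f 0) \<le> B * norm (t - 0)"
  proof (rule differentiable_bound[of "{0..t}" f "\<lambda>s h. h *\<^sub>R f' s"])
    fix s assume s: "s \<in> {0..t}"
    show "(f has_derivative (\<lambda>h. h *\<^sub>R f' s)) (at s within {0..t})"
      using assms(1)[OF s] by (simp add: has_vector_derivative_def)
    show "onorm (\<lambda>h. h *\<^sub>R f' s) \<le> B"
      using assms(2)[OF s] order_trans[OF norm_ge_zero assms(2)[OF s]]
      by (intro onorm_bound) (auto simp: mult.commute[of B] intro!: mult_left_mono)
  qed (use assms in auto)
  then show ?thesis using assms(3) by simp
qed

context chart_at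
begin

abbreviation "centre \<equiv> chart M p p"

lemma acc_boundD:
  assumes "acc_bound R C"
  shows "y \<in> cball centre R \<inter> W \<Longrightarrow> geodesic_acc y a \<alpha> \<Longrightarrow> norm \<alpha> \<le> C * (norm a)\<^sup>2"
    and "y1 \<in> cball centre R \<inter> W \<Longrightarrow> y2 \<in> cball centre R \<inter> W \<Longrightarrow> geodesic_acc y1 a1 \<alpha>1 \<Longrightarrow>
      geodesic_acc y2 a2 \<alpha>2 \<Longrightarrow> norm a1 \<le> m \<Longrightarrow> norm a2 \<le> m \<Longrightarrow> m \<le> 1 \<Longrightarrow>
      norm (\<alpha>1 - \<alpha>2) \<le> C * m * (norm (y1 - y2) + norm (a1 - a2))"
  using assms unfolding acc_bound_def by blast+

text \<open>The ball is compact and M is Hausdorff, so its image is closed in all of M and not just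
  in the chart domain. This prevents a curve from escaping from the chart while its coordinates stay
  in the ball.\<close>

lemma closedin_chart_ball:
  assumes "cball centre R \<inter> W \<subseteq> S"
  shows "closedin (rtop M) (cinv M p ` (cball centre R \<inter> W))"
proof -
  have "compactin (top_of_set S) (cball centre R \<inter> W)"
    using assms W by (simp add: compactin_subtopology compact_Int_closed closed_subspace)
  then have "compactin (rtop M) (cinv M p ` (cball centre R \<inter> W))"
    using image_compactin[OF _ cinv_continuous] by blast
  then show ?thesis using M compactin_imp_closedin by (auto simp: riemannian_manifold_def)
qed

text \<open>A bootstrap argument. As long as the speed is at most 2 * \<rho>, the acceleration is at
  most 4 * C * \<rho>^2 < \<rho>, so within unit time the velocity changes by less than \<rho> and
  the position by at most 2 * \<rho> < R. Thus the assumed bounds hold again in strict form.\<close>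

lemma geodesic_stays:
  assumes bd: "acc_bound R C" and geo: "geodesic M {0..1} \<gamma>" "\<gamma> 0 = p" "velocity M {0..1} \<gamma> 0 u"
    and \<rho>: "0 < \<rho>" "norm u \<le> \<rho>" "2 * \<rho> < R" "4 * C * \<rho> < 1"
  defines "c \<equiv> chart M p \<circ> \<gamma>"
  obtains c' c'' where "c 0 = centre" "c' 0 = u"
    "\<And>t. t \<in> {0..1} \<Longrightarrow> \<gamma> t \<in> cdom M p \<and> c t \<in> cball centre R \<inter> W \<and> norm (c' t) \<le> 2 * \<rho> \<and>
       (c has_vector_derivative c' t) (at t within {0..1}) \<and>
       (c' has_vector_derivative c'' t) (at t within {0..1}) \<and> geodesic_acc (c t) (c' t) (c'' t)"
proof -
  have R: "R > 0" "C > 0" "cball centre R \<inter> W \<subseteq> S" using bd by (auto simp: acc_bound_def)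
  define J where "J = {t\<in>{0..1}. \<gamma> t \<in> cdom M p}"
  have \<gamma>: "continuous_map (top_of_set {0..1}) (rtop M) \<gamma>"
    using geo(1) by (simp add: geodesic_def smooth_curve_def)
  have J: "openin (top_of_set {0..1}) J"
    using openin_continuous_map_preimage[OF \<gamma> cdom_open] by (simp add: J_def)
  obtain c' c'' where c': "\<And>t. t \<in> J \<Longrightarrow> (c has_vector_derivative c' t) (at t within J)"
    "\<And>t. t \<in> J \<Longrightarrow> (c' has_vector_derivative c'' t) (at t within J)"
    "\<And>t w. t \<in> J \<Longrightarrow> w \<in> W \<Longrightarrow> gcoord M p (c t) (c'' t) w + christoffel M p (c t) (c' t) (c' t) w = 0"
  proof -
    obtain c' c'' where *: "\<forall>t\<in>J. (c has_vector_derivative c' t) (at t within J) \<and>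
      (c' has_vector_derivative c'' t) (at t within J) \<and>
      (\<forall>w\<in>W. gcoord M p (c t) (c'' t) w + christoffel M p (c t) (c' t) (c' t) w = 0)"
      using geo(1)[unfolded geodesic_def Let_def, THEN conjunct2, THEN bspec, OF p] unfolding c_def J_def by blast
    show thesis by (rule that) (use * in blast)+
  qed
  have at: "at t within J = at t within {0..1}" if "t \<in> J" for t
    using openin_at_within[OF J that] .
  have nb: "at t within {0..1} \<noteq> bot" if "t \<in> {0..1}" for t :: real
    using that by (simp add: trivial_limit_within)
  have J0: "0 \<in> J" using geo(2) p_cdom by (simp add: J_def)
  have J01: "J \<subseteq> {0..1}" by (auto simp: J_def)
  have c0: "c 0 = centre" by (simp add: c_def geo(2))
  have "(c has_vector_derivative u) (at 0 within {0..1})"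
    using geo(2,3) by (simp add: velocity_def c_def)
  \<comment> \<open>The geodesic equation only supplies some derivative c' along the curve;
    uniqueness of one-sided derivatives ties its value at 0 to u.\<close>
  then have c'0: "c' 0 = u"
    using vector_derivative_unique_within[OF nb c'(1)[OF J0, unfolded at[OF J0]]] by simp
  have cW: "c ` J \<subseteq> W" using chart_S S_W by (auto simp: J_def c_def)
  have c'W: "c' t \<in> W" if "t \<in> J" for t
    using vector_derivative_in_subspace[OF c'(1)[OF that] _ that W cW] nb at[OF that] J01 that by auto
  have c''W: "c'' t \<in> W" if "t \<in> J" for t
  proof (rule vector_derivative_in_subspace[OF c'(2)[OF that] _ that W])
    show "at t within J \<noteq> bot" using nb[of t] J01 that unfolding at[OF that] by blast
  qed (use c'W in blast)
  have acc: "geodesic_acc (c t) (c' t) (c'' t)" if "t \<in> J" for t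
    using c'W c''W c'(3) that by (simp add: geodesic_acc_def)
  have cont: "continuous_on J c" "continuous_on J c'"
    unfolding continuous_on_eq_continuous_within
    using c'(1,2) has_vector_derivative_continuous by blast+
  define A where "A = {t\<in>J. norm (c t - centre) < R \<and> norm (c' t) < 2 * \<rho>}"
  have "A = {0..1}"
  proof (rule interval_induction)
    have "openin (top_of_set J) (J \<inter> (\<lambda>t. norm (c t - centre)) -` {..<R})"
      "openin (top_of_set J) (J \<inter> (\<lambda>t. norm (c' t)) -` {..<2 * \<rho>})"
      by (intro continuous_openin_preimage_gen continuous_intros cont; simp)+
    then have "openin (top_of_set J) (J \<inter> (\<lambda>t. norm (c t - centre)) -` {..<R} \<inter> (J \<inter> (\<lambda>t. norm (c' t)) -` {..<2 * \<rho>}))"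
      by blast
    also have "J \<inter> (\<lambda>t. norm (c t - centre)) -` {..<R} \<inter> (J \<inter> (\<lambda>t. norm (c' t)) -` {..<2 * \<rho>}) = A"
      by (auto simp: A_def)
    finally show "openin (top_of_set {0..1}) A" using J openin_trans by blast
    show "0 \<in> A" using J0 c0 c'0 R \<rho> by (simp add: A_def)
    fix t :: real assume t: "0 < t" "t \<le> 1" "{0..<t} \<subseteq> A"
    have clo: "closure {0..<t} = {0..t}" using t by simp
    \<comment> \<open>At the limit time t, membership of the curve in the chart domain comes first:
      the curve lies in the closed set Q before t, hence also at t.\<close>
    define Q where "Q = cinv M p ` (cball centre R \<inter> W)"
    have Qc: "Q \<subseteq> cdom M p" using R cinv_cdom by (auto simp: Q_def)
    have "closedin (top_of_set {0..1}) {s\<in>{0..1}. \<gamma> s \<in> Q}"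
      using closedin_continuous_map_preimage[OF \<gamma> closedin_chart_ball[OF R(3)]] by (simp add: Q_def)
    then have "closed {s\<in>{0..1}. \<gamma> s \<in> Q}" using closedin_closed_eq closed_atLeastAtMost by blast
    moreover have "{0..<t} \<subseteq> {s\<in>{0..1}. \<gamma> s \<in> Q}"
    proof
      fix s assume "s \<in> {0..<t}"
      then have s: "s \<in> A" using t by auto
      then have "\<gamma> s \<in> cdom M p" "c s \<in> cball centre R \<inter> W"
        using cW by (auto simp: A_def J_def dist_norm norm_minus_commute)
      then have "\<gamma> s \<in> Q" unfolding Q_def by (intro image_eqI[of _ _ "c s"]) (auto simp: c_def cinv_chart)
      then show "s \<in> {s\<in>{0..1}. \<gamma> s \<in> Q}" using s J01 by (auto simp: A_def)
    qed
    ultimately have "closure {0..<t} \<subseteq> {s\<in>{0..1}. \<gamma> s \<in> Q}" by (rule closure_minimal[rotated])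
    then have tJ: "{0..t} \<subseteq> J" using Qc t unfolding clo by (auto simp: J_def)
    \<comment> \<open>In the limit the strict bounds of A survive only as weak ones; the integration
      below makes them strict again.\<close>
    have le: "f s \<le> b" if "continuous_on {0..t} f" "\<And>s. s \<in> {0..<t} \<Longrightarrow> f s \<le> b" "s \<in> {0..t}"
      for f :: "real \<Rightarrow> real" and b s
      using continuous_le_on_closure[of "{0..<t}" f s b] that unfolding clo by blast
    have cb: "norm (c s - centre) \<le> R" "norm (c' s) \<le> 2 * \<rho>" if s: "s \<in> {0..t}" for s
    proof -
      have c: "continuous_on {0..t} (\<lambda>s. norm (c s - centre))" "continuous_on {0..t} (\<lambda>s. norm (c' s))"
        by (intro continuous_intros continuous_on_subset[OF _ tJ] cont)+
      have *: "norm (c s - centre) \<le> R" "norm (c' s) \<le> 2 * \<rho>" if "s \<in> {0..<t}" for s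
        using subsetD[OF t(3) that] by (simp_all add: A_def)
      show "norm (c s - centre) \<le> R" "norm (c' s) \<le> 2 * \<rho>"
        using le[OF c(1) *(1) s] le[OF c(2) *(2) s] by blast+
    qed
    have c''b: "norm (c'' s) \<le> 4 * C * \<rho> * \<rho>" if s: "s \<in> {0..t}" for s
    proof -
      have "c s \<in> W" using cW tJ s by blast
      then have "c s \<in> cball centre R \<inter> W" using cb(1)[OF s] by (simp add: dist_norm norm_minus_commute)
      then have "norm (c'' s) \<le> C * (norm (c' s))\<^sup>2"
        using acc_boundD(1)[OF bd _ acc] s tJ by blast
      also have "\<dots> \<le> C * (2 * \<rho>)\<^sup>2" using cb[OF s] R by (intro mult_left_mono power_mono) auto
      finally show ?thesis by (simp add: power2_eq_square mult_ac)
    qed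
    have d: "(c has_vector_derivative c' s) (at s within {0..t})" "(c' has_vector_derivative c'' s) (at s within {0..t})"
      if "s \<in> {0..t}" for s
      using c'(1,2)[of s] tJ that has_vector_derivative_within_subset by blast+
    have "norm (c' t - c' 0) \<le> 4 * C * \<rho> * \<rho> * t" using vector_mvt[OF d(2) c''b] t by simp
    also have "\<dots> \<le> 4 * C * \<rho> * \<rho> * 1" using R t \<rho> by (intro mult_left_mono) auto
    also have "\<dots> < 1 * \<rho>" using mult_strict_right_mono[OF \<rho>(4,1)] by simp
    finally have 1: "norm (c' t) < 2 * \<rho>" using \<rho>(2) norm_triangle_sub[of "c' t" "c' 0"] by (simp add: c'0)
    have "norm (c t - c 0) \<le> 2 * \<rho> * t" using vector_mvt[OF d(1) cb(2)] t by simp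
    also have "\<dots> \<le> 2 * \<rho> * 1" using \<rho> t by (intro mult_left_mono) auto
    finally have 2: "norm (c t - centre) < R" using \<rho>(3) by (simp add: c0)
    show "t \<in> A" using 1 2 tJ t by (auto simp: A_def)
  qed
  then have J1: "J = {0..1}" and A: "\<And>t. t \<in> {0..1} \<Longrightarrow> t \<in> A" using J01 by (auto simp: A_def)
  show thesis
  proof (rule that[of c' c'', OF c0 c'0])
    fix t :: real assume t: "t \<in> {0..1}"
    show "\<gamma> t \<in> cdom M p \<and> c t \<in> cball centre R \<inter> W \<and> norm (c' t) \<le> 2 * \<rho> \<and>
       (c has_vector_derivative c' t) (at t within {0..1}) \<and>
       (c' has_vector_derivative c'' t) (at t within {0..1}) \<and> geodesic_acc (c t) (c' t) (c'' t)"
      using A[OF t] t c' acc cW unfolding J1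
      by (auto simp: A_def J_def dist_norm norm_minus_commute)
  qed
qed

text \<open>Second-order Taylor estimate: the bound 4 * C * \<rho>^2 on the acceleration is
  integrated twice over unit time.\<close>

lemma geodesic_endpoint:
  assumes bd: "acc_bound R C" and geo: "geodesic M {0..1} \<gamma>" "\<gamma> 0 = p" "velocity M {0..1} \<gamma> 0 u"
    and \<rho>: "0 < \<rho>" "norm u \<le> \<rho>" "2 * \<rho> < R" "4 * C * \<rho> < 1"
  shows "\<gamma> 1 \<in> cdom M p" "norm (chart M p (\<gamma> 1) - centre - u) \<le> 4 * C * \<rho>\<^sup>2"
proof -
  define c where "c = chart M p \<circ> \<gamma>"
  obtain c' c'' where c: "c 0 = centre" "c' 0 = u"
    "\<And>t. t \<in> {0..1} \<Longrightarrow> \<gamma> t \<in> cdom M p \<and> c t \<in> cball centre R \<inter> W \<and> norm (c' t) \<le> 2 * \<rho> \<and>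
       (c has_vector_derivative c' t) (at t within {0..1}) \<and>
       (c' has_vector_derivative c'' t) (at t within {0..1}) \<and> geodesic_acc (c t) (c' t) (c'' t)"
    using geodesic_stays[OF assms] unfolding c_def by blast
  show "\<gamma> 1 \<in> cdom M p" using c(3)[of 1] by simp
  have C: "C > 0" using bd by (auto simp: acc_bound_def)
  have c''b: "norm (c'' s) \<le> 4 * C * \<rho>\<^sup>2" if s: "s \<in> {0..1}" for s
  proof -
    have "norm (c'' s) \<le> C * (norm (c' s))\<^sup>2"
      using acc_boundD(1)[OF bd] c(3)[OF s] by blast
    also have "\<dots> \<le> C * (2 * \<rho>)\<^sup>2" using c(3)[OF s] C by (intro mult_left_mono power_mono) auto
    finally show ?thesis by (simp add: power_mult_distrib mult_ac)
  qed
  have c'b: "norm (c' s - u) \<le> 4 * C * \<rho>\<^sup>2" if s: "s \<in> {0..1}" for s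
  proof -
    have "norm (c' s - c' 0) \<le> 4 * C * \<rho>\<^sup>2 * s"
    proof (rule vector_mvt)
      fix r assume r: "r \<in> {0..s}"
      then have "r \<in> {0..1}" using s by simp
      from c''b[OF this] show "norm (c'' r) \<le> 4 * C * \<rho>\<^sup>2" .
      from c(3)[OF \<open>r \<in> {0..1}\<close>] s show "(c' has_vector_derivative c'' r) (at r within {0..s})"
        by (auto intro: has_vector_derivative_within_subset)
    qed (use s in simp)
    also have "\<dots> \<le> 4 * C * \<rho>\<^sup>2 * 1" using C s by (intro mult_left_mono) auto
    finally show ?thesis by (simp add: c(2))
  qed
  have "norm ((c 1 - 1 *\<^sub>R u) - (c 0 - 0 *\<^sub>R u)) \<le> 4 * C * \<rho>\<^sup>2 * 1"
    by (rule vector_mvt[of 1 "\<lambda>s. c s - s *\<^sub>R u" "\<lambda>s. c' s - u"])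
      (use c(3) c'b in \<open>auto intro!: derivative_eq_intros\<close>)
  then show "norm (chart M p (\<gamma> 1) - centre - u) \<le> 4 * C * \<rho>\<^sup>2"
    using c(1) by (simp add: c_def algebra_simps)
qed

text \<open>
  Speeds of order \<open>\<rho>\<close> make the geodesic equation contracting on the unit time interval, so that
  continuous dependence (and with it uniqueness) needs no Gronwall argument.
\<close>

lemma geodesic_dependence:
  assumes bd: "acc_bound R C"
    and geo1: "geodesic M {0..1} \<gamma>1" "\<gamma>1 0 = p" "velocity M {0..1} \<gamma>1 0 u1"
    and geo2: "geodesic M {0..1} \<gamma>2" "\<gamma>2 0 = p" "velocity M {0..1} \<gamma>2 0 u2"
    and \<rho>: "0 < \<rho>" "norm u1 \<le> \<rho>" "norm u2 \<le> \<rho>" "2 * \<rho> < R" "8 * C * \<rho> < 1" "2 * \<rho> \<le> 1"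
  shows "norm (chart M p (\<gamma>1 1) - chart M p (\<gamma>2 1)) \<le> 2 * norm (u1 - u2)"
proof -
  have C: "C > 0" using bd by (auto simp: acc_bound_def)
  have \<rho>4: "4 * C * \<rho> < 1" using \<rho>(5) mult_pos_pos[OF C \<rho>(1)] by simp
  define c where "c = chart M p \<circ> \<gamma>1"
  define e where "e = chart M p \<circ> \<gamma>2"
  obtain c' c'' where c: "c 0 = centre" "c' 0 = u1"
    "\<And>t. t \<in> {0..1} \<Longrightarrow> \<gamma>1 t \<in> cdom M p \<and> c t \<in> cball centre R \<inter> W \<and> norm (c' t) \<le> 2 * \<rho> \<and>
       (c has_vector_derivative c' t) (at t within {0..1}) \<and>
       (c' has_vector_derivative c'' t) (at t within {0..1}) \<and> geodesic_acc (c t) (c' t) (c'' t)"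
    using geodesic_stays[OF bd geo1 \<rho>(1,2,4) \<rho>4] unfolding c_def by blast
  obtain e' e'' where e: "e 0 = centre" "e' 0 = u2"
    "\<And>t. t \<in> {0..1} \<Longrightarrow> \<gamma>2 t \<in> cdom M p \<and> e t \<in> cball centre R \<inter> W \<and> norm (e' t) \<le> 2 * \<rho> \<and>
       (e has_vector_derivative e' t) (at t within {0..1}) \<and>
       (e' has_vector_derivative e'' t) (at t within {0..1}) \<and> geodesic_acc (e t) (e' t) (e'' t)"
    using geodesic_stays[OF bd geo2 \<rho>(1,3,4) \<rho>4] unfolding e_def by blast
  have "continuous_on {0..1} c'" "continuous_on {0..1} e'"
    unfolding continuous_on_eq_continuous_within
    using c(3) e(3) has_vector_derivative_continuous by blast+
  then have "continuous_on {0..1} (\<lambda>t. norm (c' t - e' t))" by (intro continuous_intros)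
  \<comment> \<open>D is the maximal difference of velocities. Positions then differ by at most D
    and accelerations by at most C * (2 * \<rho>) * (2 * D) \<le> D / 2, so D \<le>
    \<open>norm (u1 - u2)\<close> + D / 2 and half of D is absorbed.\<close>
  then obtain s0 where s0: "s0 \<in> {0..1}" "\<And>t. t \<in> {0..1} \<Longrightarrow> norm (c' t - e' t) \<le> norm (c' s0 - e' s0)"
    using continuous_attains_sup[of "{0..1::real}" "\<lambda>t. norm (c' t - e' t)"] by auto
  define D where "D = norm (c' s0 - e' s0)"
  have D0: "D \<ge> 0" by (simp add: D_def)
  have pos: "norm (c t - e t) \<le> D" if t: "t \<in> {0..1}" for t
  proof -
    have "norm ((c t - e t) - (c 0 - e 0)) \<le> D * t"
    proof (rule vector_mvt[of t "\<lambda>t. c t - e t" "\<lambda>t. c' t - e' t"])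
      fix r assume r: "r \<in> {0..t}"
      then have "r \<in> {0..1}" using t by simp
      then show "norm (c' r - e' r) \<le> D" using s0(2) by (simp add: D_def)
      have "(c has_vector_derivative c' r) (at r within {0..t})" "(e has_vector_derivative e' r) (at r within {0..t})"
        using c(3)[OF \<open>r \<in> {0..1}\<close>] e(3)[OF \<open>r \<in> {0..1}\<close>] t by (auto intro: has_vector_derivative_within_subset)
      then show "((\<lambda>t. c t - e t) has_vector_derivative c' r - e' r) (at r within {0..t})"
        by (rule has_vector_derivative_diff)
    qed (use t in simp)
    also have "\<dots> \<le> D * 1" using D0 t by (intro mult_left_mono) auto
    finally show ?thesis by (simp add: c(1) e(1))
  qed
  have accd: "norm (c'' t - e'' t) \<le> D / 2" if t: "t \<in> {0..1}" for t
  proof -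
    have "norm (c'' t - e'' t) \<le> C * (2 * \<rho>) * (norm (c t - e t) + norm (c' t - e' t))"
      using acc_boundD(2)[OF bd] c(3)[OF t] e(3)[OF t] \<rho>(6) by blast
    also have "\<dots> \<le> C * (2 * \<rho>) * (D + D)"
      using pos[OF t] s0(2)[OF t] C \<rho> by (intro mult_left_mono add_mono) (auto simp: D_def)
    also have "\<dots> = (8 * C * \<rho>) * (D / 2)" by simp
    also have "\<dots> \<le> 1 * (D / 2)" using \<rho>(5) D0 by (intro mult_right_mono) auto
    finally show ?thesis by simp
  qed
  have "norm ((c' s0 - e' s0) - (c' 0 - e' 0)) \<le> D / 2 * s0"
  proof (rule vector_mvt[of s0 "\<lambda>t. c' t - e' t" "\<lambda>t. c'' t - e'' t"])
    fix r assume r: "r \<in> {0..s0}"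
    then have "r \<in> {0..1}" using s0(1) by simp
    then show "norm (c'' r - e'' r) \<le> D / 2" by (rule accd)
    have "(c' has_vector_derivative c'' r) (at r within {0..s0})" "(e' has_vector_derivative e'' r) (at r within {0..s0})"
      using c(3)[OF \<open>r \<in> {0..1}\<close>] e(3)[OF \<open>r \<in> {0..1}\<close>] s0(1) by (auto intro: has_vector_derivative_within_subset)
    then show "((\<lambda>t. c' t - e' t) has_vector_derivative c'' r - e'' r) (at r within {0..s0})"
      by (rule has_vector_derivative_diff)
  qed (use s0 in simp)
  also have "\<dots> \<le> D / 2 * 1" using D0 s0(1) by (intro mult_left_mono) auto
  finally have "D \<le> norm (u1 - u2) + D / 2"
    using norm_triangle_sub[of "c' s0 - e' s0" "c' 0 - e' 0"] by (simp add: D_def c(2) e(2))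
  then show ?thesis using pos[of 1] by (simp add: c_def e_def)
qed

text \<open>The quadratic error uses the speed scale \<rho> = \<open>norm u\<close>, which must be
  positive; this is why u = 0 is excluded there. The Lipschitz bound uses the fixed scale r. With
  equal initial vectors the dependence estimate also gives uniqueness of the endpoint, so that
  \<open>rexp\<close> satisfies \<open>exp_rel\<close>.\<close>

lemma exp_estimates:
  obtains r C where "r > 0" "C > 0"
    "\<And>u. u \<in> exp_dom M p \<Longrightarrow> u \<noteq> 0 \<Longrightarrow> norm u \<le> r \<Longrightarrow>
       rexp M p u \<in> cdom M p \<and> norm (chart M p (rexp M p u) - centre - u) \<le> C * (norm u)\<^sup>2"
    "\<And>u v. u \<in> exp_dom M p \<Longrightarrow> v \<in> exp_dom M p \<Longrightarrow> norm u \<le> r \<Longrightarrow> norm v \<le> r \<Longrightarrow>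
       norm (chart M p (rexp M p u) - chart M p (rexp M p v)) \<le> 2 * norm (u - v)"
proof -
  obtain R C where bd: "acc_bound R C" using acceleration by blast
  have RC: "R > 0" "C > 0" using bd by (auto simp: acc_bound_def)
  \<comment> \<open>The three entries secure 2 * r < R, 8 * C * r < 1 and 2 * r \<le> 1, the
    conditions of \<open>geodesic_dependence\<close>.\<close>
  define r where "r = min (R / 3) (min (1 / (9 * C)) (1 / 2))"
  have r: "r > 0" "2 * r < R" "2 * r \<le> 1" using RC by (auto simp: r_def)
  have "8 * C * r \<le> 8 * C * (1 / (9 * C))" using RC by (intro mult_left_mono) (auto simp: r_def)
  then have r8: "8 * C * r < 1" using RC by simp
  then have r4: "4 * C * r < 1" using mult_pos_pos[OF RC(2) r(1)] by simp
  have ex: "exp_rel M p u (rexp M p u)" if u: "u \<in> exp_dom M p" "norm u \<le> r" for u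
  proof -
    have "\<exists>y. exp_rel M p u y" using u by (auto simp: exp_dom_def)
    moreover have "y = z" if yz: "exp_rel M p u y" "exp_rel M p u z" for y z
    proof -
      obtain \<gamma>1 where 1: "geodesic M {0..1} \<gamma>1" "\<gamma>1 0 = p" "velocity M {0..1} \<gamma>1 0 u" "\<gamma>1 1 = y"
        using yz(1) unfolding exp_rel_def by blast
      obtain \<gamma>2 where 2: "geodesic M {0..1} \<gamma>2" "\<gamma>2 0 = p" "velocity M {0..1} \<gamma>2 0 u" "\<gamma>2 1 = z"
        using yz(2) unfolding exp_rel_def by blast
      have "chart M p y = chart M p z"
        using geodesic_dependence[OF bd 1(1-3) 2(1-3) r(1) u(2) u(2) r(2) r8 r(3)] by (simp add: 1(4) 2(4))
      moreover have "y \<in> cdom M p" "z \<in> cdom M p"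
        using geodesic_endpoint(1)[OF bd 1(1-3) r(1) u(2) r(2) r4] geodesic_endpoint(1)[OF bd 2(1-3) r(1) u(2) r(2) r4]
        by (simp_all add: 1(4) 2(4))
      ultimately show ?thesis using chart_inj by (meson inj_onD)
    qed
    ultimately show ?thesis unfolding rexp_def by (metis theI)
  qed
  show thesis
  proof (rule that[OF r(1), of "4 * C"])
    show "4 * C > 0" using RC by simp
    fix u assume u: "u \<in> exp_dom M p" "norm u \<le> r"
    obtain \<gamma> where 1: "geodesic M {0..1} \<gamma>" "\<gamma> 0 = p" "velocity M {0..1} \<gamma> 0 u" "\<gamma> 1 = rexp M p u"
      using ex[OF u] unfolding exp_rel_def by blast
    {
      assume "u \<noteq> 0"
      have "4 * C * norm u \<le> 4 * C * r" using u RC by (intro mult_left_mono) auto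
      then show "rexp M p u \<in> cdom M p \<and> norm (chart M p (rexp M p u) - centre - u) \<le> 4 * C * (norm u)\<^sup>2"
        using geodesic_endpoint[OF bd 1(1-3), of "norm u"] u r r4 \<open>u \<noteq> 0\<close> by (simp add: 1(4))
    next
      fix v assume v: "v \<in> exp_dom M p" "norm v \<le> r"
      obtain \<delta> where 2: "geodesic M {0..1} \<delta>" "\<delta> 0 = p" "velocity M {0..1} \<delta> 0 v" "\<delta> 1 = rexp M p v"
        using ex[OF v] unfolding exp_rel_def by blast
      show "norm (chart M p (rexp M p u) - chart M p (rexp M p v)) \<le> 2 * norm (u - v)"
        using geodesic_dependence[OF bd 1(1-3) 2(1-3) r(1) u(2) v(2) r(2) r8 r(3)] by (simp add: 1(4) 2(4))
    }
  qed
qed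

end

section \<open>Sectors\<close>

text \<open>The chain rule along a line keeps its shape: the derivative is again a function of class
  k, namely the derivative of f in the fixed direction w, restricted to the line. So the induction
  closes on itself.\<close>

lemma Ck_on_compose_line:
  fixes f :: "'e::real_normed_vector \<Rightarrow> 'c::real_normed_vector"
  assumes "Ck_on k W A f" "w \<in> W" "\<And>t. t \<in> I \<Longrightarrow> y + t *\<^sub>R w \<in> A"
  shows "Ck_on k UNIV I (\<lambda>t::real. f (y + t *\<^sub>R w))"
  using assms(1)
proof (induction k arbitrary: f)
  case 0
  then show ?case using assms(3)
    by (auto intro!: continuous_on_compose2[of A f] continuous_intros)
next
  case (Suc k)
  then obtain f' where f': "\<And>x. x \<in> A \<Longrightarrow> (f has_derivative f' x) (at x within A)"
    "\<And>w. w \<in> W \<Longrightarrow> Ck_on k W A (\<lambda>x. f' x w)" by auto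
  have lin: "linear (f' (y + t *\<^sub>R w))" if "t \<in> I" for t
    using has_derivative_linear[OF f'(1)[OF assms(3)[OF that]]] .
  show ?case unfolding Ck_on.simps
  proof (intro exI[of _ "\<lambda>t h. h *\<^sub>R f' (y + t *\<^sub>R w) w"] conjI ballI)
    fix t assume t: "t \<in> I"
    have "((\<lambda>t. y + t *\<^sub>R w) has_derivative (\<lambda>h. h *\<^sub>R w)) (at t within I)"
      by (auto intro!: derivative_eq_intros)
    then have "((\<lambda>t. f (y + t *\<^sub>R w)) has_derivative (\<lambda>h. f' (y + t *\<^sub>R w) (h *\<^sub>R w))) (at t within I)"
      by (rule has_derivative_in_compose)
        (use f'(1)[OF assms(3)[OF t]] assms(3) in \<open>blast intro: has_derivative_subset\<close>)
    then show "((\<lambda>t. f (y + t *\<^sub>R w)) has_derivative (\<lambda>h. h *\<^sub>R f' (y + t *\<^sub>R w) w)) (at t within I)"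
      by (simp add: linear_scale[OF lin[OF t]])
  next
    fix h :: real
    show "Ck_on k UNIV I (\<lambda>t. h *\<^sub>R f' (y + t *\<^sub>R w) w)"
      by (intro Ck_on_scaleR Ck_on_const Suc.IH f'(2) assms(2))
  qed
qed

text \<open>
  In contrast to \<open>cone\<close>, a sector is measured in the chart and with the Euclidean norm. Both choices
  are invisible to the sets of directions, and they make sectors open and easy to compare with curves.
\<close>

definition sector :: "('a, 'e::euclidean_space) rman \<Rightarrow> 'a \<Rightarrow> 'e \<Rightarrow> real \<Rightarrow> 'a set" where
  "sector M x v \<epsilon> = {y \<in> cdom M x. \<exists>t. 0 < t \<and> t < \<epsilon> \<and> norm (chart M x y - chart M x x - t *\<^sub>R v) < \<epsilon> * t}"

definition sector_dirs :: "('a, 'e::euclidean_space) rman \<Rightarrow> 'a \<Rightarrow> 'a set \<Rightarrow> 'e set" where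
  "sector_dirs M x X = {v \<in> unit_sphere M x. \<exists>\<epsilon>>0. sector M x v \<epsilon> \<subseteq> X}"

text \<open>Turning the axis by \<eta> displaces the point at parameter t by at most \<eta> * t, so
  an aperture larger by \<eta> compensates. This makes the sets of sector directions open.\<close>

lemma sector_subset:
  assumes "norm (v - w) \<le> \<eta>" "\<epsilon> + \<eta> \<le> \<epsilon>'"
  shows "sector M x w \<epsilon> \<subseteq> sector M x v \<epsilon>'"
proof
  fix y assume "y \<in> sector M x w \<epsilon>"
  then obtain t where y: "y \<in> cdom M x" "0 < t" "t < \<epsilon>" "norm (chart M x y - chart M x x - t *\<^sub>R w) < \<epsilon> * t"
    by (auto simp: sector_def)
  have "norm (t *\<^sub>R w - t *\<^sub>R v) \<le> \<eta> * t"
    using assms(1) y(2) by (simp add: norm_minus_commute mult.commute flip: scaleR_diff_right)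
  then have "norm (chart M x y - chart M x x - t *\<^sub>R v) < (\<epsilon> + \<eta>) * t"
    using norm_triangle_ineq[of "chart M x y - chart M x x - t *\<^sub>R w" "t *\<^sub>R w - t *\<^sub>R v"] y(4)
    by (simp add: distrib_right)
  also have "\<dots> \<le> \<epsilon>' * t" using assms(2) y(2) by (intro mult_right_mono) auto
  finally have bound: "norm (chart M x y - chart M x x - t *\<^sub>R v) < \<epsilon>' * t" .
  show "y \<in> sector M x v \<epsilon>'"
  proof -
    have "t < \<epsilon>'" using y(3) assms norm_ge_zero[of "v - w"] by linarith
    with bound y show ?thesis unfolding sector_def by blast
  qed
qed

lemma sector_mono: "\<epsilon> \<le> \<epsilon>' \<Longrightarrow> sector M x v \<epsilon> \<subseteq> sector M x v \<epsilon>'"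
  using sector_subset[of v v 0 \<epsilon> \<epsilon>' M x] by simp

lemma sector_dirs_mono:
  assumes "X \<subseteq> Y"
  shows "sector_dirs M x X \<subseteq> sector_dirs M x Y"
proof
  fix v assume "v \<in> sector_dirs M x X"
  then obtain \<epsilon> where "v \<in> unit_sphere M x" "\<epsilon> > 0" "sector M x v \<epsilon> \<subseteq> X"
    unfolding sector_dirs_def by blast
  moreover from this(3) assms have "sector M x v \<epsilon> \<subseteq> Y" by (rule subset_trans)
  ultimately show "v \<in> sector_dirs M x Y" unfolding sector_dirs_def by blast
qed

lemma sector_dirs_Int: "sector_dirs M x (X \<inter> Y) = sector_dirs M x X \<inter> sector_dirs M x Y"
proof (intro subset_antisym subsetI)
  fix v assume v: "v \<in> sector_dirs M x X \<inter> sector_dirs M x Y"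
  then obtain \<epsilon> \<epsilon>' where "\<epsilon> > 0" "sector M x v \<epsilon> \<subseteq> X" "\<epsilon>' > 0" "sector M x v \<epsilon>' \<subseteq> Y"
    by (auto simp: sector_dirs_def)
  moreover from this have "sector M x v (min \<epsilon> \<epsilon>') \<subseteq> X \<inter> Y"
    using sector_mono[of "min \<epsilon> \<epsilon>'" \<epsilon> M x v] sector_mono[of "min \<epsilon> \<epsilon>'" \<epsilon>' M x v] by (simp; blast)
  moreover have "min \<epsilon> \<epsilon>' > 0" using calculation by simp
  ultimately show "v \<in> sector_dirs M x (X \<inter> Y)" using v unfolding sector_dirs_def by blast
qed (use sector_dirs_mono[of "X \<inter> Y"] in blast)

lemma openin_sector_dirs: "openin (top_of_set (unit_sphere M x)) (sector_dirs M x X)"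
  unfolding openin_euclidean_subtopology_iff
proof (intro conjI ballI)
  fix v assume v: "v \<in> sector_dirs M x X"
  then obtain \<epsilon> where \<epsilon>: "\<epsilon> > 0" "sector M x v \<epsilon> \<subseteq> X" by (auto simp: sector_dirs_def)
  show "\<exists>e>0. \<forall>w\<in>unit_sphere M x. dist w v < e \<longrightarrow> w \<in> sector_dirs M x X"
  proof (intro exI[of _ "\<epsilon> / 2"] conjI ballI impI)
    fix w assume w: "w \<in> unit_sphere M x" "dist w v < \<epsilon> / 2"
    then have "sector M x w (\<epsilon> / 2) \<subseteq> sector M x v \<epsilon>"
      by (intro sector_subset[of _ _ "\<epsilon> / 2"]) (auto simp: dist_norm norm_minus_commute)
    then have "sector M x w (\<epsilon> / 2) \<subseteq> X" "\<epsilon> / 2 > 0" using \<epsilon> by auto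
    then show "w \<in> sector_dirs M x X" using w unfolding sector_dirs_def by blast
  qed (use \<epsilon> in simp)
qed (auto simp: sector_dirs_def)

context chart_at
begin

lemma centre_S: "centre \<in> S"
  using chart_S p_cdom .

lemma unit_sphere_W: "unit_sphere M p \<subseteq> W"
  by (auto simp: unit_sphere_def)

text \<open>In coordinates a sector is the trace on S of a union of open balls. Openness is what
  places a sector contained in a set inside the interior of this set.\<close>

lemma openin_sector: "openin (rtop M) (sector M p v \<epsilon>)"
proof -
  define A where "A = (\<Union>t\<in>{0<..<\<epsilon>}. ball (centre + t *\<^sub>R v) (\<epsilon> * t))"
  have "open A" by (auto simp: A_def)
  then have "openin (top_of_set S) (S \<inter> A)" by auto
  from openin_continuous_map_preimage[OF chart_continuous this]
  have "openin (subtopology (rtop M) (cdom M p)) {y \<in> cdom M p. chart M p y \<in> S \<inter> A}"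
    using cdom_pts by (simp add: Int_absorb1)
  then have "openin (rtop M) {y \<in> cdom M p. chart M p y \<in> S \<inter> A}"
    using cdom_open openin_trans_full by blast
  also have "{y \<in> cdom M p. chart M p y \<in> S \<inter> A} = sector M p v \<epsilon>"
    using chart_S by (auto simp: sector_def A_def dist_norm norm_minus_commute algebra_simps)
  finally show ?thesis .
qed

lemma sector_in_open:
  assumes "openin (rtop M) A" "p \<in> A"
  shows "\<exists>\<epsilon>>0. sector M p v \<epsilon> \<subseteq> A"
proof -
  have "centre \<in> chart M p ` (cdom M p \<inter> A)" using p_cdom assms(2) by blast
  then obtain r where r: "r > 0" "ball centre r \<inter> W \<subseteq> chart M p ` (cdom M p \<inter> A)"
    using chart_open[OF assms(1)] by (meson openin_contains_ball)
  \<comment> \<open>A point of the sector at parameter t has coordinate distance less than t * (norm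
    v + 1) from the centre; the entry 1 bounds the aperture, the other one the parameter.\<close>
  define \<epsilon> where "\<epsilon> = min 1 (r / (norm v + 1))"
  have pos: "norm v + 1 > 0" using norm_ge_zero[of v] by linarith
  have \<epsilon>: "\<epsilon> > 0" "\<epsilon> \<le> 1" using r pos by (auto simp: \<epsilon>_def)
  have "\<epsilon> * (norm v + 1) \<le> r / (norm v + 1) * (norm v + 1)" using pos by (intro mult_right_mono) (auto simp: \<epsilon>_def)
  then have \<epsilon>r: "\<epsilon> * (norm v + 1) \<le> r" using pos by simp
  have "sector M p v \<epsilon> \<subseteq> A"
  proof
    fix y assume "y \<in> sector M p v \<epsilon>"
    then obtain t where y: "y \<in> cdom M p" "0 < t" "t < \<epsilon>" "norm (chart M p y - centre - t *\<^sub>R v) < \<epsilon> * t"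
      by (auto simp: sector_def)
    have "norm (chart M p y - centre) \<le> norm (chart M p y - centre - t *\<^sub>R v) + norm (t *\<^sub>R v)"
      by (metis norm_triangle_sub add.commute diff_add_cancel norm_triangle_ineq)
    also have "\<dots> < 1 * t + t * norm v"
    proof -
      have "\<epsilon> * t \<le> 1 * t" using y \<epsilon> by (intro mult_right_mono) auto
      moreover have "norm (t *\<^sub>R v) = t * norm v" using y by simp
      ultimately show ?thesis using y(4) by linarith
    qed
    also have "\<dots> = t * (norm v + 1)" by (simp add: algebra_simps)
    also have "\<dots> \<le> \<epsilon> * (norm v + 1)" using y pos by (intro mult_right_mono) auto
    finally have "chart M p y \<in> ball centre r \<inter> W"
      using \<epsilon>r chart_S[OF y(1)] S_W by (auto simp: dist_norm norm_minus_commute)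
    then obtain z where "z \<in> cdom M p \<inter> A" "chart M p y = chart M p z" using r by blast
    then show "y \<in> A" using chart_inj y(1) by (metis IntD1 IntD2 inj_onD)
  qed
  then show ?thesis using \<epsilon> by blast
qed

lemma sector_dirs_open:
  assumes "openin (rtop M) A" "p \<in> A"
  shows "sector_dirs M p A = unit_sphere M p"
proof -
  have "\<exists>\<epsilon>>0. sector M p v \<epsilon> \<subseteq> A" for v by (rule sector_in_open[OF assms])
  then show ?thesis by (simp add: sector_dirs_def)
qed

section \<open>Straight lines in the chart and smooth curves through a point\<close>

lemma line_in_chart:
  assumes "w \<in> W"
  obtains \<eta> where "\<eta> > 0" "\<And>t. t \<in> {0..<\<eta>} \<Longrightarrow> centre + t *\<^sub>R w \<in> S"
proof -
  obtain r where r: "r > 0" "ball centre r \<inter> W \<subseteq> S" using S centre_S by (meson openin_contains_ball)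
  have pos: "norm w + 1 > 0" using norm_ge_zero[of w] by linarith
  show thesis
  proof (rule that[of "r / (norm w + 1)"])
    show "r / (norm w + 1) > 0" using r pos by simp
    fix t assume t: "t \<in> {0..<r / (norm w + 1)}"
    then have "t * (norm w + 1) < r" using pos by (simp add: field_simps)
    then have "norm (t *\<^sub>R w) < r" using t by (simp add: algebra_simps)
    then have "centre + t *\<^sub>R w \<in> ball centre r \<inter> W"
      using W assms centre_S S_W by (auto simp: dist_norm intro: subspace_add subspace_scale)
    then show "centre + t *\<^sub>R w \<in> S" using r by blast
  qed
qed

lemma line_curve:
  assumes w: "w \<in> W" and \<eta>: "\<eta> > 0" "\<And>t. t \<in> {0..<\<eta>} \<Longrightarrow> centre + t *\<^sub>R w \<in> S"
  defines "\<gamma> \<equiv> \<lambda>t. cinv M p (centre + t *\<^sub>R w)"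
  shows "smooth_curve M {0..<\<eta>} \<gamma>" "\<gamma> 0 = p" "velocity M {0..<\<eta>} \<gamma> 0 w"
proof -
  show \<gamma>0: "\<gamma> 0 = p" using cinv_chart[OF p_cdom] by (simp add: \<gamma>_def)
  have "continuous_map (top_of_set {0..<\<eta>}) (top_of_set S) (\<lambda>t. centre + t *\<^sub>R w)"
    using \<eta>(2) by (auto intro!: continuous_intros)
  then have "continuous_map (top_of_set {0..<\<eta>}) (rtop M) \<gamma>"
    using continuous_map_compose[OF _ cinv_continuous] unfolding \<gamma>_def o_def by blast
  \<comment> \<open>\<open>smooth_curve\<close> asks for smoothness in every chart; in the chart at
    q the curve is the transition evaluated along a line.\<close>
  moreover have "smooth_on UNIV {t \<in> {0..<\<eta>}. \<gamma> t \<in> cdom M q} (chart M q \<circ> \<gamma>)" if q: "q \<in> pts M" for q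
    unfolding smooth_on_def
  proof
    fix k
    have *: "centre + t *\<^sub>R w \<in> chart M p ` (cdom M p \<inter> cdom M q)" if "t \<in> {t \<in> {0..<\<eta>}. \<gamma> t \<in> cdom M q}" for t
    proof -
      have "chart M p (\<gamma> t) = centre + t *\<^sub>R w" "\<gamma> t \<in> cdom M p" "\<gamma> t \<in> cdom M q"
        using that \<eta>(2) chart_cinv cinv_cdom by (auto simp: \<gamma>_def)
      then show ?thesis by (metis IntI imageI)
    qed
    have "chart M q \<circ> \<gamma> = (\<lambda>t. transition M p q (centre + t *\<^sub>R w))"
      by (auto simp: transition_def \<gamma>_def)
    then show "Ck_on k UNIV {t \<in> {0..<\<eta>}. \<gamma> t \<in> cdom M q} (chart M q \<circ> \<gamma>)"
      using Ck_on_compose_line[OF transition_smooth[OF q] w *, of "{t \<in> {0..<\<eta>}. \<gamma> t \<in> cdom M q}"] by simp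
  qed
  ultimately show "smooth_curve M {0..<\<eta>} \<gamma>" by (simp add: smooth_curve_def)
  have "((\<lambda>t. centre + t *\<^sub>R w) has_vector_derivative w) (at 0 within {0..<\<eta>})"
    by (auto intro!: derivative_eq_intros)
  then have "(chart M p \<circ> \<gamma> has_vector_derivative w) (at 0 within {0..<\<eta>})"
    by (rule has_vector_derivative_transform[rotated 2]) (use \<eta> chart_cinv in \<open>auto simp: \<gamma>_def\<close>)
  then show "velocity M {0..<\<eta>} \<gamma> 0 w" by (simp add: velocity_def \<gamma>0)
qed

lemma sector_line:
  assumes v: "v \<in> W" and \<epsilon>: "\<epsilon> > 0"
  obtains \<eta> \<gamma> where "\<eta> > 0" "smooth_curve M {0..<\<eta>} \<gamma>" "\<gamma> 0 = p" "velocity M {0..<\<eta>} \<gamma> 0 v"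
    "\<And>t. 0 < t \<Longrightarrow> t < \<eta> \<Longrightarrow> \<gamma> t \<in> sector M p v \<epsilon>"
proof -
  obtain \<eta> where \<eta>: "\<eta> > 0" "\<And>t. t \<in> {0..<\<eta>} \<Longrightarrow> centre + t *\<^sub>R v \<in> S"
    using line_in_chart[OF v] by metis
  define \<eta>' where "\<eta>' = min \<eta> \<epsilon>"
  have \<eta>': "\<eta>' > 0" "\<And>t. t \<in> {0..<\<eta>'} \<Longrightarrow> centre + t *\<^sub>R v \<in> S" using \<eta> \<epsilon> by (auto simp: \<eta>'_def)
  show thesis
  proof (rule that[OF \<eta>'(1) line_curve[OF v \<eta>']])
    fix t assume t: "0 < t" "t < \<eta>'"
    then have "centre + t *\<^sub>R v \<in> S" using \<eta>'(2) by simp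
    then show "cinv M p (centre + t *\<^sub>R v) \<in> sector M p v \<epsilon>"
      using t \<epsilon> unfolding sector_def by (auto simp: chart_cinv cinv_cdom \<eta>'_def intro!: exI[of _ t])
  qed
qed

lemma sector_dirs_U_set:
  assumes "p \<in> X" shows "sector_dirs M p X \<subseteq> U_set M p X"
proof
  fix v assume v: "v \<in> sector_dirs M p X"
  then obtain \<epsilon> where \<epsilon>: "\<epsilon> > 0" "sector M p v \<epsilon> \<subseteq> X" and u: "v \<in> unit_sphere M p"
    by (auto simp: sector_dirs_def)
  have vW: "v \<in> W" using u unit_sphere_W by blast
  obtain \<eta> \<gamma> where *: "\<eta> > 0" "smooth_curve M {0..<\<eta>} \<gamma>" "\<gamma> 0 = p" "velocity M {0..<\<eta>} \<gamma> 0 v"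
    "\<And>t. 0 < t \<Longrightarrow> t < \<eta> \<Longrightarrow> \<gamma> t \<in> sector M p v \<epsilon>"
    using sector_line[OF vW \<epsilon>(1)] by metis
  have "\<gamma> ` {0..<\<eta>} \<subseteq> X"
  proof
    fix y assume "y \<in> \<gamma> ` {0..<\<eta>}"
    then obtain t where "y = \<gamma> t" "0 \<le> t" "t < \<eta>" by auto
    then show "y \<in> X" using *(3,5) \<epsilon>(2) assms by (cases "t = 0") auto
  qed
  then show "v \<in> U_set M p X" unfolding U_set_def using * u by blast
qed

text \<open>Every sector contains points of a line issuing from p. If p were outside the closed set
  X, some small sector would lie both in X and in its complement and hence be empty.\<close>

lemma sector_dirs_closure:
  assumes "sector_dirs M p X \<noteq> {}" "closedin (rtop M) X"
  shows "p \<in> X"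
proof (rule ccontr)
  assume "p \<notin> X"
  then have A: "openin (rtop M) (pts M - X)" "p \<in> pts M - X" using assms(2) p by auto
  obtain v where v: "v \<in> sector_dirs M p X" using assms by blast
  then have "v \<in> sector_dirs M p (pts M - X)"
    using sector_dirs_open[OF A] by (auto simp: sector_dirs_def)
  with v have "v \<in> sector_dirs M p (X \<inter> (pts M - X))" unfolding sector_dirs_Int by (rule IntI)
  then obtain \<epsilon> where \<epsilon>: "\<epsilon> > 0" "sector M p v \<epsilon> = {}" "v \<in> W"
    using unit_sphere_W by (auto simp: sector_dirs_def)
  obtain \<eta> \<gamma> where *: "\<eta> > 0" "smooth_curve M {0..<\<eta>} \<gamma>" "\<gamma> 0 = p" "velocity M {0..<\<eta>} \<gamma> 0 v"
    "\<And>t. 0 < t \<Longrightarrow> t < \<eta> \<Longrightarrow> \<gamma> t \<in> sector M p v \<epsilon>"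
    using sector_line[OF \<epsilon>(3,1)] by metis
  from *(5)[of "\<eta> / 2"] *(1) \<epsilon>(2) show False by simp
qed

text \<open>Differentiability at 0 says that c t - c 0 - t v is o(t), which is eventually below the
  aperture \<epsilon> * t.\<close>

lemma curve_enters_sector:
  assumes \<gamma>: "smooth_curve M {0..<\<eta>} \<gamma>" "\<gamma> 0 = p" "velocity M {0..<\<eta>} \<gamma> 0 v" and "\<eta> > 0" "\<epsilon> > 0"
  obtains t where "0 < t" "t < \<eta>" "\<gamma> t \<in> sector M p v \<epsilon>"
proof -
  have cm: "continuous_map (top_of_set {0..<\<eta>}) (rtop M) \<gamma>" using \<gamma>(1) by (simp add: smooth_curve_def)
  have "openin (top_of_set {0..<\<eta>}) {t\<in>{0..<\<eta>}. \<gamma> t \<in> cdom M p}"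
    using openin_continuous_map_preimage[OF cm cdom_open] by simp
  moreover have "0 \<in> {t\<in>{0..<\<eta>}. \<gamma> t \<in> cdom M p}" using \<gamma>(2) p_cdom \<open>\<eta> > 0\<close> by simp
  ultimately obtain a where a: "a > 0" "\<And>t. t \<in> {0..<\<eta>} \<Longrightarrow> dist t 0 < a \<Longrightarrow> \<gamma> t \<in> cdom M p"
    unfolding openin_euclidean_subtopology_iff by blast
  define c where "c = chart M p \<circ> \<gamma>"
  have "(c has_derivative (\<lambda>t. t *\<^sub>R v)) (at 0 within {0..<\<eta>})"
    using \<gamma>(2,3) by (simp add: velocity_def has_vector_derivative_def c_def)
  then obtain b where b: "b > 0" "\<And>t. t \<in> {0..<\<eta>} \<Longrightarrow> norm (t - 0) < b \<Longrightarrow>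
      norm (c t - c 0 - (t - 0) *\<^sub>R v) \<le> \<epsilon> / 2 * norm (t - 0)"
    unfolding has_derivative_within_alt using \<open>\<epsilon> > 0\<close> by (meson half_gt_zero)
  define t where "t = min (min (a / 2) (b / 2)) (min (\<eta> / 2) (\<epsilon> / 2))"
  have t: "0 < t" "t < a" "t < b" "t < \<eta>" "t < \<epsilon>" using a b assms by (auto simp: t_def)
  have "norm (c t - c 0 - t *\<^sub>R v) \<le> \<epsilon> / 2 * t" using b(2)[of t] t by simp
  also have "\<dots> < \<epsilon> * t" using t \<open>\<epsilon> > 0\<close> by simp
  finally have "\<gamma> t \<in> sector M p v \<epsilon>"
    using a(2)[of t] t by (auto simp: sector_def c_def \<gamma>(2) intro!: exI[of _ t])
  then show thesis using that t by blast
qed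

lemma U_set_disjoint: "U_set M p X \<inter> sector_dirs M p (pts M - X) = {}"
proof (rule ccontr)
  assume "U_set M p X \<inter> sector_dirs M p (pts M - X) \<noteq> {}"
  then obtain v \<epsilon> \<eta> \<gamma> where *: "\<epsilon> > 0" "sector M p v \<epsilon> \<subseteq> pts M - X"
    "\<eta> > 0" "smooth_curve M {0..<\<eta>} \<gamma>" "\<gamma> ` {0..<\<eta>} \<subseteq> X" "\<gamma> 0 = p" "velocity M {0..<\<eta>} \<gamma> 0 v"
    unfolding U_set_def sector_dirs_def by blast
  obtain t where t: "0 < t" "t < \<eta>" "\<gamma> t \<in> sector M p v \<epsilon>"
    by (rule curve_enters_sector[OF *(4,6,7,3,1)])
  then have "\<gamma> t \<in> X" using *(5) by auto
  with t(3) *(2) show False by blast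
qed

text \<open>At distance of order t from the centre, a cone has width of order t, whereas
  \<open>rexp\<close> differs from the identity in the chart only by order t^2. For small t the
  image thus covers a slightly narrower sector.\<close>

lemma cone_exp_sector:
  assumes v: "v \<in> unit_sphere M p" and \<delta>: "\<delta> > 0" and dom: "cone M p v \<delta> \<subseteq> exp_dom M p"
  shows "\<exists>\<epsilon>>0. sector M p v \<epsilon> \<subseteq> rexp M p ` cone M p v \<delta>"
proof -
  have vW: "v \<in> W" using v unit_sphere_W by blast
  obtain G where G: "bounded_bilinear G" "\<And>u v. G u v = G v u"
    "\<And>u v. u \<in> W \<Longrightarrow> v \<in> W \<Longrightarrow> rmetric M p u v = G u v"
    using inner_product_extend[OF W metric] by metis
  have Gv: "G v v = 1" using v vW G(3) by (simp add: unit_sphere_def)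
  have v0: "v \<noteq> 0" using Gv bounded_bilinear.zero_left[OF G(1)] by force
  \<comment> \<open>f z > 0 is the aperture condition of the cone, which is invariant under positive
    scaling. At v its value is \<delta>, so it persists for nearby z.\<close>
  define f where "f z = G z v - (1 - \<delta>) * sqrt (G z z)" for z
  have cont: "isCont (\<lambda>z. G z (h z)) v" if "isCont h v" for h
    using bounded_bilinear.isCont[OF G(1) _ that, of "\<lambda>z. z"] by simp
  have "isCont f v" unfolding f_def by (intro continuous_intros cont)
  then have "(f \<longlongrightarrow> f v) (nhds v)" by (simp add: isCont_def tendsto_nhds_iff)
  moreover have "f v > 0" using Gv \<delta> by (simp add: f_def)
  ultimately have 1: "eventually (\<lambda>z. f z > 0) (nhds v)" by (rule order_tendstoD(1))
  have "((\<lambda>z. G z v) \<longlongrightarrow> G v v) (nhds v)"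
    using cont[of "\<lambda>z. v"] by (simp add: isCont_def tendsto_nhds_iff)
  then have 2: "eventually (\<lambda>z. G z v < 2) (nhds v)"
    using order_tendstoD(2)[of _ "G v v" _ 2] Gv by simp
  from eventually_conj[OF 1 2] obtain e0 where e0: "e0 > 0" "\<And>z. dist z v < e0 \<Longrightarrow> f z > 0 \<and> G z v < 2"
    unfolding eventually_nhds_metric by blast
  \<comment> \<open>e \<le> 1 gives \<open>norm z\<close> \<le> B, and e \<le> \<open>norm v\<close>
    keeps z different from 0, for z within distance e of v.\<close>
  define e where "e = min e0 (min 1 (norm v))"
  have e: "e > 0" "e \<le> 1" "e \<le> norm v" "\<And>z. dist z v < e \<Longrightarrow> f z > 0 \<and> G z v < 2"
    using e0 v0 by (auto simp: e_def)
  have tn: "tnorm M p z = sqrt (G z z)" if "z \<in> W" for z using G(3) that by (simp add: tnorm_def)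
  have cone: "t *\<^sub>R z \<in> cone M p v \<delta>" if z: "z \<in> W" "dist z v < e" and t: "0 < t" "t < \<delta> / 2" for t z
  proof -
    have tz: "t *\<^sub>R z \<in> W" using z W by (simp add: subspace_scale)
    have "sqrt (G (t *\<^sub>R z) (t *\<^sub>R z)) = t * sqrt (G z z)"
      using t by (simp add: bounded_bilinear.scaleR_left[OF G(1)] bounded_bilinear.scaleR_right[OF G(1)]
          real_sqrt_mult flip: mult.assoc)
    moreover have "(1 - \<delta>) * (t * sqrt (G z z)) < t * G z v"
      using e(4)[OF z(2)] t mult_strict_left_mono[of "(1 - \<delta>) * sqrt (G z z)" "G z v" t]
      by (simp add: f_def mult_ac)
    moreover have "t * G z v < \<delta>"
    proof -
      have "t * G z v < t * 2" using e(4)[OF z(2)] t by (intro mult_strict_left_mono) auto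
      then show ?thesis using t by linarith
    qed
    ultimately show ?thesis
      using tz vW by (simp add: cone_def tn Gv G(3) bounded_bilinear.scaleR_left[OF G(1)])
  qed
  obtain r C where r: "r > 0" and C: "C > 0"
    and E1: "\<And>u. u \<in> exp_dom M p \<Longrightarrow> u \<noteq> 0 \<Longrightarrow> norm u \<le> r \<Longrightarrow>
       rexp M p u \<in> cdom M p \<and> norm (chart M p (rexp M p u) - centre - u) \<le> C * (norm u)\<^sup>2"
    and E2: "\<And>u v. u \<in> exp_dom M p \<Longrightarrow> v \<in> exp_dom M p \<Longrightarrow> norm u \<le> r \<Longrightarrow> norm v \<le> r \<Longrightarrow>
       norm (chart M p (rexp M p u) - chart M p (rexp M p v)) \<le> 2 * norm (u - v)"
    using exp_estimates by metis
  define B where "B = norm v + 1"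
  have B: "B > 0" using norm_ge_zero[of v] unfolding B_def by linarith
  \<comment> \<open>e / 2 reserves half of the width for the ball K below; \<delta> / 2 meets the
    height condition of the cone, as G z v < 2; r / B makes the vectors short enough for the
    estimates; the last entry makes the error C * (t * B)^2 at most e / 2 * t, the radius of
    K.\<close>
  define \<epsilon> where "\<epsilon> = min (e / 2) (min (\<delta> / 2) (min (r / B) (e / (2 * C * B\<^sup>2))))"
  have \<epsilon>: "\<epsilon> > 0" using e \<delta> r C B by (simp add: \<epsilon>_def)
  have \<epsilon>_le: "\<epsilon> \<le> e / 2" "\<epsilon> \<le> \<delta> / 2" "\<epsilon> \<le> r / B" "\<epsilon> \<le> e / (2 * C * B\<^sup>2)"
    unfolding \<epsilon>_def by (simp_all only: min_le_iff_disj order_refl simp_thms)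
  have "sector M p v \<epsilon> \<subseteq> rexp M p ` cone M p v \<delta>"
  proof
    fix y assume "y \<in> sector M p v \<epsilon>"
    then obtain t where y: "y \<in> cdom M p" and t: "0 < t" "t < \<epsilon>"
      and yt: "norm (chart M p y - centre - t *\<^sub>R v) < \<epsilon> * t"
      by (auto simp: sector_def)
    define w where "w = chart M p y - centre"
    have wW: "w \<in> W" using chart_S[OF y] centre_S S_W W by (auto simp: w_def intro: subspace_diff)
    define K where "K = cball w (e / 2 * t) \<inter> W"
    have "\<epsilon> * t \<le> e / 2 * t" using t \<epsilon>_le by (intro mult_right_mono) simp_all
    then have wt: "norm (w - t *\<^sub>R v) < e / 2 * t" using yt by (simp add: w_def)
    have K: "u \<in> cone M p v \<delta> \<and> u \<noteq> 0 \<and> norm u \<le> t * B" if u: "u \<in> K" for u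
    proof -
      define z where "z = (1 / t) *\<^sub>R u"
      have uz: "u = t *\<^sub>R z" using t by (simp add: z_def)
      have "norm (u - t *\<^sub>R v) \<le> norm (u - w) + norm (w - t *\<^sub>R v)"
        using norm_triangle_ineq[of "u - w" "w - t *\<^sub>R v"] by simp
      also have "\<dots> < e * t" using u wt by (simp add: K_def dist_norm norm_minus_commute)
      finally have "t * norm (z - v) < t * e"
        using t unfolding uz by (simp add: mult.commute flip: scaleR_diff_right)
      then have z: "dist z v < e" using t by (simp add: dist_norm)
      have zW: "z \<in> W" using u W by (simp add: z_def K_def subspace_scale)
      have "z \<noteq> 0" using z e(3) by (auto simp: dist_norm)
      moreover have "norm z \<le> B" using z e(2) norm_triangle_sub[of z v] by (simp add: B_def dist_norm)
      moreover have "t < \<delta> / 2" using t \<epsilon>_le by linarith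
      ultimately show ?thesis using cone[OF zW z t(1)] t(1) by (simp add: uz)
    qed
    have tr: "t * B \<le> r"
    proof -
      have "t * B \<le> r / B * B" using t B \<epsilon>_le(3) by (intro mult_right_mono) linarith+
      then show ?thesis using B by simp
    qed
    \<comment> \<open>The point \<open>w\<close> is hit by \<open>F\<close> since \<open>u \<mapsto> u - F u + w\<close> has a fixed point, by Brouwer's theorem.\<close>
    define F where "F u = chart M p (rexp M p u) - centre" for u
    define T where "T u = u - F u + w" for u
    have KE: "u \<in> exp_dom M p" "norm u \<le> r" "rexp M p u \<in> cdom M p" "norm (F u - u) \<le> e / 2 * t" if "u \<in> K" for u
    proof -
      show ud: "u \<in> exp_dom M p" "norm u \<le> r" using K[OF that] dom tr by auto
      note E = E1[OF ud(1) _ ud(2)]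
      show "rexp M p u \<in> cdom M p" using E K[OF that] by blast
      have "norm (F u - u) \<le> C * (norm u)\<^sup>2" using E K[OF that] by (simp add: F_def)
      also have "\<dots> \<le> C * (t * B)\<^sup>2" using K[OF that] C by (intro mult_left_mono power_mono) auto
      also have "\<dots> = (C * B\<^sup>2 * t) * t" by (simp add: power2_eq_square)
      also have "\<dots> \<le> (C * B\<^sup>2 * (e / (2 * C * B\<^sup>2))) * t"
        using t C \<epsilon>_le(4) by (intro mult_right_mono mult_left_mono) auto
      also have "\<dots> = e / 2 * t" using C B by simp
      finally show "norm (F u - u) \<le> e / 2 * t" .
    qed
    have "compact K" "convex K"
      using W by (auto simp: K_def compact_Int_closed closed_subspace convex_Int subspace_imp_convex)
    moreover have "w \<in> K" using wW e(1) t(1) by (simp add: K_def)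
    then have "K \<noteq> {}" by blast
    moreover have "continuous_on K T"
    proof -
      have "continuous_on K F"
        unfolding continuous_on_iff
      proof (intro ballI allI impI)
        fix u and a :: real assume u: "u \<in> K" and a: "a > 0"
        show "\<exists>b>0. \<forall>u'\<in>K. dist u' u < b \<longrightarrow> dist (F u') (F u) < a"
        proof (intro exI[of _ "a / 2"] conjI ballI impI)
          fix u' assume u': "u' \<in> K" "dist u' u < a / 2"
          show "dist (F u') (F u) < a"
          proof -
            have "F u' - F u = chart M p (rexp M p u') - chart M p (rexp M p u)"
              unfolding F_def by (rule diff_diff_eq2[THEN trans]) simp
            then have "norm (F u' - F u) \<le> 2 * norm (u' - u)"
              using E2[OF KE(1)[OF u'(1)] KE(1)[OF u] KE(2)[OF u'(1)] KE(2)[OF u]] by metis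
            then show ?thesis using u'(2) unfolding dist_norm by linarith
          qed
        qed (rule half_gt_zero[OF a])
      qed
      then show ?thesis unfolding T_def
        by (intro continuous_on_add continuous_on_diff continuous_on_id continuous_on_const)
    qed
    moreover have "T ` K \<subseteq> K"
    proof
      fix x assume "x \<in> T ` K"
      then obtain u where u: "u \<in> K" "x = T u" by blast
      have "F u \<in> W" using chart_S[OF KE(3)[OF u(1)]] centre_S S_W W by (auto simp: F_def intro: subspace_diff)
      moreover have "u \<in> W" using u(1) by (simp add: K_def)
      ultimately have "x \<in> W" using wW W unfolding u(2) T_def by (intro subspace_add subspace_diff)
      moreover have "w - x = F u - u" by (simp add: u(2) T_def)
      ultimately show "x \<in> K" using KE(4)[OF u(1)] by (simp add: K_def dist_norm)
    qed
    ultimately obtain u where u: "u \<in> K" "T u = u" using brouwer[of K T] by blast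
    then have "chart M p (rexp M p u) = chart M p y" by (simp add: T_def F_def w_def)
    then have "rexp M p u = y" using chart_inj KE(3)[OF u(1)] y by (meson inj_onD)
    then show "y \<in> rexp M p ` cone M p v \<delta>" using K[OF u(1)] by blast
  qed
  then show ?thesis using \<epsilon> by blast
qed

lemma C_set_sector_dirs: "C_set M X p \<subseteq> sector_dirs M p X \<union> sector_dirs M p (pts M - X)"
proof
  fix v assume "v \<in> C_set M X p"
  then have v: "v \<in> unit_sphere M p" and ex: "\<exists>\<delta>>0. cone M p v \<delta> \<subseteq> exp_dom M p \<and>
      (rexp M p ` cone M p v \<delta> \<subseteq> X \<or> rexp M p ` cone M p v \<delta> \<subseteq> pts M - X)"
    unfolding C_set_def mem_Collect_eq by (rule conjunct1, rule conjunct2)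
  from ex obtain \<delta> where \<delta>: "\<delta> > 0" "cone M p v \<delta> \<subseteq> exp_dom M p"
    and or: "rexp M p ` cone M p v \<delta> \<subseteq> X \<or> rexp M p ` cone M p v \<delta> \<subseteq> pts M - X"
    by (elim exE conjE) (rule that)
  obtain \<epsilon> where \<epsilon>: "\<epsilon> > 0" "sector M p v \<epsilon> \<subseteq> rexp M p ` cone M p v \<delta>"
    using cone_exp_sector[OF v \<delta>] by blast
  from or show "v \<in> sector_dirs M p X \<union> sector_dirs M p (pts M - X)"
  proof
    assume "rexp M p ` cone M p v \<delta> \<subseteq> X"
    with \<epsilon> v have "v \<in> sector_dirs M p X" unfolding sector_dirs_def by auto
    then show ?thesis ..
  next
    assume "rexp M p ` cone M p v \<delta> \<subseteq> pts M - X"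
    with \<epsilon>(2) have "sector M p v \<epsilon> \<subseteq> pts M - X" by (rule subset_trans)
    with \<epsilon>(1) v have "v \<in> sector_dirs M p (pts M - X)" unfolding sector_dirs_def by auto
    then show ?thesis ..
  qed
qed

end

section \<open>Closures of direction sets\<close>

text \<open>A nonempty open subset of the interior of S meets P or Q by density, and it cannot meet
  Q. So P is dense in the interior of S, and the closures coincide, whatever S is between P and the
  complement of Q.\<close>

lemma ci_eq_closure:
  assumes P: "openin T P" "P \<subseteq> S" and Q: "S \<inter> Q = {}" and dense: "T closure_of (P \<union> Q) = topspace T"
  shows "ci T S = T closure_of P"
proof
  have "P \<subseteq> T interior_of S" using P by (simp add: interior_of_maximal)
  then show "T closure_of P \<subseteq> ci T S" unfolding ci_def by (rule closure_of_mono)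
  have "T interior_of S \<subseteq> T closure_of P"
  proof
    fix v assume v: "v \<in> T interior_of S"
    have "v \<in> topspace T" using v interior_of_subset_topspace by fast
    then have "v \<in> T closure_of (P \<union> Q)" by (simp only: dense)
    show "v \<in> T closure_of P"
      unfolding in_closure_of
    proof (intro conjI allI impI)
      fix O' assume "v \<in> O' \<and> openin T O'"
      then have "v \<in> O' \<inter> T interior_of S" "openin T (O' \<inter> T interior_of S)" using v by auto
      with \<open>v \<in> T closure_of (P \<union> Q)\<close> obtain y where "y \<in> P \<union> Q" "y \<in> O' \<inter> T interior_of S"
        unfolding in_closure_of by blast
      then show "\<exists>y. y \<in> P \<and> y \<in> O'" using Q interior_of_subset[of T S] by blast
    qed fact
  qed
  then show "ci T S \<subseteq> T closure_of P" unfolding ci_def by (simp add: closure_of_minimal)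
qed

lemma dense_Int:
  assumes "openin T A" "T closure_of A = topspace T" "T closure_of B = topspace T"
  shows "T closure_of (A \<inter> B) = topspace T"
  using closure_of_openin_Int_closure_of[OF assms(1), of B] assms openin_subset[OF assms(1)]
  by (simp add: Int_absorb2)

lemma dense_mono: "T closure_of A = topspace T \<Longrightarrow> A \<subseteq> B \<Longrightarrow> T closure_of B = topspace T"
  using closure_of_mono[of A B T] closure_of_subset_topspace[of T B] by simp

lemma rtop_usphere [simp]: "rtop (usphere M x) = top_of_set (unit_sphere M x)"
  by (simp add: usphere_def)

lemma U_set_mono:
  assumes "X \<subseteq> Y" shows "U_set M x X \<subseteq> U_set M x Y"
proof -
  have "\<gamma> ` {0..<\<epsilon>} \<subseteq> Y" if "\<gamma> ` {0..<\<epsilon>} \<subseteq> X" for \<gamma> :: "real \<Rightarrow> 'a" and \<epsilon> :: real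
    using that assms by (rule subset_trans)
  then show ?thesis unfolding U_set_def by blast
qed

lemma U_set_empty:
  assumes "x \<notin> X" shows "U_set M x X = {}"
proof -
  have "\<gamma> 0 \<in> X" if "\<gamma> ` {0..<\<epsilon>} \<subseteq> X" "\<epsilon> > 0" for \<gamma> :: "real \<Rightarrow> 'a" and \<epsilon> :: real
    using that by (simp add: image_subset_iff)
  with assms show ?thesis unfolding U_set_def by blast
qed

lemma ci_empty [simp]: "ci T {} = {}"
  by (simp add: ci_def)

lemma ci_closed:
  assumes "X = ci T X" shows "closedin T X"
  by (subst assms) (simp add: ci_def)

lemma SS_SucD:
  assumes "X \<in> SS (Suc k) M"
  shows "X \<subseteq> pts M" and "X = ci (rtop M) X" and "closedin (rtop M) X"
    and "x \<in> X \<Longrightarrow> top_of_set (unit_sphere M x) closure_of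
      (top_of_set (unit_sphere M x) interior_of C_set M X x) = unit_sphere M x"
    and "x \<in> X \<Longrightarrow> ci (top_of_set (unit_sphere M x)) (U_set M x X) \<in> SS k (usphere M x)"
proof -
  note * = assms[unfolded SS_Suc rtop_usphere topspace_euclidean_subtopology]
  show "X \<subseteq> pts M" using * by (rule conjunct1)
  show ci: "X = ci (rtop M) X" using * by (elim conjE)
  show "closedin (rtop M) X" using ci by (rule ci_closed)
  show "top_of_set (unit_sphere M x) closure_of
      (top_of_set (unit_sphere M x) interior_of C_set M X x) = unit_sphere M x"
    if "x \<in> X" using *[THEN conjunct2, THEN conjunct2, THEN conjunct1] that by (rule bspec)
  show "ci (top_of_set (unit_sphere M x)) (U_set M x X) \<in> SS k (usphere M x)"
    if "x \<in> X" using *[THEN conjunct2, THEN conjunct2, THEN conjunct2] that by (rule bspec)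
qed

section \<open>Direction sets of unions and intersections\<close>

context chart_at
begin

abbreviation "USph \<equiv> top_of_set (unit_sphere M p)"

definition dirs_dense :: "'a set \<Rightarrow> bool" where
  "dirs_dense X \<longleftrightarrow> USph closure_of (sector_dirs M p X \<union> sector_dirs M p (pts M - X)) = topspace USph"

lemma sector_dirs_U_set_closed:
  "closedin (rtop M) X \<Longrightarrow> sector_dirs M p X \<subseteq> U_set M p X"
  using sector_dirs_closure[of X] sector_dirs_U_set[of X] by blast

lemma ci_U_set:
  assumes "closedin (rtop M) X" "dirs_dense X"
  shows "ci USph (U_set M p X) = USph closure_of (sector_dirs M p X)"
  using assms U_set_disjoint[of X]
  by (intro ci_eq_closure[OF openin_sector_dirs sector_dirs_U_set_closed]) (auto simp: dirs_dense_def)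

lemma dirs_dense_Int:
  assumes "dirs_dense X" "dirs_dense Y"
  shows "USph closure_of ((sector_dirs M p X \<union> sector_dirs M p (pts M - X)) \<inter>
    (sector_dirs M p Y \<union> sector_dirs M p (pts M - Y))) = topspace USph"
  using assms unfolding dirs_dense_def by (intro dense_Int openin_Un openin_sector_dirs)

text \<open>A sector may lie in the union without lying in X or in Y, so the sector directions of
  the union can be more than those of X and Y together. These already suffice, since with the
  directions avoiding both sets they are dense.\<close>

lemma ci_U_set_Un:
  assumes X: "closedin (rtop M) X" "dirs_dense X" and Y: "closedin (rtop M) Y" "dirs_dense Y"
  shows "ci USph (U_set M p (X \<union> Y)) = ci USph (U_set M p X) \<union> ci USph (U_set M p Y)"
proof -
  have "ci USph (U_set M p (X \<union> Y)) = USph closure_of (sector_dirs M p X \<union> sector_dirs M p Y)"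
  proof (rule ci_eq_closure)
    show "openin USph (sector_dirs M p X \<union> sector_dirs M p Y)"
      by (intro openin_Un openin_sector_dirs)
    show "sector_dirs M p X \<union> sector_dirs M p Y \<subseteq> U_set M p (X \<union> Y)"
      using sector_dirs_U_set_closed[OF X(1)] sector_dirs_U_set_closed[OF Y(1)]
        U_set_mono[of X "X \<union> Y" M p] U_set_mono[of Y "X \<union> Y" M p] by blast
    have "pts M - (X \<union> Y) = (pts M - X) \<inter> (pts M - Y)" by blast
    then show "U_set M p (X \<union> Y) \<inter> (sector_dirs M p (pts M - X) \<inter> sector_dirs M p (pts M - Y)) = {}"
      using U_set_disjoint[of "X \<union> Y"] by (simp add: sector_dirs_Int)
    show "USph closure_of (sector_dirs M p X \<union> sector_dirs M p Y \<union>
        sector_dirs M p (pts M - X) \<inter> sector_dirs M p (pts M - Y)) = topspace USph"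
      by (rule dense_mono[OF dirs_dense_Int[OF X(2) Y(2)]]) blast
  qed
  then show ?thesis using ci_U_set X Y by (simp add: closure_of_Un)
qed

text \<open>The same open set P and the same avoided set Q describe both sides. On the left, open
  sectors in X \<inter> Y lie in its interior and hence in Z. On the right, an open set disjoint
  from \<open>U_set M p V\<close> is also disjoint from its \<open>ci\<close>.\<close>

lemma ci_U_set_Int:
  assumes X: "closedin (rtop M) X" "dirs_dense X" and Y: "closedin (rtop M) Y" "dirs_dense Y"
  shows "ci USph (U_set M p (ci (rtop M) (X \<inter> Y))) = ci USph (ci USph (U_set M p X) \<inter> ci USph (U_set M p Y))"
proof -
  define Z where "Z = ci (rtop M) (X \<inter> Y)"
  define P where "P = sector_dirs M p X \<inter> sector_dirs M p Y"
  define Q where "Q = sector_dirs M p (pts M - X) \<union> sector_dirs M p (pts M - Y)"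
  have P: "openin USph P" unfolding P_def by (intro openin_Int openin_sector_dirs)
  have dense: "USph closure_of (P \<union> Q) = topspace USph"
    by (rule dense_mono[OF dirs_dense_Int[OF X(2) Y(2)]]) (auto simp: P_def Q_def)
  have ZXY: "Z \<subseteq> X \<inter> Y"
    unfolding Z_def ci_def using X(1) Y(1) by (intro closure_of_minimal interior_of_subset) auto
  have Zc: "closedin (rtop M) Z" by (simp add: Z_def ci_def)
  have "ci USph (U_set M p Z) = USph closure_of P"
  proof (rule ci_eq_closure[OF P _ _ dense])
    have "P \<subseteq> sector_dirs M p Z"
    proof
      fix v assume "v \<in> P"
      then have "v \<in> sector_dirs M p (X \<inter> Y)" by (simp add: P_def sector_dirs_Int)
      then obtain \<epsilon> where v: "v \<in> unit_sphere M p" "\<epsilon> > 0" "sector M p v \<epsilon> \<subseteq> X \<inter> Y"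
        unfolding sector_dirs_def by blast
      have "sector M p v \<epsilon> \<subseteq> rtop M interior_of (X \<inter> Y)"
        using v(3) openin_sector by (rule interior_of_maximal)
      also have "\<dots> \<subseteq> Z" unfolding Z_def ci_def
        by (intro closure_of_subset interior_of_subset_topspace)
      finally show "v \<in> sector_dirs M p Z" using v(1,2) unfolding sector_dirs_def by blast
    qed
    then show "P \<subseteq> U_set M p Z" using sector_dirs_U_set_closed[OF Zc] by blast
    show "U_set M p Z \<inter> Q = {}"
      using U_set_disjoint[of X] U_set_disjoint[of Y] U_set_mono[of Z X M p] U_set_mono[of Z Y M p] ZXY
      unfolding Q_def by blast
  qed
  moreover have "ci USph (ci USph (U_set M p X) \<inter> ci USph (U_set M p Y)) = USph closure_of P"
  proof (rule ci_eq_closure[OF P _ _ dense])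
    have sub: "sector_dirs M p V \<subseteq> USph closure_of (sector_dirs M p V)" for V
      by (rule closure_of_subset) (simp add: sector_dirs_def)
    show "P \<subseteq> ci USph (U_set M p X) \<inter> ci USph (U_set M p Y)"
      unfolding ci_U_set[OF X] ci_U_set[OF Y] P_def using sub by blast
    have "sector_dirs M p (pts M - V) \<inter> ci USph (U_set M p V) = {}" for V
      unfolding ci_def openin_Int_closure_of_eq_empty[OF openin_sector_dirs]
      using U_set_disjoint[of V] interior_of_subset[of USph "U_set M p V"] by blast
    then show "ci USph (U_set M p X) \<inter> ci USph (U_set M p Y) \<inter> Q = {}"
      unfolding Q_def by blast
  qed
  ultimately show ?thesis by (simp add: Z_def)
qed

lemma ci_U_set_interior:
  assumes "p \<in> rtop M interior_of X"
  shows "ci USph (U_set M p X) = unit_sphere M p"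
proof -
  have "p \<in> X" using assms interior_of_subset by fast
  have "unit_sphere M p = sector_dirs M p (rtop M interior_of X)"
    using sector_dirs_open[OF openin_interior_of assms] by simp
  also have "\<dots> \<subseteq> sector_dirs M p X" by (intro sector_dirs_mono interior_of_subset)
  also have "\<dots> \<subseteq> U_set M p X" by (rule sector_dirs_U_set) fact
  finally have "U_set M p X = topspace USph" by (auto simp: U_set_def)
  then show ?thesis unfolding ci_def by (simp only: interior_of_topspace closure_of_topspace) simp
qed

lemma unit_sphere_nonempty:
  assumes "d > 0" shows "unit_sphere M p \<noteq> {}"
proof -
  have "\<not> W \<subseteq> {0}" using assms dim_W by (metis dim_eq_0 less_numeral_extra(3))
  then obtain w where w: "w \<in> W" "w \<noteq> 0" by blast
  define c where "c = 1 / sqrt (rmetric M p w w)"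
  have pos: "rmetric M p w w > 0" using metric w unfolding inner_product_on_def by blast
  have cw: "c *\<^sub>R w \<in> W" using w W by (simp add: subspace_scale)
  have "rmetric M p (c *\<^sub>R w) (c *\<^sub>R w) = c * rmetric M p w (c *\<^sub>R w)"
    using metric w cw unfolding inner_product_on_def by blast
  also have "rmetric M p w (c *\<^sub>R w) = rmetric M p (c *\<^sub>R w) w"
    using metric w cw unfolding inner_product_on_def by blast
  also have "\<dots> = c * rmetric M p w w"
    using metric w unfolding inner_product_on_def by blast
  finally have "rmetric M p (c *\<^sub>R w) (c *\<^sub>R w) = 1"
    using pos by (simp add: c_def flip: power2_eq_square real_sqrt_mult)
  then show ?thesis using cw unfolding unit_sphere_def by blast
qed

text \<open>Condition (b) speaks only about points of X. At any other point all directions avoid X,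
  because X is closed.\<close>

lemma dirs_dense_SS:
  assumes "X \<in> SS (Suc k) M"
  shows "dirs_dense X"
proof (cases "p \<in> X")
  case True
  then have "USph closure_of (USph interior_of C_set M X p) = topspace USph"
    using SS_SucD(4)[OF assms] by simp
  moreover have "USph interior_of C_set M X p \<subseteq> sector_dirs M p X \<union> sector_dirs M p (pts M - X)"
    using interior_of_subset C_set_sector_dirs by (rule subset_trans)
  ultimately show ?thesis unfolding dirs_dense_def by (rule dense_mono)
next
  case False
  have "closedin (rtop M) X" using assms by (rule SS_SucD)
  then have "sector_dirs M p (pts M - X) = unit_sphere M p"
    using False p by (intro sector_dirs_open) auto
  then have "sector_dirs M p X \<union> sector_dirs M p (pts M - X) = topspace USph"
    by (auto simp: sector_dirs_def)
  then show ?thesis unfolding dirs_dense_def by (simp only: closure_of_topspace)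
qed

end

section \<open>The recursion for tilde\<close>

lemma tilde_empty [simp]: "tilde d M {} = {}"
  by (cases d) (auto simp: tilde_def tilde_step_def)

lemma SS_empty: "{} \<in> SS d M"
  by (cases d) (simp_all add: SS_0 SS_Suc)

text \<open>The condition that x lies in X can be absorbed: off X there are no directions, and the
  empty set has empty image. The fibre over every x is thus given by one formula, which allows the
  identities to be compared pointwise.\<close>

lemma tilde_Suc_mem:
  "(x, vs) \<in> tilde (Suc d) M X \<longleftrightarrow>
    (\<exists>w ws. vs = w # ws \<and> (w, ws) \<in> tilde d (usphere M x) (ci (top_of_set (unit_sphere M x)) (U_set M x X)))"
proof (cases "x \<in> X")
  case True
  then show ?thesis unfolding tilde_Suc rtop_usphere by blast
next
  case False
  then have "U_set M x X = {}" by (rule U_set_empty)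
  with False show ?thesis unfolding tilde_Suc by simp
qed

text \<open>Charts take values in {0} and are injective, so every chart domain is a single point and
  the topology is discrete. Hence \<open>ci\<close> is the identity in the base case.\<close>

lemma riemannian_manifold_0_discrete:
  assumes M: "riemannian_manifold 0 M" and A: "A \<subseteq> pts M"
  shows "ci (rtop M) A = A"
proof -
  have op: "openin (rtop M) B" if B: "B \<subseteq> pts M" for B
  proof (subst openin_subopen, intro ballI)
    fix p assume "p \<in> B"
    then interpret chart_at M 0 p using M B by unfold_locales auto
    have "W \<subseteq> {0}" using dim_W by simp
    then have S0: "S \<subseteq> {0}" using S_W by blast
    have "cdom M p \<subseteq> {p}"
    proof
      fix q assume q: "q \<in> cdom M p"
      have "chart M p q = chart M p p"
        using subsetD[OF S0 chart_S[OF q]] subsetD[OF S0 chart_S[OF p_cdom]] by simp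
      then show "q \<in> {p}" using chart_inj q p_cdom by (simp add: inj_on_eq_iff)
    qed
    then show "\<exists>V. openin (rtop M) V \<and> p \<in> V \<and> V \<subseteq> B" using cdom_open p_cdom \<open>p \<in> B\<close> by blast
  qed
  have "closedin (rtop M) A" unfolding closedin_def using A op[of "pts M - A"] by blast
  then show ?thesis using op[OF A] by (simp add: ci_def interior_of_openin closure_of_closedin)
qed

section \<open>Induction on the dimension\<close>

definition tilde_props :: "nat \<Rightarrow> ('a, 'e::euclidean_space) rman \<Rightarrow> bool" where
  "tilde_props d M \<longleftrightarrow> inj_on (tilde d M) (SS d M) \<and>
    (\<forall>X\<in>SS d M. tilde d M X \<subseteq> frames d M) \<and>
    (\<forall>X\<in>SS d M. \<forall>Y\<in>SS d M.
       tilde d M X \<union> tilde d M Y = tilde d M (X \<union> Y) \<and>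
       tilde d M X \<inter> tilde d M Y = tilde d M (ci (rtop M) (X \<inter> Y)))"

lemma tilde_props_0:
  assumes "riemannian_manifold 0 M"
  shows "tilde_props 0 M"
proof -
  have t: "tilde 0 M X = X \<times> {[]}" for X by (simp add: tilde_def)
  have c: "ci (rtop M) (X \<inter> Y) = X \<inter> Y" if "X \<subseteq> pts M" for X Y
    using riemannian_manifold_0_discrete[OF assms, of "X \<inter> Y"] that by blast
  show ?thesis unfolding tilde_props_def SS_0 t frames_0
    by (auto simp: inj_on_def c)
qed

text \<open>An explicit left inverse, from which injectivity is read off. The closure is essential:
  a point of X whose set of directions has empty interior, such as the tip of a cusp, has an empty
  fibre and is no base point of the image.\<close>

lemma tilde_Suc_closure:
  assumes M: "riemannian_manifold (Suc d) M" and IH: "\<And>x. x \<in> pts M \<Longrightarrow> tilde_props d (usphere M x)"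
    and X: "X \<in> SS (Suc d) M"
  shows "rtop M closure_of (fst ` tilde (Suc d) M X) = X"
proof
  have Xc: "X = rtop M closure_of (rtop M interior_of X)" using SS_SucD(2)[OF X] unfolding ci_def .
  have "closedin (rtop M) X" using X by (rule SS_SucD)
  then show "rtop M closure_of (fst ` tilde (Suc d) M X) \<subseteq> X"
    by (intro closure_of_minimal) (auto simp: tilde_Suc)
  have "rtop M interior_of X \<subseteq> fst ` tilde (Suc d) M X"
  proof
    fix x assume x: "x \<in> rtop M interior_of X"
    then have xX: "x \<in> X" using interior_of_subset by fast
    have xM: "x \<in> pts M" using x interior_of_subset_topspace by fast
    interpret chart_at M "Suc d" x using M xM by unfold_locales
    have "unit_sphere M x \<in> SS d (usphere M x)"
      using SS_SucD(5)[OF X xX] unfolding ci_U_set_interior[OF x] .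
    moreover have "inj_on (tilde d (usphere M x)) (SS d (usphere M x))"
      using IH[OF xM] by (simp add: tilde_props_def)
    \<comment> \<open>The injectivity one dimension below also shows that a nonempty set has a nonempty image.\<close>
    ultimately have "tilde d (usphere M x) (unit_sphere M x) \<noteq> tilde d (usphere M x) {}"
      using SS_empty unit_sphere_nonempty by (metis inj_onD zero_less_Suc)
    then obtain w ws where "(w, ws) \<in> tilde d (usphere M x) (unit_sphere M x)" by auto
    then have "(x, w # ws) \<in> tilde (Suc d) M X"
      unfolding tilde_Suc_mem ci_U_set_interior[OF x] by blast
    then show "x \<in> fst ` tilde (Suc d) M X" by force
  qed
  then show "X \<subseteq> rtop M closure_of (fst ` tilde (Suc d) M X)"
    by (subst Xc) (rule closure_of_mono)
qed

lemma tilde_props_Suc: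
  assumes M: "riemannian_manifold (Suc d) M" and IH: "\<And>x. x \<in> pts M \<Longrightarrow> tilde_props d (usphere M x)"
  shows "tilde_props (Suc d) M"
  unfolding tilde_props_def
proof (intro conjI ballI)
  show "inj_on (tilde (Suc d) M) (SS (Suc d) M)"
    by (rule inj_on_inverseI) (rule tilde_Suc_closure[OF assms])
next
  fix X assume X: "X \<in> SS (Suc d) M"
  have "(w, ws) \<in> frames d (usphere M x)"
    if "x \<in> X" "(w, ws) \<in> tilde d (usphere M x) (ci (rtop (usphere M x)) (U_set M x X))" for x w ws
  proof -
    have "x \<in> pts M" "ci (rtop (usphere M x)) (U_set M x X) \<in> SS d (usphere M x)"
      using SS_SucD(1)[OF X] SS_SucD(5)[OF X that(1)] that(1) by auto
    then show ?thesis using IH that(2) unfolding tilde_props_def by blast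
  qed
  moreover have "X \<subseteq> pts M" using X by (rule SS_SucD)
  ultimately show "tilde (Suc d) M X \<subseteq> frames (Suc d) M"
    unfolding tilde_Suc frames_Suc by blast
next
  fix X Y assume X: "X \<in> SS (Suc d) M" and Y: "Y \<in> SS (Suc d) M"
  define Z where "Z = ci (rtop M) (X \<inter> Y)"
  \<comment> \<open>F x V is the fibre over x of the image of V, with x removed from the tuples; it
    is empty for x outside V.\<close>
  define F where "F x V = tilde d (usphere M x) (ci (top_of_set (unit_sphere M x)) (U_set M x V))" for x V
  have cl: "closedin (rtop M) X" "closedin (rtop M) Y" using X Y by (auto intro: SS_SucD)
  have XYM: "X \<subseteq> pts M" "Y \<subseteq> pts M" using SS_SucD(1)[OF X] SS_SucD(1)[OF Y] .
  have ZXY: "Z \<subseteq> X \<inter> Y"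
    unfolding Z_def ci_def using cl by (intro closure_of_minimal interior_of_subset) auto
  have F0: "F x V = {}" if "x \<notin> V" for x V using that by (simp add: F_def U_set_empty)
  have F: "F x X \<union> F x Y = F x (X \<union> Y) \<and> F x X \<inter> F x Y = F x Z" for x
  proof (cases "x \<in> pts M")
    case False
    then show ?thesis using XYM ZXY F0[of x] by blast
  next
    case True
    interpret chart_at M "Suc d" x using M True by unfold_locales
    note * = cl(1) dirs_dense_SS[OF X] cl(2) dirs_dense_SS[OF Y]
    have SS: "ci USph (U_set M x V) \<in> SS d (usphere M x)" if "V \<in> SS (Suc d) M" "x \<in> V" for V
      using that by (rule SS_SucD)
    have U: "F x (X \<union> Y) = tilde d (usphere M x) (ci USph (U_set M x X) \<union> ci USph (U_set M x Y))"
      unfolding F_def ci_U_set_Un[OF *] ..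
    \<comment> \<open>Condition (c) provides members of the lower collection only when x lies in
      both sets; in the other cases one fibre and the fibre of Z are empty.\<close>
    consider "x \<notin> X" | "x \<notin> Y" | "x \<in> X" "x \<in> Y" by blast
    then show ?thesis
    proof cases
      case 1
      then have "F x X = {}" "F x Z = {}" using F0 ZXY by auto
      moreover have "F x (X \<union> Y) = F x Y" unfolding U using 1 by (simp add: U_set_empty F_def)
      ultimately show ?thesis by simp
    next
      case 2
      then have "F x Y = {}" "F x Z = {}" using F0 ZXY by auto
      moreover have "F x (X \<union> Y) = F x X" unfolding U using 2 by (simp add: U_set_empty F_def)
      ultimately show ?thesis by simp
    next
      case 3
      note props = IH[OF True, unfolded tilde_props_def, THEN conjunct2, THEN conjunct2,
          THEN bspec, OF SS[OF X 3(1)], THEN bspec, OF SS[OF Y 3(2)]]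
      have "F x Z = tilde d (usphere M x) (ci USph (ci USph (U_set M x X) \<inter> ci USph (U_set M x Y)))"
        unfolding F_def Z_def ci_U_set_Int[OF *] ..
      then show ?thesis using props unfolding U by (simp add: F_def)
    qed
  qed
  have mem: "(x, vs) \<in> tilde (Suc d) M V \<longleftrightarrow> (\<exists>w ws. vs = w # ws \<and> (w, ws) \<in> F x V)" for x vs V
    unfolding tilde_Suc_mem F_def ..
  show "tilde (Suc d) M X \<union> tilde (Suc d) M Y = tilde (Suc d) M (X \<union> Y)"
  proof (rule set_eqI)
    fix z :: "'a \<times> 'b list"
    obtain x vs where z: "z = (x, vs)" by (cases z)
    show "z \<in> tilde (Suc d) M X \<union> tilde (Suc d) M Y \<longleftrightarrow> z \<in> tilde (Suc d) M (X \<union> Y)"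
      unfolding z Un_iff mem F[THEN conjunct1, symmetric] by blast
  qed
  show "tilde (Suc d) M X \<inter> tilde (Suc d) M Y = tilde (Suc d) M (ci (rtop M) (X \<inter> Y))"
  proof (rule set_eqI)
    fix z :: "'a \<times> 'b list"
    obtain x vs where z: "z = (x, vs)" by (cases z)
    show "z \<in> tilde (Suc d) M X \<inter> tilde (Suc d) M Y \<longleftrightarrow> z \<in> tilde (Suc d) M (ci (rtop M) (X \<inter> Y))"
      unfolding z Int_iff mem Z_def[symmetric] F[THEN conjunct2, symmetric] by blast
  qed
qed

text \<open>Unit spheres have points in the ambient space, so an induction over manifolds with
  points of this type stays within one type. A manifold with arbitrary points then takes one further
  step.\<close>

lemma tilde_props_euclidean:
  fixes M :: "('e, 'e::euclidean_space) rman"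
  assumes "riemannian_manifold d M"
  shows "tilde_props d M"
  using assms
proof (induction d arbitrary: M)
  case 0
  then show ?case by (rule tilde_props_0)
next
  case (Suc d)
  show ?case
    by (intro tilde_props_Suc[OF Suc.prems] Suc.IH riemannian_manifold_usphere[OF Suc.prems])
qed

theorem theorem4p4:
  fixes M :: "('a, 'e::euclidean_space) rman" and d :: nat
  assumes "riemannian_manifold d M"
  shows "inj_on (tilde d M) (SS d M) \<and>
    (\<forall>X\<in>SS d M. tilde d M X \<subseteq> frames d M) \<and>
    (\<forall>X\<in>SS d M. \<forall>Y\<in>SS d M.
       tilde d M X \<union> tilde d M Y = tilde d M (X \<union> Y) \<and>
       tilde d M X \<inter> tilde d M Y = tilde d M (ci (rtop M) (X \<inter> Y)))"
proof -
  have "tilde_props d M"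
  proof (cases d)
    case 0
    then show ?thesis using assms tilde_props_0 by simp
  next
    case (Suc k)
    then have M: "riemannian_manifold (Suc k) M" using assms by simp
    show ?thesis unfolding Suc
      by (intro tilde_props_Suc[OF M] tilde_props_euclidean riemannian_manifold_usphere[OF M])
  qed
  then show ?thesis unfolding tilde_props_def .
qed

end
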